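(* Let $\alpha\in(-\infty,-3/2)\cup\big([1/2,\infty)\setminus\mathbb{N}\big)$ and $1<p<\infty$ be fixed. Then $$\sup_{c\ge 1}\|\mathscr{I}_{\alpha,c}\|_{\ell_p(\mathbb{Z})\to L_p(\mathbb{R})}<\infty.$$
   Context: For $c>0$ and $\alpha\in\mathbb{R}\setminus\{0,1,2,\dots\}$, the one-dimensional general multiquadric $\phi_{\alpha,c}(x)=(x^2+c^2)^\alpha$ has generalized Fourier transform $$\widehat{\phi}_{\alpha,c}(\xi)=\frac{2^{1+\alpha}}{\Gamma(-\alpha)}\Big(\frac{c}{|\xi|}\Big)^{\alpha+\frac12}K_{\alpha+\frac12}(c|\xi|),\quad \xi\neq 0,$$ where $K_\nu=K_{-\nu}$ is the modified Bessel function of the second kind. Set $$\widehat{L}_{\alpha,c}(\xi)=\frac{\widehat{\phi}_{\alpha,c}(\xi)}{\sum_{j\in\mathbb{Z}}\widehat{\phi}_{\alpha,c}(\xi+2\pi j)},\quad\xi\in\mathbb{R}$$ (extended by continuity to $\xi\in2\pi\mathbb{Z}$). This is in $L_1(\mathbb{R})$, and the fundamental function is $L_{\alpha,c}(x)=\frac1{2\pi}\int_{\mathbb{R}}\widehat{L}_{\alpha,c}(\xi)e^{ix\xi}d\xi$. The cardinal interpolation operator acts on sequences $\mathbf{y}=(y_j)_{j\in\mathbb{Z}}$ by $\mathscr{I}_{\alpha,c}\mathbf{y}(x)=\sum_{j\in\mathbb{Z}}y_jL_{\alpha,c}(x-j)$, $x\in\mathbb{R}$; $\|\cdot\|_{\ell_p\to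 L_p}$ is the operator norm. *)

theory Defs
  imports "HOL-Analysis.Analysis"
begin

text \<open>Modified Bessel function of the second kind, by its standard integral representation,
  valid for all real \<open>\<nu>\<close> and \<open>x > 0\<close>. It is only used at positive arguments.\<close>

definition bessel_K :: "real \<Rightarrow> real \<Rightarrow> real" where
  "bessel_K \<nu> x = (LINT t:{0..}|lborel. exp (- x * cosh t) * cosh (\<nu> * t))"

text \<open>The value at \<open>\<xi> = 0\<close> is a dummy one and is never used below.\<close>

definition multiquadric_hat :: "real \<Rightarrow> real \<Rightarrow> real \<Rightarrow> real" where
  "multiquadric_hat \<alpha> c \<xi> =
     2 powr (1 + \<alpha>) / Gamma (- \<alpha>) * (c / \<bar>\<xi>\<bar>) powr (\<alpha> + 1/2) * bessel_K (\<alpha> + 1/2) (c * \<bar>\<xi>\<bar>)"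

definition fundamental_quotient :: "real \<Rightarrow> real \<Rightarrow> real \<Rightarrow> real" where
  "fundamental_quotient \<alpha> c \<xi> =
     multiquadric_hat \<alpha> c \<xi> / (\<Sum>\<^sub>\<infinity>j\<in>(UNIV :: int set). multiquadric_hat \<alpha> c (\<xi> + 2 * pi * of_int j))"

text \<open>Off \<open>2\<pi>\<int>\<close> the quotient involves no value at \<open>0\<close> of the transform; on \<open>2\<pi>\<int>\<close>
  it is extended by continuity.\<close>

definition fundamental_hat :: "real \<Rightarrow> real \<Rightarrow> real \<Rightarrow> real" where
  "fundamental_hat \<alpha> c \<xi> =
     (if \<exists>k::int. \<xi> = 2 * pi * of_int k then Lim (at \<xi>) (fundamental_quotient \<alpha> c)
      else fundamental_quotient \<alpha> c \<xi>)"

definition fundamental_fun :: "real \<Rightarrow> real \<Rightarrow> real \<Rightarrow> complex" where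
  "fundamental_fun \<alpha> c x =
     1 / (2 * of_real pi) *
     (LINT \<xi>|lborel. of_real (fundamental_hat \<alpha> c \<xi>) * exp (\<i> * of_real x * of_real \<xi>))"

definition cardinal_interp :: "real \<Rightarrow> real \<Rightarrow> (int \<Rightarrow> complex) \<Rightarrow> real \<Rightarrow> complex" where
  "cardinal_interp \<alpha> c y x = (\<Sum>\<^sub>\<infinity>j\<in>UNIV. y j * fundamental_fun \<alpha> c (x - of_int j))"

definition ell :: "real \<Rightarrow> (int \<Rightarrow> complex) set" where
  "ell p = {y. (\<lambda>j. norm (y j) powr p) summable_on UNIV}"

definition ell_norm :: "real \<Rightarrow> (int \<Rightarrow> complex) \<Rightarrow> real" where
  "ell_norm p y = (\<Sum>\<^sub>\<infinity>j\<in>UNIV. norm (y j) powr p) powr (1 / p)"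

definition Lp :: "real \<Rightarrow> (real \<Rightarrow> complex) set" where
  "Lp p = {f \<in> borel_measurable lborel. integrable lborel (\<lambda>x. norm (f x) powr p)}"

definition Lp_norm :: "real \<Rightarrow> (real \<Rightarrow> complex) \<Rightarrow> real" where
  "Lp_norm p f = (LINT x|lborel. norm (f x) powr p) powr (1 / p)"

text \<open>The operator norm as the least admissible bound. It is \<open>\<infinity>\<close> (the infimum of the empty set)
  if the operator is unbounded or does not map \<open>\<ell>\<^sub>p\<close> into \<open>L\<^sub>p\<close>.\<close>

definition ell_Lp_opnorm :: "real \<Rightarrow> ((int \<Rightarrow> complex) \<Rightarrow> real \<Rightarrow> complex) \<Rightarrow> ennreal" where
  "ell_Lp_opnorm p T =
     Inf {ennreal C | C. 0 \<le> C \<and> (\<forall>y\<in>ell p. T y \<in> Lp p \<and> Lp_norm p (T y) \<le> C * ell_norm p y)}"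

end

theory Submission
  imports Defs "HOL-Complex_Analysis.Complex_Analysis"
begin

text \<open>
  The symbol \<open>m\<close> of the fundamental function is even with values in \<open>[0, 1]\<close>, and on each interval
  \<open>(2\<pi>k, 2\<pi>k + 2\<pi>)\<close> it is a difference of two monotone functions with values in \<open>[0, b k]\<close>, where
  \<open>b\<close> is summable and independent of \<open>c \<ge> 1\<close>. Indeed \<open>1 / m = 1 + P + Q\<close> with \<open>P\<close> and \<open>Q\<close> monotone in
  opposite directions, because every quotient \<open>g (\<xi> + d) / g \<xi>\<close> of the profile
  \<open>g \<xi> = (c \<xi>) powr (- \<nu>) * bessel_K \<nu> (c \<xi>)\<close> is monotone: increasing for \<open>\<nu> \<ge> 1\<close>, and decreasing for
  \<open>\<nu> \<le> - 1\<close>, where \<open>\<nu> = \<alpha> + 1/2\<close>. A monotone multiplier is a limit of averages of indicators of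
  intervals, so everything reduces to the operators with symbol \<open>indicator {a..b}\<close>, \<open>b - a \<le> 2\<pi>\<close>. Their
  kernel is a combination of two modulations of \<open>t / (1 + t\<^sup>2)\<close> plus an \<open>O(1 / (1 + t\<^sup>2))\<close> term.

  The convolution with \<open>t / (1 + t\<^sup>2)\<close> is the imaginary part on the line \<open>Im w = 1\<close> of
  \<open>G w = \<Sum>j. \<i> * z j / (w - j)\<close>, whose real part is the harmless convolution with \<open>1 / (1 + t\<^sup>2)\<close>. For
  \<open>z \<ge> 0\<close> the function \<open>G powr p\<close> is holomorphic in the upper half plane and integrates to zero over the
  line, which gives M. Riesz' inequality for \<open>1 < p \<le> 2\<close>; duality on the integers gives \<open>p \<ge> 2\<close>.
\<close>

section \<open>Convexity and convolution with the Poisson kernel\<close>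

text \<open>As \<open>c\<close> grows the symbol tends to the indicator of (-pi, pi), whose kernel
  is not integrable. Hence neither the L1 norm of the kernel nor the derivative of the symbol is
  bounded uniformly in \<open>c\<close>. Bounded variation survives: it comes from monotone
  quotients, which dilation by \<open>c\<close> does not affect, and \<open>c \<ge> 1\<close> enters
  only through exponential decay. The reciprocal of \<open>1 + P + Q\<close> need not be monotone,
  which is why every interval takes two monotone functions.

  The kernel t / (1 + t^2) stands in for the singular 1 / t: it is bounded and varies slowly, so
  sums over integers and integrals over the line can be exchanged at the price of a Poisson term.
  Duality takes place on the integers because there source and target are the same sequence spaces
  and an odd kernel is minus its own transpose.

  The ranges of \<alpha> give |\<nu>| \<ge> 1. For \<nu> = - \<mu> < 0 the power and the Bessel
  factor of the profile compete, and the order condition \<mu> \<ge> 1 makes K_(\<mu>-1) / K_\<mu>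
  increasing, which settles the direction.\<close>

text \<open>Young's inequality for the pair \<open>a\<close>, \<open>m powr (p - 1)\<close> is the
  tangent line inequality of the convex power in disguise; no case split at \<open>m = 0\<close>
  arises.\<close>

lemma powr_tangent:
  fixes a m p :: real
  assumes "p > 1" "a \<ge> 0" "m \<ge> 0"
  shows "m powr p + p * m powr (p - 1) * (a - m) \<le> a powr p"
proof -
  define q where "q = p / (p - 1)"
  have q: "q > 1" "1 / p + 1 / q = 1" "(p - 1) * q = p"
    using assms by (auto simp: q_def field_simps)
  have mq: "(m powr (p - 1)) powr q = m powr p"
    using q by (simp add: powr_powr)
  have mm: "m powr (p - 1) * m = m powr p"
    using assms powr_mult_base[of m "p - 1"] by (simp add: mult.commute)
  have "a * m powr (p - 1) \<le> a powr p / p + m powr p / q"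
    using Youngs_inequality[of p q a "m powr (p - 1)"] q assms mq by simp
  then have "p * (a * m powr (p - 1)) \<le> p * (a powr p / p + m powr p / q)"
    using assms by simp
  also have "\<dots> = a powr p + (p - 1) * m powr p"
    using assms by (simp add: q_def field_simps)
  finally have "p * (a * m powr (p - 1)) \<le> a powr p + (p - 1) * m powr p" .
  moreover have "p * m powr (p - 1) * (a - m) = p * (a * m powr (p - 1)) - p * m powr p"
    unfolding mm[symmetric] by argo
  ultimately show ?thesis by argo
qed

text \<open>Jensen with unnormalised weights: the tangent inequalities at the weighted mean are
  added, and the linear terms cancel. The total weight then appears with exponent
  \<open>p - 1\<close>.\<close>

lemma powr_sum_weighted_le:
  fixes a w :: "'i \<Rightarrow> real" and p :: real
  assumes "p > 1" and w: "\<And>i. i \<in> I \<Longrightarrow> w i \<ge> 0" and a: "\<And>i. i \<in> I \<Longrightarrow> a i \<ge> 0"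
  shows "(\<Sum>i\<in>I. w i * a i) powr p \<le> (\<Sum>i\<in>I. w i) powr (p - 1) * (\<Sum>i\<in>I. w i * a i powr p)"
proof (cases "(\<Sum>i\<in>I. w i) = 0")
  case True
  have "finite I \<Longrightarrow> \<forall>i\<in>I. w i = 0"
    using True w sum_nonneg_eq_0_iff[of I w] by blast
  then have "(\<Sum>i\<in>I. w i * a i) = 0"
    by (cases "finite I") auto
  then show ?thesis by (auto intro!: mult_nonneg_nonneg sum_nonneg w)
next
  case False
  define W where "W = (\<Sum>i\<in>I. w i)"
  define m where "m = (\<Sum>i\<in>I. w i * a i) / W"
  have W: "W > 0" using False w unfolding W_def by (metis less_eq_real_def sum_nonneg)
  have m0: "m \<ge> 0" unfolding m_def using W by (auto intro!: divide_nonneg_pos sum_nonneg mult_nonneg_nonneg w a)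
  have Wm: "W * m = (\<Sum>i\<in>I. w i * a i)" using W by (simp add: m_def)
  have "W * m powr p = W * m powr p + p * m powr (p - 1) * ((\<Sum>i\<in>I. w i * a i) - W * m)"
    using Wm by simp
  also have "\<dots> = (\<Sum>i\<in>I. w i * (m powr p + p * m powr (p - 1) * (a i - m)))"
    unfolding W_def by (simp add: algebra_simps sum.distrib sum_distrib_left sum_distrib_right sum_subtractf)
  also have "\<dots> \<le> (\<Sum>i\<in>I. w i * a i powr p)"
    by (intro sum_mono mult_left_mono powr_tangent assms m0 w a)
  finally have *: "W * m powr p \<le> (\<Sum>i\<in>I. w i * a i powr p)" .
  have "(\<Sum>i\<in>I. w i * a i) powr p = W powr (p - 1) * (W * m powr p)"
    using Wm[symmetric] W m0 powr_mult_base[of W "p - 1"]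
    by (simp add: powr_mult mult_ac)
  also have "\<dots> \<le> W powr (p - 1) * (\<Sum>i\<in>I. w i * a i powr p)"
    by (intro mult_left_mono *) auto
  finally show ?thesis by (simp add: W_def)
qed

lemma norm_sum_powr_le:
  fixes f :: "'i \<Rightarrow> 'a::real_normed_vector"
  assumes "p > 1"
  shows "norm (\<Sum>i\<in>I. f i) powr p \<le> real (card I) powr (p - 1) * (\<Sum>i\<in>I. norm (f i) powr p)"
proof -
  have "norm (\<Sum>i\<in>I. f i) powr p \<le> (\<Sum>i\<in>I. 1 * norm (f i)) powr p"
    using assms by (intro powr_mono2) (auto intro: norm_sum)
  also have "\<dots> \<le> (\<Sum>i\<in>I. 1) powr (p - 1) * (\<Sum>i\<in>I. 1 * norm (f i) powr p)"
    by (intro powr_sum_weighted_le assms) auto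
  finally show ?thesis by simp
qed

lemma norm_add_powr_le:
  fixes x y :: "'a::real_normed_vector"
  assumes "p > 1"
  shows "norm (x + y) powr p \<le> 2 powr (p - 1) * (norm x powr p + norm y powr p)"
  using norm_sum_powr_le[OF assms, of "\<lambda>b. if b then x else y" "{True, False}"] by simp

text \<open>The Poisson kernel of the upper half plane at height 1, without the factor 1 /
  pi.\<close>

definition pker :: "real \<Rightarrow> real" where "pker t = 1 / (1 + t\<^sup>2)"

lemma pker_pos: "pker t > 0" and pker_le_1: "pker t \<le> 1"
  by (auto simp: pker_def add_pos_nonneg)

lemma pker_minus: "pker (- t) = pker t"
  by (simp add: pker_def)

lemma continuous_on_pker [continuous_intros]:
  "continuous_on A f \<Longrightarrow> continuous_on A (\<lambda>x. pker (f x))"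
  unfolding pker_def by (intro continuous_intros) (auto simp: add_nonneg_eq_0_iff)

lemma pker_measurable [measurable]: "pker \<in> borel_measurable borel"
  unfolding pker_def by measurable

text \<open>A Harnack-type comparison at distance at most 1, which lets integer points replace real
  ones.\<close>

lemma pker_near:
  assumes "\<bar>t - s\<bar> \<le> 1"
  shows "pker t \<le> 3 * pker s"
proof -
  have "s\<^sup>2 \<le> (\<bar>t\<bar> + 1)\<^sup>2"
    using assms by (intro abs_le_square_iff[THEN iffD1]) auto
  also have "\<dots> \<le> 2 * t\<^sup>2 + 2"
    using zero_le_power2[of "\<bar>t\<bar> - 1"] by (simp add: power2_eq_square algebra_simps)
  finally have "1 + s\<^sup>2 \<le> 3 * (1 + t\<^sup>2)"
    using zero_le_power2[of t] by argo
  then show ?thesis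
    by (simp add: pker_def add_pos_nonneg field_simps)
qed

text \<open>The bound telescopes, since \<open>pker m\<close> is at most 2 / m - 2 / (m + 1) for m >
  0. It is sharp at \<open>m = 1\<close>, where the induction really begins; at \<open>m = 0\<close>
  the convention 2 / 0 = 0 makes it harmless.\<close>

lemma sum_pker_nat: "(\<Sum>i<m. pker (real i)) \<le> 3 - 2 / real m"
proof (induction m)
  case (Suc m)
  show ?case
  proof (cases "m = 0")
    case False
    have "pker (real m) \<le> 2 / real m - 2 / real (Suc m)"
    proof -
      have "2 / real m - 2 / real (Suc m) = 2 / (real m * (real m + 1))"
        using False by (simp add: field_simps)
      moreover have "pker (real m) = 2 / (2 * (1 + (real m)\<^sup>2))"
        unfolding pker_def by (subst mult_divide_mult_cancel_left[symmetric, of 2]) auto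
      moreover have "real m * (real m + 1) \<le> 2 * (1 + (real m)\<^sup>2)"
        using zero_le_power2[of "real m - 1"] by (simp add: power2_eq_square algebra_simps)
      ultimately show ?thesis using False
        by (simp only:) (intro divide_left_mono, auto intro!: mult_pos_pos add_pos_nonneg)
    qed
    then show ?thesis using Suc by simp
  qed (simp add: pker_def)
qed simp

lemma sum_pker_int:
  fixes J :: "int set"
  assumes "finite J"
  shows "(\<Sum>j\<in>J. pker (of_int j)) \<le> 6"
proof -
  \<comment> \<open>Stated for sets on which the absolute value is injective, so that it serves both
    the nonnegative and the negative half.\<close>
  have nat: "(\<Sum>j\<in>A. pker (of_int j)) \<le> 3" if "finite A" "inj_on (\<lambda>j. nat \<bar>j\<bar>) A" for A :: "int set"
  proof -
    obtain m where m: "(\<lambda>j. nat \<bar>j\<bar>) ` A \<subseteq> {..<m}"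
      using finite_nat_iff_bounded[of "(\<lambda>j. nat \<bar>j\<bar>) ` A"] \<open>finite A\<close> by auto
    have "(\<Sum>j\<in>A. pker (of_int j)) = (\<Sum>j\<in>A. pker (real (nat \<bar>j\<bar>)))"
      by (intro sum.cong) (auto simp: pker_def)
    also have "\<dots> = (\<Sum>i\<in>(\<lambda>j. nat \<bar>j\<bar>) ` A. pker (real i))"
      by (simp add: sum.reindex that)
    also have "\<dots> \<le> (\<Sum>i<m. pker (real i))"
      by (intro sum_mono2 m) (auto intro: less_imp_le pker_pos)
    also have "\<dots> \<le> 3" using sum_pker_nat[of m] by (smt (verit) divide_nonneg_nonneg of_nat_0_le_iff)
    finally show ?thesis .
  qed
  have "(\<Sum>j\<in>J. pker (of_int j)) = (\<Sum>j\<in>{j\<in>J. j \<ge> 0}. pker (of_int j)) + (\<Sum>j\<in>{j\<in>J. j < 0}. pker (of_int j))"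
    using assms by (subst sum.union_disjoint[symmetric]) (auto intro!: sum.cong)
  also have "\<dots> \<le> 3 + 3"
    by (intro add_mono nat) (use assms in \<open>auto simp: inj_on_def\<close>)
  finally show ?thesis by simp
qed

lemma sum_pker_shift:
  fixes J :: "int set"
  assumes "finite J"
  shows "(\<Sum>j\<in>J. pker (x - of_int j)) \<le> 18"
proof -
  have "(\<Sum>j\<in>J. pker (x - of_int j)) \<le> (\<Sum>j\<in>J. 3 * pker (of_int (j - \<lfloor>x\<rfloor>)))"
  proof (intro sum_mono)
    fix j
    have "pker (x - of_int j) \<le> 3 * pker (of_int \<lfloor>x\<rfloor> - of_int j)"
      by (rule pker_near) linarith
    then show "pker (x - of_int j) \<le> 3 * pker (of_int (j - \<lfloor>x\<rfloor>))"
      using pker_minus[of "of_int \<lfloor>x\<rfloor> - of_int j"] by simp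
  qed
  also have "\<dots> = 3 * (\<Sum>j\<in>(\<lambda>j. j - \<lfloor>x\<rfloor>) ` J. pker (of_int j))"
    by (simp add: sum.reindex inj_on_def sum_distrib_left)
  also have "\<dots> \<le> 3 * 6"
    using sum_pker_int[of "(\<lambda>j. j - \<lfloor>x\<rfloor>) ` J"] assms by simp
  finally show ?thesis by simp
qed

lemma nn_integral_pker: "(\<integral>\<^sup>+x. ennreal (pker (x - s)) \<partial>lborel) = ennreal pi"
proof -
  have d: "DERIV arctan x :> pker x" for x
    by (auto intro!: derivative_eq_intros simp: pker_def field_simps)
  have lim: "(arctan \<longlongrightarrow> pi/2) at_top" by (rule tendsto_arctan_at_top)
  have a: "(\<integral>\<^sup>+x. ennreal (pker x) * indicator {0..} x \<partial>lborel) = ennreal (pi/2)"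
    using nn_integral_FTC_atLeast[of pker 0 arctan "pi/2"] d lim by (auto simp: pker_pos less_imp_le)
  have "(\<integral>\<^sup>+x. ennreal (pker x) * indicator {..<0} x \<partial>lborel)
      = (\<integral>\<^sup>+x. ennreal (pker x) * indicator {0<..} x \<partial>lborel)"
    by (subst nn_integral_real_affine[where c="-1" and t=0])
       (auto simp: pker_minus indicator_def intro!: nn_integral_cong)
  also have "\<dots> = (\<integral>\<^sup>+x. ennreal (pker x) * indicator {0..} x \<partial>lborel)"
    using AE_lborel_singleton[of 0]
    by (intro nn_integral_cong_AE) (auto simp: indicator_def)
  finally have b: "(\<integral>\<^sup>+x. ennreal (pker x) * indicator {..<0} x \<partial>lborel) = ennreal (pi/2)"
    using a by simp
  have "(\<integral>\<^sup>+x. ennreal (pker (x - s)) \<partial>lborel) = (\<integral>\<^sup>+x. ennreal (pker x) \<partial>lborel)"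
    by (subst nn_integral_real_affine[where c=1 and t=s]) auto
  also have "\<dots> = (\<integral>\<^sup>+x. ennreal (pker x) * indicator {0..} x + ennreal (pker x) * indicator {..<0} x \<partial>lborel)"
    by (intro nn_integral_cong) (auto simp: indicator_def)
  also have "\<dots> = ennreal (pi/2) + ennreal (pi/2)"
    by (subst nn_integral_add) (auto simp: a b)
  also have "\<dots> = ennreal pi" by (simp flip: ennreal_plus)
  finally show ?thesis .
qed

lemma powr_sum_pker_le:
  assumes "p > 1" "finite J" and a: "\<And>j. a j \<ge> 0"
  shows "(\<Sum>j\<in>J. a j * pker (x - of_int j)) powr p
           \<le> 18 powr (p - 1) * (\<Sum>j\<in>J. a j powr p * pker (x - of_int j))"
proof -
  have "(\<Sum>j\<in>J. a j * pker (x - of_int j)) powr p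
      \<le> (\<Sum>j\<in>J. pker (x - of_int j)) powr (p - 1) * (\<Sum>j\<in>J. pker (x - of_int j) * a j powr p)"
    using powr_sum_weighted_le[of p J "\<lambda>j. pker (x - of_int j)" a] assms
    by (simp add: mult.commute less_imp_le pker_pos)
  also have "\<dots> \<le> 18 powr (p - 1) * (\<Sum>j\<in>J. pker (x - of_int j) * a j powr p)"
    using assms by (intro mult_right_mono powr_mono2 sum_pker_shift sum_nonneg)
       (auto simp: less_imp_le pker_pos)
  finally show ?thesis by (simp add: mult.commute)
qed

text \<open>Jensen moves the power inside, with weights of total at most 18 at every point, and each
  translate of \<open>pker\<close> integrates to pi. This is the source of the recurring constant
  \<open>18 powr (p - 1) * pi\<close>.\<close>

lemma conv_pker_Lp:
  assumes "p > 1" "finite J" and a: "\<And>j. a j \<ge> 0"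
  shows "(\<integral>\<^sup>+x. ennreal ((\<Sum>j\<in>J. a j * pker (x - of_int j)) powr p) \<partial>lborel)
           \<le> ennreal (18 powr (p - 1) * pi * (\<Sum>j\<in>J. a j powr p))"
proof -
  have "(\<integral>\<^sup>+x. ennreal ((\<Sum>j\<in>J. a j * pker (x - of_int j)) powr p) \<partial>lborel)
     \<le> (\<integral>\<^sup>+x. (\<Sum>j\<in>J. ennreal (18 powr (p - 1) * a j powr p) * ennreal (pker (x - of_int j))) \<partial>lborel)"
  proof (intro nn_integral_mono)
    fix x
    have "ennreal ((\<Sum>j\<in>J. a j * pker (x - of_int j)) powr p)
        \<le> ennreal (\<Sum>j\<in>J. 18 powr (p - 1) * a j powr p * pker (x - of_int j))"
      using powr_sum_pker_le[OF assms, where x=x] by (intro ennreal_leI) (simp add: sum_distrib_left mult.assoc)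
    also have "\<dots> = (\<Sum>j\<in>J. ennreal (18 powr (p - 1) * a j powr p) * ennreal (pker (x - of_int j)))"
      by (subst sum_ennreal[symmetric]) (auto simp: less_imp_le pker_pos ennreal_mult intro!: sum.cong)
    finally show "ennreal ((\<Sum>j\<in>J. a j * pker (x - of_int j)) powr p)
       \<le> (\<Sum>j\<in>J. ennreal (18 powr (p - 1) * a j powr p) * ennreal (pker (x - of_int j)))" .
  qed
  also have "\<dots> = (\<Sum>j\<in>J. ennreal (18 powr (p - 1) * a j powr p) * ennreal pi)"
    by (subst nn_integral_sum) (auto simp: nn_integral_cmult nn_integral_pker)
  also have "\<dots> = (\<Sum>j\<in>J. ennreal (18 powr (p - 1) * a j powr p * pi))"
    by (intro sum.cong) (simp_all add: ennreal_mult)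
  also have "\<dots> = ennreal (18 powr (p - 1) * pi * (\<Sum>j\<in>J. a j powr p))"
    by (subst sum_ennreal) (auto simp: sum_distrib_left sum_distrib_right mult_ac)
  finally show ?thesis .
qed

section \<open>The conjugate Poisson kernel\<close>

text \<open>The conjugate Poisson kernel at height 1, again without 1 / pi: a bounded version of the
  Hilbert kernel 1 / t.\<close>

definition hker :: "real \<Rightarrow> real" where "hker t = t / (1 + t\<^sup>2)"

lemma hker_minus: "hker (- t) = - hker t"
  by (simp add: hker_def)

lemma continuous_on_hker [continuous_intros]:
  "continuous_on A f \<Longrightarrow> continuous_on A (\<lambda>x. hker (f x))"
  unfolding hker_def by (intro continuous_intros) (auto simp: add_nonneg_eq_0_iff)

lemma hker_measurable [measurable]: "hker \<in> borel_measurable borel"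
  unfolding hker_def by measurable

text \<open>The derivative (1 - r^2) (pker r)^2 is at most \<open>pker r\<close> in absolute value,
  so the mean value inequality and \<open>pker_near\<close> apply.\<close>

lemma hker_near:
  assumes "\<bar>t - s\<bar> \<le> 1"
  shows "\<bar>hker t - hker s\<bar> \<le> 3 * pker s"
proof -
  have d: "(hker has_field_derivative (1 - r\<^sup>2) * (pker r)\<^sup>2) (at r within S)" for r S
    unfolding hker_def pker_def
    by (auto intro!: derivative_eq_intros simp: add_nonneg_eq_0_iff power2_eq_square field_simps)
  have b: "norm ((1 - r\<^sup>2) * (pker r)\<^sup>2) \<le> 3 * pker s" if "r \<in> closed_segment t s" for r
  proof -
    have "\<bar>r - s\<bar> \<le> 1"
      using that assms by (auto simp: closed_segment_eq_real_ivl split: if_splits)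
    then have *: "pker r \<le> 3 * pker s" by (rule pker_near)
    have "\<bar>1 - r\<^sup>2\<bar> \<le> 1 + r\<^sup>2" by (rule abs_leI) auto
    then have "\<bar>1 - r\<^sup>2\<bar> * pker r \<le> 1"
      by (simp add: pker_def add_pos_nonneg)
    then have "\<bar>1 - r\<^sup>2\<bar> * pker r * pker r \<le> 1 * pker r"
      by (intro mult_right_mono) (auto simp: pker_pos less_imp_le)
    then show ?thesis using * by (simp add: abs_mult power2_eq_square mult_ac)
  qed
  have "norm (hker t - hker s) \<le> 3 * pker s * norm (t - s)"
    by (rule field_differentiable_bound[where S="closed_segment t s" and f'="\<lambda>r. (1 - r\<^sup>2) * (pker r)\<^sup>2"])
       (use b in \<open>auto intro: d\<close>)
  also have "\<dots> \<le> 3 * pker s * 1"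
    using assms by (intro mult_left_mono) (auto simp: pker_pos less_imp_le)
  finally show ?thesis by simp
qed

text \<open>The device for passing between the integers and the line. The Poisson sum
  \<open>V\<close> may be taken at either point because both uses want it at the real point, which
  is \<open>t\<close> in one direction and \<open>s\<close> in the other.\<close>

lemma hker_conv_near:
  fixes z :: "int \<Rightarrow> 'a::real_normed_field" and J :: "int set"
  defines "U \<equiv> \<lambda>x. \<Sum>j\<in>J. z j * of_real (hker (x - of_int j))"
    and "V \<equiv> \<lambda>x. \<Sum>j\<in>J. norm (z j) * pker (x - of_int j)"
  assumes p: "p > 1" and st: "\<bar>s - t\<bar> \<le> 1" and v: "v = s \<or> v = t"
  shows "norm (U s) powr p \<le> 2 powr (p - 1) * norm (U t) powr p + 2 powr (p - 1) * (3 powr p * V v powr p)"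
proof -
  have V0: "V v \<ge> 0" unfolding V_def by (intro sum_nonneg mult_nonneg_nonneg) (auto simp: pker_pos less_imp_le)
  have "norm (U s - U t) \<le> (\<Sum>j\<in>J. norm (z j) * (3 * pker (v - of_int j)))"
    unfolding U_def sum_subtractf[symmetric]
  proof (intro sum_norm_le)
    fix j
    have "\<bar>hker (s - of_int j) - hker (t - of_int j)\<bar> \<le> 3 * pker (v - of_int j)"
      using v hker_near[of "s - of_int j" "t - of_int j"] hker_near[of "t - of_int j" "s - of_int j"] st
      by (auto simp: abs_minus_commute)
    then have "norm (z j) * \<bar>hker (s - of_int j) - hker (t - of_int j)\<bar> \<le> norm (z j) * (3 * pker (v - of_int j))"
      by (rule mult_left_mono) simp
    then show "norm (z j * of_real (hker (s - of_int j)) - z j * of_real (hker (t - of_int j)))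
       \<le> norm (z j) * (3 * pker (v - of_int j))"
      by (simp add: norm_mult right_diff_distrib[symmetric] of_real_diff[symmetric] del: of_real_diff)
  qed
  also have "\<dots> = 3 * V v" by (simp add: V_def sum_distrib_left mult_ac)
  finally have "norm (U s - U t) powr p \<le> (3 * V v) powr p"
    using p by (intro powr_mono2) auto
  then have le: "norm (U s - U t) powr p \<le> 3 powr p * V v powr p"
    using V0 by (simp add: powr_mult)
  have "norm (U s) powr p \<le> 2 powr (p - 1) * (norm (U t) powr p + norm (U s - U t) powr p)"
    using norm_add_powr_le[OF p, of "U t" "U s - U t"] by simp
  also have "\<dots> \<le> 2 powr (p - 1) * (norm (U t) powr p + 3 powr p * V v powr p)"
    using le by (intro mult_left_mono add_mono) auto
  finally show ?thesis by (simp add: distrib_left)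
qed

text \<open>As \<open>p \<theta>\<close> runs into \<open>(\<pi>/2, \<pi>]\<close> when \<open>\<theta>\<close> approaches \<open>\<pi>/2\<close>, the term \<open>- cos (p \<theta>)\<close>
  is bounded below exactly where \<open>cos \<theta>\<close> is not.\<close>

lemma abs_sin_powr_le:
  fixes p :: real
  assumes "1 < p" "p \<le> 2"
  obtains A B where "A \<ge> 0" "B \<ge> 0"
    "\<And>\<theta>. \<bar>\<theta>\<bar> < pi / 2 \<Longrightarrow> \<bar>sin \<theta>\<bar> powr p \<le> A * cos \<theta> powr p - B * cos (p * \<theta>)"
proof -
  \<comment> \<open>The midpoint between pi / (2 p), the first zero of cos (p \<theta>), and pi / 2.
    The assumption \<open>p \<le> 2\<close> keeps p \<theta> below pi, where the cosine still
    decreases.\<close>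
  define t where "t = (pi / 4) * (1 + 1 / p)"
  have pt: "p * t = (pi / 4) * (p + 1)" using assms by (simp add: t_def field_simps)
  have t: "0 < t" "t < pi / 2" "pi / 2 < p * t" "p * t < pi"
  proof -
    show "0 < t" using assms by (auto simp: t_def intro!: mult_pos_pos add_pos_pos)
    have "1 / p < 1" using assms by simp
    then have "(pi/4) * (1 + 1/p) < (pi/4) * 2" by (intro mult_strict_left_mono) auto
    then show "t < pi / 2" by (simp add: t_def)
    have "(pi/4) * 2 < (pi/4) * (p + 1)" using assms by (intro mult_strict_left_mono) auto
    then show "pi / 2 < p * t" by (simp add: pt)
    have "(pi/4) * (p + 1) < (pi/4) * 4" using assms by (intro mult_strict_left_mono) auto
    then show "p * t < pi" by (simp add: pt)
  qed
  define k where "k = - cos (p * t)"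
  have k: "k > 0" using t cos_lt_zero_pi[of "p * t"] by (simp add: k_def)
  have ct: "cos t > 0" using t by (intro cos_gt_zero) auto
  \<comment> \<open>\<open>B\<close> makes the term - B cos (p \<theta>) at least 1 for angles
    beyond \<open>t\<close>. For smaller angles that term is at least - B, and \<open>A\<close>
    makes the first term at least 1 + B.\<close>
  define A B where "A = (1 + 1 / k) / cos t powr p" and "B = 1 / k"
  have AB: "A \<ge> 0" "B \<ge> 0" using k ct by (auto simp: A_def B_def)
  have "\<bar>sin \<theta>\<bar> powr p \<le> A * cos \<theta> powr p - B * cos (p * \<theta>)" if th: "\<bar>\<theta>\<bar> < pi / 2" for \<theta>
  proof -
    have sin1: "\<bar>sin \<theta>\<bar> powr p \<le> 1"
      using assms by (intro powr_le1) auto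
    have cos_abs: "cos (p * \<theta>) = cos (p * \<bar>\<theta>\<bar>)" "cos \<theta> = cos \<bar>\<theta>\<bar>" by (auto simp: abs_if)
    show ?thesis
    proof (cases "\<bar>\<theta>\<bar> \<ge> t")
      case True
      have "p * \<bar>\<theta>\<bar> \<le> 2 * (pi / 2)" using assms th by (intro mult_mono) auto
      then have "cos (p * \<bar>\<theta>\<bar>) \<le> cos (p * t)"
        using True t assms by (intro cos_monotone_0_pi_le) auto
      then have "1 \<le> - B * cos (p * \<theta>)"
        unfolding cos_abs(1) using k by (simp add: B_def k_def field_simps)
      moreover have "A * cos \<theta> powr p \<ge> 0" using AB by simp
      ultimately show ?thesis using sin1 by linarith
    next
      case False
      then have "cos t \<le> cos \<theta>" unfolding cos_abs(2) using t th by (intro cos_monotone_0_pi_le) auto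
      then have "cos t powr p \<le> cos \<theta> powr p" using ct assms by (intro powr_mono2) auto
      then have "A * cos t powr p \<le> A * cos \<theta> powr p" using AB by (intro mult_left_mono) auto
      moreover have "A * cos t powr p = 1 + B" using ct by (simp add: A_def B_def)
      moreover have "B * cos (p * \<theta>) \<le> B * 1" using AB by (intro mult_left_mono) auto
      ultimately show ?thesis using sin1 by linarith
    qed
  qed
  then show thesis using AB that by blast
qed

text \<open>Both sides are homogeneous of degree \<open>p\<close>, so the inequality for angles
  suffices. The last term is the real part of the principal power of \<open>z\<close>, which is
  holomorphic in \<open>z\<close> and can be removed by Cauchy's theorem.\<close>

lemma abs_Im_powr_le:
  fixes p :: real
  assumes "1 < p" "p \<le> 2"
  obtains A B where "A \<ge> 0" "B \<ge> 0"
    "\<And>z. Re z > 0 \<Longrightarrow> \<bar>Im z\<bar> powr p \<le> A * Re z powr p - B * Re (exp (of_real p * Ln z))"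
proof -
  obtain A B where AB: "A \<ge> 0" "B \<ge> 0" and
    *: "\<And>\<theta>. \<bar>\<theta>\<bar> < pi / 2 \<Longrightarrow> \<bar>sin \<theta>\<bar> powr p \<le> A * cos \<theta> powr p - B * cos (p * \<theta>)"
    using abs_sin_powr_le[OF assms] by metis
  have "\<bar>Im z\<bar> powr p \<le> A * Re z powr p - B * Re (exp (of_real p * Ln z))" if z: "Re z > 0" for z
  proof -
    define \<theta> r where "\<theta> = Im (Ln z)" and "r = norm z"
    have z0: "z \<noteq> 0" using z by auto
    have r: "r > 0" using z0 by (simp add: r_def)
    have th: "\<bar>\<theta>\<bar> < pi / 2" using z Re_Ln_pos_lt z0 by (auto simp: \<theta>_def)
    have "z = exp (Ln z)" using z0 by simp
    then have "Re z = r * cos \<theta>" "Im z = r * sin \<theta>"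
      using z0 by (metis Re_exp Im_exp Re_Ln \<theta>_def r_def exp_ln norm_exp_eq_Re zero_less_norm_iff)+
    moreover have "Re (exp (of_real p * Ln z)) = r powr p * cos (p * \<theta>)"
      using z0 r by (simp add: Re_exp powr_def \<theta>_def r_def)
    moreover have "cos \<theta> > 0" using th cos_gt_zero_pi by auto
    ultimately have e: "\<bar>Im z\<bar> powr p = r powr p * \<bar>sin \<theta>\<bar> powr p" "Re z powr p = r powr p * cos \<theta> powr p"
      "Re (exp (of_real p * Ln z)) = r powr p * cos (p * \<theta>)"
      using r by (auto simp: abs_mult powr_mult)
    have "r powr p * \<bar>sin \<theta>\<bar> powr p \<le> r powr p * (A * cos \<theta> powr p - B * cos (p * \<theta>))"
      using *[OF th] by (intro mult_left_mono) auto
    then show ?thesis unfolding e by (simp add: algebra_simps)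
  qed
  then show thesis using AB that by blast
qed


section \<open>Contour integration and M. Riesz' inequality for exponents up to 2\<close>

text \<open>Fatou's lemma with bounds that may vary along the sequence. It carries truncated
  integrals, approximating kernels and partial sums of sequences to their limits.\<close>

lemma nn_integral_pointwise_limit_le:
  fixes f :: "nat \<Rightarrow> 'a \<Rightarrow> ennreal"
  assumes [measurable]: "\<And>n. f n \<in> borel_measurable M"
    and lim: "\<And>x. x \<in> space M \<Longrightarrow> (\<lambda>n. f n x) \<longlonglongrightarrow> g x"
    and bound: "\<forall>\<^sub>F n in sequentially. (\<integral>\<^sup>+x. f n x \<partial>M) \<le> ennreal (c n)"
    and c: "c \<longlonglongrightarrow> c'"
  shows "(\<integral>\<^sup>+x. g x \<partial>M) \<le> ennreal c'"
proof -
  have "(\<integral>\<^sup>+x. g x \<partial>M) = (\<integral>\<^sup>+x. liminf (\<lambda>n. f n x) \<partial>M)"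
    by (intro nn_integral_cong) (metis lim lim_imp_Liminf sequentially_bot)
  also have "\<dots> \<le> liminf (\<lambda>n. \<integral>\<^sup>+x. f n x \<partial>M)"
    by (intro nn_integral_liminf) auto
  also have "\<dots> \<le> liminf (\<lambda>n. ennreal (c n))"
    by (intro Liminf_mono bound)
  also have "\<dots> = ennreal c'"
    by (intro lim_imp_Liminf tendsto_ennrealI c) simp
  finally show ?thesis .
qed

lemma cauchy_kernel_parts:
  "\<i> / (of_real t + \<i>) = Complex (pker t) (hker t)"
  by (auto simp: complex_eq_iff Re_divide Im_divide pker_def hker_def power2_eq_square field_simps)

text \<open>Each i / (w - j) has positive real part in the upper half plane, so with nonnegative
  coefficients, one of them positive, \<open>G\<close> avoids the cut of \<open>Ln\<close> and its
  \<open>p\<close>-th power has a primitive there. The integral over the segment at height 1 is a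
  difference of two values of the primitive, and it can be estimated along the other three sides of
  a rectangle: length 4 R times a bound of order R^(-p), which tends to 0 as
  \<open>p > 1\<close>.\<close>

lemma contour_integral_half_plane_small:
  fixes z :: "int \<Rightarrow> real" and p :: real and J :: "int set"
  defines "G \<equiv> \<lambda>w. \<Sum>j\<in>J. of_real (z j) * (\<i> / (w - of_int j))"
  assumes p: "p > 1" and J: "finite J" and z: "\<And>j. z j \<ge> 0" and j0: "j0 \<in> J" "z j0 > 0"
  obtains I where
    "\<And>R. R \<ge> 0 \<Longrightarrow> has_bochner_integral lborel
         (\<lambda>x. indicator {-R..R} x *\<^sub>R exp (of_real p * Ln (G (of_real x + \<i>)))) (I R)"
    "((\<lambda>R. norm (I R)) \<longlongrightarrow> 0) at_top"
proof -
  define \<Omega> where "\<Omega> = {w::complex. Im w > 0}"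
  have \<Omega>: "convex \<Omega>" "open \<Omega>"
    by (auto simp: \<Omega>_def convex_halfspace_Im_gt open_halfspace_Im_gt)
  have nz: "w - of_int j \<noteq> 0" if "w \<in> \<Omega>" for w j
    using that by (auto simp: \<Omega>_def complex_eq_iff)
  have ReG: "Re (G w) > 0" if w: "w \<in> \<Omega>" for w
  proof -
    have *: "Re (\<i> / (w - of_int j)) > 0" for j
      using nz[OF w, of j] w by (auto simp: \<Omega>_def Re_divide complex_eq_iff intro!: divide_pos_pos add_nonneg_pos)
    have "0 < (\<Sum>j\<in>J. z j * Re (\<i> / (w - of_int j)))"
      using J j0 z by (intro sum_pos2[of J j0] mult_nonneg_nonneg mult_pos_pos * less_imp_le[OF *]) auto
    also have "\<dots> = Re (G w)"
    proof -
      have re: "Re (of_real a * b) = a * Re b" for a b by simp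
      show ?thesis unfolding G_def Re_sum re ..
    qed
    finally show ?thesis .
  qed
  define h where "h w = exp (of_real p * Ln (G w))" for w
  have npr: "G w \<notin> \<real>\<^sub>\<le>\<^sub>0" if "w \<in> \<Omega>" for w
    using ReG[OF that] by (auto simp: complex_nonpos_Reals_iff)
  have Ghol: "G holomorphic_on \<Omega>"
    unfolding G_def by (intro holomorphic_intros nz)
  have hhol: "h holomorphic_on \<Omega>"
    unfolding h_def by (intro holomorphic_intros Ghol npr)
  obtain g where g: "\<And>w. w \<in> \<Omega> \<Longrightarrow> (g has_field_derivative h w) (at w within \<Omega>)"
  proof (rule holomorphic_convex_primitive'[OF \<Omega> hhol])
    fix g assume "\<And>w. w \<in> \<Omega> \<Longrightarrow> (g has_field_derivative h w) (at w within \<Omega>)"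
    then show thesis by (rule that)
  qed
  have g': "(g has_field_derivative h w) (at w)" if "w \<in> \<Omega>" for w
    using g[OF that] unfolding at_within_open[OF that \<Omega>(2)] .
  define I where "I R = g (of_real R + \<i>) - g (of_real (- R) + \<i>)" for R
  have int: "has_bochner_integral lborel (\<lambda>x. indicator {-R..R} x *\<^sub>R h (of_real x + \<i>)) (I R)" if "R \<ge> 0" for R
    unfolding I_def
  proof (rule has_bochner_integral_FTC_Icc)
    show "- R \<le> R" using that by simp
    show "((\<lambda>x. g (of_real x + \<i>)) has_vector_derivative h (of_real x + \<i>)) (at x within {- R..R})" for x
    proof -
      have "((\<lambda>w. g (w + \<i>)) has_field_derivative h (of_real x + \<i>)) (at (of_real x))"
        using g'[of "of_real x + \<i>"] by (simp add: DERIV_shift \<Omega>_def)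
      then show ?thesis
        by (rule has_vector_derivative_real_field)
    qed
    show "continuous_on {- R..R} (\<lambda>x. h (of_real x + \<i>))"
      by (rule continuous_on_compose2[OF holomorphic_on_imp_continuous_on[OF hhol]])
         (auto simp: \<Omega>_def intro: continuous_intros)
  qed
  define M where "M = (\<Sum>j\<in>J. z j)"
  have M: "M > 0" unfolding M_def using J j0 z by (intro sum_pos2[of J j0]) auto
  obtain N where N: "\<And>j. j \<in> J \<Longrightarrow> \<bar>real_of_int j\<bar> \<le> N"
    using finite_imp_bounded[of "real_of_int ` J"] J unfolding bounded_iff by auto
  \<comment> \<open>All poles have absolute value at most N \<le> R / 2, so a point with real part
    of size \<open>R\<close> or imaginary part at least \<open>R\<close> keeps distance R / 2 from
    each of them.\<close>
  have hb: "norm (h w) \<le> (2 * M / R) powr p"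
    if w: "w \<in> \<Omega>" and R: "R \<ge> 2 * N" "R > 0" and far: "R \<le> \<bar>Re w\<bar> \<or> R \<le> Im w" for w R
  proof -
    have "norm (\<i> / (w - of_int j)) \<le> 2 / R" if "j \<in> J" for j
    proof -
      have "R / 2 \<le> norm (w - of_int j)"
        using far
      proof
        assume "R \<le> \<bar>Re w\<bar>"
        moreover have "\<bar>Re w\<bar> \<le> \<bar>Re (w - of_int j)\<bar> + \<bar>real_of_int j\<bar>" by simp
        ultimately have "R / 2 \<le> \<bar>Re (w - of_int j)\<bar>" using N[OF that] R by argo
        then show ?thesis using abs_Re_le_cmod[of "w - of_int j"] by linarith
      next
        assume "R \<le> Im w"
        then have "R / 2 \<le> \<bar>Im (w - of_int j)\<bar>" using R by auto
        then show ?thesis using abs_Im_le_cmod[of "w - of_int j"] by linarith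
      qed
      then have "1 / norm (w - of_int j) \<le> 1 / (R / 2)"
        using R nz[OF w, of j] by (intro divide_left_mono mult_pos_pos) auto
      then show ?thesis by (simp add: norm_divide)
    qed
    then have "norm (G w) \<le> (\<Sum>j\<in>J. z j * (2 / R))"
      unfolding G_def
      by (intro sum_norm_le) (auto simp: norm_mult z simp del: times_divide_eq_right intro!: mult_left_mono)
    also have "\<dots> = 2 * M / R" by (simp add: M_def sum_distrib_left sum_distrib_right sum_divide_distrib mult_ac)
    finally have *: "norm (G w) \<le> 2 * M / R" .
    have "G w \<noteq> 0" using ReG[OF w] by auto
    then have "norm (h w) = norm (G w) powr p" by (simp add: h_def powr_def)
    also have "\<dots> \<le> (2 * M / R) powr p" using * p by (intro powr_mono2) auto
    finally show ?thesis .
  qed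
  have Ib: "norm (I R) \<le> 4 * R * (2 * M / R) powr p" if R: "R \<ge> 2 * N" "R \<ge> 1" for R
  proof -
    let ?B = "(2 * M / R) powr p"
    \<comment> \<open>Corners of the rectangle over the segment from \<open>a\<close> to
      \<open>d\<close>. Each of the other three sides lies in a convex subset of the half plane on
      which \<open>hb\<close> holds, so the mean value inequality replaces path integrals.\<close>
    define a b c d where "a = Complex (- R) 1" and "b = Complex (- R) R" and "c = Complex R R" and "d = Complex R 1"
    have bound: "norm (g u - g v) \<le> ?B * norm (u - v)"
      if "convex S" "S \<subseteq> \<Omega>" "\<And>w. w \<in> S \<Longrightarrow> R \<le> \<bar>Re w\<bar> \<or> R \<le> Im w" "u \<in> S" "v \<in> S" for S u v
      by (rule field_differentiable_bound[OF that(1) _ _ that(4,5), where f'=h])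
         (use that R hb[of _ R] in \<open>auto intro!: has_field_derivative_at_within[OF g']\<close>)
    have "norm (g d - g c) \<le> ?B * norm (d - c)"
      by (rule bound[of "\<Omega> \<inter> {w. Re w \<ge> R}"])
         (use R in \<open>auto intro!: convex_Int convex_halfspace_Im_gt convex_halfspace_Re_ge simp: \<Omega>_def c_def d_def\<close>)
    moreover have "norm (g c - g b) \<le> ?B * norm (c - b)"
      by (rule bound[of "\<Omega> \<inter> {w. Im w \<ge> R}"])
         (use R in \<open>auto intro!: convex_Int convex_halfspace_Im_gt convex_halfspace_Im_ge simp: \<Omega>_def c_def b_def\<close>)
    moreover have "norm (g b - g a) \<le> ?B * norm (b - a)"
      by (rule bound[of "\<Omega> \<inter> {w. Re w \<le> - R}"])
         (use R in \<open>auto intro!: convex_Int convex_halfspace_Im_gt convex_halfspace_Re_le simp: \<Omega>_def a_def b_def\<close>)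
    moreover have "norm (d - c) \<le> R" "norm (c - b) \<le> 2 * R" "norm (b - a) \<le> R"
      using R by (auto simp: a_def b_def c_def d_def cmod_eq_Re cmod_eq_Im)
    then have "?B * norm (d - c) \<le> ?B * R" "?B * norm (c - b) \<le> ?B * (2 * R)" "?B * norm (b - a) \<le> ?B * R"
      by (intro mult_left_mono; simp)+
    moreover have "norm (g d - g a) \<le> norm (g d - g c) + norm (g c - g b) + norm (g b - g a)"
    proof -
      have e: "g d - g a = (g d - g c) + (g c - g b) + (g b - g a)" by simp
      show ?thesis by (subst e) (intro norm_triangle_le add_mono order_refl)
    qed
    moreover have "I R = g d - g a"
    proof -
      have "a = of_real (- R) + \<i>" "d = of_real R + \<i>" by (simp_all add: a_def d_def complex_eq_iff)
      then show ?thesis by (simp only: I_def)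
    qed
    ultimately show ?thesis by (simp add: mult_ac)
  qed
  have "((\<lambda>R. 4 * R * (2 * M / R) powr p) \<longlongrightarrow> 0) at_top"
  proof -
    have "((\<lambda>R. 4 * (2 * M) powr p * R powr (1 - p)) \<longlongrightarrow> 4 * (2 * M) powr p * 0) at_top"
      by (intro tendsto_intros tendsto_neg_powr filterlim_ident) (use p in auto)
    moreover have "\<forall>\<^sub>F R in at_top. 4 * (2 * M) powr p * R powr (1 - p) = 4 * R * (2 * M / R) powr p"
      using eventually_gt_at_top[of 0]
      by eventually_elim (use M in \<open>simp add: powr_divide powr_diff\<close>)
    ultimately show ?thesis by (simp add: Lim_transform_eventually)
  qed
  moreover have "\<forall>\<^sub>F R in at_top. norm (norm (I R)) \<le> 4 * R * (2 * M / R) powr p"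
    using eventually_ge_at_top[of "max 1 (2 * N)"]
    by eventually_elim (use Ib in auto)
  ultimately have "((\<lambda>R. norm (I R)) \<longlongrightarrow> 0) at_top"
    by (rule Lim_null_comparison[rotated])
  with int show thesis
    using that unfolding h_def by blast
qed

text \<open>The constant \<open>C\<close> bounds the \<open>p\<close>-th power of the operator norm.\<close>

definition kernel_Lp :: "real \<Rightarrow> real \<Rightarrow> (real \<Rightarrow> 'a::real_normed_field) \<Rightarrow> bool" where
  "kernel_Lp p C K \<longleftrightarrow> C \<ge> 0 \<and> (\<forall>J y. finite J \<longrightarrow>
     (\<integral>\<^sup>+x. ennreal (norm (\<Sum>j\<in>J. y j * K (x - of_int j)) powr p) \<partial>lborel)
       \<le> ennreal (C * (\<Sum>j\<in>J. norm (y j) powr p)))"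

definition kernel_lp :: "real \<Rightarrow> real \<Rightarrow> (real \<Rightarrow> 'a::real_normed_field) \<Rightarrow> bool" where
  "kernel_lp p C K \<longleftrightarrow> C \<ge> 0 \<and> (\<forall>J N y. finite J \<longrightarrow> finite N \<longrightarrow>
     (\<Sum>n\<in>N. norm (\<Sum>j\<in>J. y j * K (of_int n - of_int j)) powr p)
       \<le> C * (\<Sum>j\<in>J. norm (y j) powr p))"


text \<open>The pointwise inequality of \<open>abs_Im_powr_le\<close> is applied to
  \<open>G = V + i U\<close> and integrated over growing intervals. The Poisson part
  \<open>V\<close> is controlled by \<open>conv_pker_Lp\<close>, and the integral of the holomorphic
  power tends to 0.\<close>

lemma hker_Lp_nonneg:
  fixes p :: real
  assumes "1 < p" "p \<le> 2"
  shows "\<exists>C\<ge>0. \<forall>J (z :: int \<Rightarrow> real). finite J \<longrightarrow> (\<forall>j. z j \<ge> 0) \<longrightarrow>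
      (\<integral>\<^sup>+x. ennreal (\<bar>\<Sum>j\<in>J. z j * hker (x - of_int j)\<bar> powr p) \<partial>lborel) \<le> ennreal (C * (\<Sum>j\<in>J. z j powr p))"
proof -
  obtain A B where AB: "A \<ge> 0" "B \<ge> 0" and
    *: "\<And>z. Re z > 0 \<Longrightarrow> \<bar>Im z\<bar> powr p \<le> A * Re z powr p - B * Re (exp (of_real p * Ln z))"
    using abs_Im_powr_le[OF assms] by metis
  define K where "K = 18 powr (p - 1) * pi"
  have K: "K \<ge> 0" by (simp add: K_def)
  have main: "(\<integral>\<^sup>+x. ennreal (\<bar>\<Sum>j\<in>J. z j * hker (x - of_int j)\<bar> powr p) \<partial>lborel)
      \<le> ennreal (A * K * (\<Sum>j\<in>J. z j powr p))"
    if J: "finite J" and z: "\<And>j. z j \<ge> 0" for J and z :: "int \<Rightarrow> real"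
  \<comment> \<open>Without a positive coefficient \<open>G\<close> vanishes and has no power to
    speak of, but then the claim is trivial.\<close>
  proof (cases "\<exists>j0\<in>J. z j0 > 0")
    case False
    then have "z j = 0" if "j \<in> J" for j using z[of j] that by force
    then show ?thesis by simp
  next
    case True
    then obtain j0 where j0: "j0 \<in> J" "z j0 > 0" by blast
    define G where "G w = (\<Sum>j\<in>J. of_real (z j) * (\<i> / (w - of_int j)))" for w
    obtain I where I: "\<And>R. R \<ge> 0 \<Longrightarrow> has_bochner_integral lborel
         (\<lambda>x. indicator {-R..R} x *\<^sub>R exp (of_real p * Ln (G (of_real x + \<i>)))) (I R)"
      and I0: "((\<lambda>R. norm (I R)) \<longlongrightarrow> 0) at_top"
      using contour_integral_half_plane_small[where J=J and z=z and p=p, OF assms(1) J z j0, folded G_def] by blast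
    define U V where "U x = (\<Sum>j\<in>J. z j * hker (x - of_int j))"
      and "V x = (\<Sum>j\<in>J. z j * pker (x - of_int j))" for x
    have GUV: "G (of_real x + \<i>) = Complex (V x) (U x)" for x
    proof -
      have "G (of_real x + \<i>) = (\<Sum>j\<in>J. of_real (z j) * Complex (pker (x - of_int j)) (hker (x - of_int j)))"
        unfolding G_def cauchy_kernel_parts[symmetric] by (simp add: algebra_simps)
      then show ?thesis by (simp add: complex_eq_iff U_def V_def)
    qed
    have Vpos: "V x > 0" for x
      unfolding V_def using J j0 z
      by (intro sum_pos2[of J j0] mult_nonneg_nonneg mult_pos_pos pker_pos less_imp_le[OF pker_pos]) auto
    define H where "H x = Re (exp (of_real p * Ln (G (of_real x + \<i>))))" for x
    have pt: "\<bar>U x\<bar> powr p \<le> A * V x powr p - B * H x" for x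
      using *[of "G (of_real x + \<i>)"] Vpos[of x] unfolding H_def GUV by simp
    have contU: "continuous_on S (\<lambda>x. \<bar>U x\<bar> powr p)" and contV: "continuous_on S (\<lambda>x. V x powr p)" for S
      unfolding U_def V_def using assms
      by (auto intro!: continuous_intros continuous_on_powr' simp: less_imp_le pker_pos z sum_nonneg)
    define S where "S = (\<Sum>j\<in>J. z j powr p)"
    have S: "S \<ge> 0" by (simp add: S_def sum_nonneg)
    have [measurable]: "U \<in> borel_measurable borel" "V \<in> borel_measurable borel"
      unfolding U_def V_def by measurable
    have step: "(\<integral>\<^sup>+x. ennreal (indicator {-R..R} x * \<bar>U x\<bar> powr p) \<partial>lborel) \<le> ennreal (A * K * S + B * norm (I R))"
      if R: "R \<ge> 0" for R
    proof -
      have iU: "integrable lborel (\<lambda>x. indicator {-R..R} x * \<bar>U x\<bar> powr p)"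
        using borel_integrable_atLeastAtMost'[OF contU, of "-R" R] by (simp add: set_integrable_def)
      have iV: "integrable lborel (\<lambda>x. indicator {-R..R} x * V x powr p)"
        using borel_integrable_atLeastAtMost'[OF contV, of "-R" R] by (simp add: set_integrable_def)
      have "has_bochner_integral lborel (\<lambda>x. Re (indicator {-R..R} x *\<^sub>R exp (of_real p * Ln (G (of_real x + \<i>))))) (Re (I R))"
        by (intro has_bochner_integral_bounded_linear[OF bounded_linear_Re] I R)
      then have H: "has_bochner_integral lborel (\<lambda>x. indicator {-R..R} x * H x) (Re (I R))"
        by (simp add: H_def)
      have "ennreal (LINT x|lborel. indicator {-R..R} x * V x powr p)
          = (\<integral>\<^sup>+x. ennreal (indicator {-R..R} x * V x powr p) \<partial>lborel)"
        using iV by (intro nn_integral_eq_integral[symmetric]) auto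
      also have "\<dots> \<le> (\<integral>\<^sup>+x. ennreal (V x powr p) \<partial>lborel)"
        by (intro nn_integral_mono ennreal_leI) (auto simp: indicator_def)
      also have "\<dots> \<le> ennreal (K * S)"
        unfolding V_def K_def S_def by (rule conv_pker_Lp[OF assms(1) J z])
      finally have V: "(LINT x|lborel. indicator {-R..R} x * V x powr p) \<le> K * S"
        using K S by (subst (asm) ennreal_le_iff) auto
      have eq: "(\<integral>\<^sup>+x. ennreal (indicator {-R..R} x * \<bar>U x\<bar> powr p) \<partial>lborel)
          = ennreal (LINT x|lborel. indicator {-R..R} x * \<bar>U x\<bar> powr p)"
        using iU by (intro nn_integral_eq_integral) auto
      have "(LINT x|lborel. indicator {-R..R} x * \<bar>U x\<bar> powr p)
          \<le> (LINT x|lborel. A * (indicator {-R..R} x * V x powr p) - B * (indicator {-R..R} x * H x))"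
        using iU iV H pt
        by (intro integral_mono) (auto simp: indicator_def has_bochner_integral_iff)
      also have "\<dots> = A * (LINT x|lborel. indicator {-R..R} x * V x powr p) - B * Re (I R)"
        using iV H by (subst Bochner_Integration.integral_diff) (auto simp: has_bochner_integral_iff)
      also have "\<dots> \<le> A * (K * S) + B * norm (I R)"
      proof -
        have "\<bar>Re (I R)\<bar> \<le> norm (I R)" by (rule abs_Re_le_cmod)
        then have "B * (- Re (I R)) \<le> B * norm (I R)" using AB(2) by (intro mult_left_mono) auto
        then show ?thesis using mult_left_mono[OF V AB(1)] by simp
      qed
      finally show ?thesis unfolding eq by (intro ennreal_leI) (simp add: mult.assoc)
    qed
    have "(\<integral>\<^sup>+x. ennreal (\<bar>U x\<bar> powr p) \<partial>lborel) \<le> ennreal (A * K * S + B * 0)"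
    proof (rule nn_integral_pointwise_limit_le)
      show "(\<lambda>x. ennreal (indicator {- real n..real n} x * \<bar>U x\<bar> powr p)) \<in> borel_measurable lborel" for n
        by measurable
      show "(\<lambda>n. ennreal (indicator {- real n..real n} x * \<bar>U x\<bar> powr p)) \<longlonglongrightarrow> ennreal (\<bar>U x\<bar> powr p)" for x
      proof (rule tendsto_eventually)
        show "\<forall>\<^sub>F n in sequentially. ennreal (indicator {- real n..real n} x * \<bar>U x\<bar> powr p) = ennreal (\<bar>U x\<bar> powr p)"
          using eventually_ge_at_top[of "nat \<lceil>\<bar>x\<bar>\<rceil>"]
          by eventually_elim (auto simp: indicator_def nat_le_iff ceiling_le_iff abs_le_iff)
      qed
      show "\<forall>\<^sub>F n in sequentially. (\<integral>\<^sup>+x. ennreal (indicator {- real n..real n} x * \<bar>U x\<bar> powr p) \<partial>lborel)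
           \<le> ennreal (A * K * S + B * norm (I (real n)))"
        by (intro always_eventually allI step) auto
      show "(\<lambda>n. A * K * S + B * norm (I (real n))) \<longlonglongrightarrow> A * K * S + B * 0"
        by (intro tendsto_intros filterlim_compose[OF I0 filterlim_real_sequentially])
    qed
    then show ?thesis by (simp add: U_def S_def)
  qed
  show ?thesis
    by (rule exI[of _ "A * K"]) (use AB K main in auto)
qed


text \<open>The holomorphic argument needs nonnegative coefficients, so the sequence is split into
  its positive and negative parts. This costs the factor \<open>2 * D\<close>.\<close>

lemma hker_Lp_real:
  fixes p :: real
  assumes "1 < p" "p \<le> 2"
  shows "\<exists>C. kernel_Lp p C hker"
proof -
  obtain C where C: "C \<ge> 0" and **:
    "\<forall>J (z :: int \<Rightarrow> real). finite J \<longrightarrow> (\<forall>j. z j \<ge> 0) \<longrightarrow>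
      (\<integral>\<^sup>+x. ennreal (\<bar>\<Sum>j\<in>J. z j * hker (x - of_int j)\<bar> powr p) \<partial>lborel) \<le> ennreal (C * (\<Sum>j\<in>J. z j powr p))"
    using hker_Lp_nonneg[OF assms] by (elim exE conjE) (rule that)
  note * = **[rule_format]
  define D where "D = 2 powr (p - 1)"
  have D: "D \<ge> 0" by (simp add: D_def)
  have main: "(\<integral>\<^sup>+x. ennreal (\<bar>\<Sum>j\<in>J. z j * hker (x - of_int j)\<bar> powr p) \<partial>lborel)
      \<le> ennreal (2 * D * C * (\<Sum>j\<in>J. \<bar>z j\<bar> powr p))" if J: "finite J" for J and z :: "int \<Rightarrow> real"
  proof -
    define u v where "u j = max (z j) 0" and "v j = max (- z j) 0" for j
    define U V where "U x = (\<Sum>j\<in>J. u j * hker (x - of_int j))" and "V x = (\<Sum>j\<in>J. v j * hker (x - of_int j))" for x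
    have [measurable]: "U \<in> borel_measurable borel" "V \<in> borel_measurable borel"
      unfolding U_def V_def by measurable
    have S: "(\<Sum>j\<in>J. u j powr p) \<le> (\<Sum>j\<in>J. \<bar>z j\<bar> powr p)" "(\<Sum>j\<in>J. v j powr p) \<le> (\<Sum>j\<in>J. \<bar>z j\<bar> powr p)"
      using assms by (auto intro!: sum_mono powr_mono2 simp: u_def v_def)
    have split: "(\<Sum>j\<in>J. z j * hker (x - of_int j)) = U x - V x" for x
      unfolding U_def V_def sum_subtractf[symmetric]
      by (intro sum.cong) (auto simp: u_def v_def max_def algebra_simps)
    have "(\<integral>\<^sup>+x. ennreal (\<bar>\<Sum>j\<in>J. z j * hker (x - of_int j)\<bar> powr p) \<partial>lborel)
        \<le> (\<integral>\<^sup>+x. ennreal D * (ennreal (\<bar>U x\<bar> powr p) + ennreal (\<bar>V x\<bar> powr p)) \<partial>lborel)"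
    proof (intro nn_integral_mono)
      fix x
      have "\<bar>\<Sum>j\<in>J. z j * hker (x - of_int j)\<bar> powr p \<le> D * (\<bar>U x\<bar> powr p + \<bar>V x\<bar> powr p)"
        using norm_add_powr_le[OF assms(1), of "U x" "- V x"] unfolding split D_def by simp
      then have "ennreal (\<bar>\<Sum>j\<in>J. z j * hker (x - of_int j)\<bar> powr p) \<le> ennreal (D * (\<bar>U x\<bar> powr p + \<bar>V x\<bar> powr p))"
        by (rule ennreal_leI)
      then show "ennreal (\<bar>\<Sum>j\<in>J. z j * hker (x - of_int j)\<bar> powr p)
          \<le> ennreal D * (ennreal (\<bar>U x\<bar> powr p) + ennreal (\<bar>V x\<bar> powr p))"
        using D by (simp add: ennreal_mult ennreal_plus)
    qed
    also have "\<dots> = ennreal D * ((\<integral>\<^sup>+x. ennreal (\<bar>U x\<bar> powr p) \<partial>lborel) + (\<integral>\<^sup>+x. ennreal (\<bar>V x\<bar> powr p) \<partial>lborel))"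
      by (simp add: nn_integral_cmult nn_integral_add)
    also have "\<dots> \<le> ennreal D * (ennreal (C * (\<Sum>j\<in>J. u j powr p)) + ennreal (C * (\<Sum>j\<in>J. v j powr p)))"
      unfolding U_def V_def by (intro mult_left_mono add_mono * J) (auto simp: u_def v_def)
    also have "\<dots> = ennreal (D * (C * (\<Sum>j\<in>J. u j powr p) + C * (\<Sum>j\<in>J. v j powr p)))"
      using D C by (simp add: ennreal_mult ennreal_plus sum_nonneg)
    also have "\<dots> \<le> ennreal (D * (C * (\<Sum>j\<in>J. \<bar>z j\<bar> powr p) + C * (\<Sum>j\<in>J. \<bar>z j\<bar> powr p)))"
      using D C S by (intro ennreal_leI mult_left_mono add_mono) auto
    finally show ?thesis by (simp add: algebra_simps)
  qed
  then have "kernel_Lp p (2 * D * C) hker" using C D by (simp add: kernel_Lp_def)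
  then show ?thesis ..
qed

text \<open>The value at an integer \<open>n\<close> is compared with the values on [n, n + 1) and
  the comparison is integrated there. These intervals are disjoint, so the sum over \<open>n\<close>
  is at most one integral over the line.\<close>

lemma hker_lp_small:
  fixes p :: real
  assumes "1 < p" "p \<le> 2"
  shows "\<exists>C. kernel_lp p C hker"
proof -
  obtain C where "kernel_Lp p C hker"
    using hker_Lp_real[OF assms] by blast
  then have C: "C \<ge> 0" and *:
    "\<And>J (z :: int \<Rightarrow> real). finite J \<Longrightarrow>
      (\<integral>\<^sup>+x. ennreal (\<bar>\<Sum>j\<in>J. z j * hker (x - of_int j)\<bar> powr p) \<partial>lborel) \<le> ennreal (C * (\<Sum>j\<in>J. \<bar>z j\<bar> powr p))"
    by (simp_all add: kernel_Lp_def)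
  define D where "D = 2 powr (p - 1)"
  have D: "D \<ge> 0" by (simp add: D_def)
  define K where "K = 18 powr (p - 1) * pi"
  have K: "K \<ge> 0" by (simp add: K_def)
  define E where "E = D * C + D * (3 powr p * K)"
  have main: "(\<Sum>n\<in>N. \<bar>\<Sum>j\<in>J. z j * hker (of_int n - of_int j)\<bar> powr p) \<le> E * (\<Sum>j\<in>J. \<bar>z j\<bar> powr p)"
    if J: "finite J" and N: "finite N" for J N and z :: "int \<Rightarrow> real"
  proof -
    define U V where "U x = (\<Sum>j\<in>J. z j * hker (x - of_int j))" and "V x = (\<Sum>j\<in>J. \<bar>z j\<bar> * pker (x - of_int j))" for x
    define S where "S = (\<Sum>j\<in>J. \<bar>z j\<bar> powr p)"
    have S: "S \<ge> 0" by (simp add: S_def sum_nonneg)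
    have [measurable]: "U \<in> borel_measurable borel" "V \<in> borel_measurable borel"
      unfolding U_def V_def by measurable
    have near: "\<bar>U (of_int n)\<bar> powr p \<le> D * (\<bar>U x\<bar> powr p) + D * (3 powr p * V x powr p)"
      if "x \<in> {of_int n..<of_int n + 1}" for n x
      using hker_conv_near[of p "of_int n" x x z J] assms(1) that
      by (auto simp: U_def V_def D_def of_real_eq_id)
    define W where "W x = D * (\<bar>U x\<bar> powr p) + D * (3 powr p * V x powr p)" for x
    have W0: "W x \<ge> 0" for x using D by (simp add: W_def)
    have [measurable]: "W \<in> borel_measurable borel" unfolding W_def by measurable
    have "ennreal (\<Sum>n\<in>N. \<bar>U (of_int n)\<bar> powr p) = (\<Sum>n\<in>N. ennreal (\<bar>U (of_int n)\<bar> powr p))"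
      by simp
    also have "\<dots> = (\<Sum>n\<in>N. \<integral>\<^sup>+x. ennreal (\<bar>U (of_int n)\<bar> powr p) * indicator {of_int n..<of_int n + 1 :: real} x \<partial>lborel)"
    proof (intro sum.cong refl)
      fix n :: int
      show "ennreal (\<bar>U (of_int n)\<bar> powr p)
          = (\<integral>\<^sup>+x. ennreal (\<bar>U (of_int n)\<bar> powr p) * indicator {of_int n..<of_int n + 1 :: real} x \<partial>lborel)"
        by (subst nn_integral_cmult_indicator) auto
    qed
    also have "\<dots> \<le> (\<Sum>n\<in>N. \<integral>\<^sup>+x. ennreal (W x) * indicator {of_int n..<of_int n + 1} x \<partial>lborel)"
      using near unfolding W_def by (intro sum_mono nn_integral_mono) (auto simp: indicator_def intro!: ennreal_leI)
    also have "\<dots> = (\<integral>\<^sup>+x. (\<Sum>n\<in>N. ennreal (W x) * indicator {of_int n..<of_int n + 1} x) \<partial>lborel)"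
      by (subst nn_integral_sum) auto
    also have "\<dots> \<le> (\<integral>\<^sup>+x. ennreal (W x) \<partial>lborel)"
    proof (intro nn_integral_mono)
      fix x
      have "(\<Sum>n\<in>N. ennreal (W x) * indicator {of_int n..<of_int n + 1} x)
          = (\<Sum>n\<in>N. if n = \<lfloor>x\<rfloor> then ennreal (W x) else 0)"
      proof (intro sum.cong refl)
        fix n
        have "x \<in> {of_int n..<of_int n + 1} \<longleftrightarrow> n = \<lfloor>x\<rfloor>" by (auto simp: floor_eq_iff eq_commute[of n])
        then show "ennreal (W x) * indicator {of_int n..<of_int n + 1} x = (if n = \<lfloor>x\<rfloor> then ennreal (W x) else 0)"
          by (simp add: indicator_def)
      qed
      also have "\<dots> \<le> ennreal (W x)" using N by (simp add: sum.delta)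
      finally show "(\<Sum>n\<in>N. ennreal (W x) * indicator {of_int n..<of_int n + 1} x) \<le> ennreal (W x)" .
    qed
    also have "\<dots> = (\<integral>\<^sup>+x. ennreal D * ennreal (\<bar>U x\<bar> powr p) + ennreal (D * 3 powr p) * ennreal (V x powr p) \<partial>lborel)"
      unfolding W_def using D by (intro nn_integral_cong) (simp add: ennreal_plus ennreal_mult mult.assoc)
    also have "\<dots> = ennreal D * (\<integral>\<^sup>+x. ennreal (\<bar>U x\<bar> powr p) \<partial>lborel) + ennreal (D * 3 powr p) * (\<integral>\<^sup>+x. ennreal (V x powr p) \<partial>lborel)"
      by (subst nn_integral_add) (auto simp: nn_integral_cmult)
    also have "\<dots> \<le> ennreal D * ennreal (C * S) + ennreal (D * 3 powr p) * ennreal (K * S)"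
      unfolding U_def V_def K_def S_def
      by (intro add_mono mult_left_mono * J conv_pker_Lp assms) auto
    also have "\<dots> = ennreal (E * S)"
      using D C S K by (simp add: E_def flip: ennreal_plus ennreal_mult) (simp add: algebra_simps)
    finally show ?thesis
      using D C S K by (subst (asm) ennreal_le_iff) (auto simp: E_def U_def S_def)
  qed
  then have "kernel_lp p E hker" using C D K by (simp add: kernel_lp_def E_def)
  then show ?thesis ..
qed


section \<open>Duality on the integers and the conjugate kernel for all exponents\<close>

text \<open>As \<open>hker\<close> is odd, the transposed operator is minus the operator itself, and
  its bound for the conjugate exponent p \<le> 2 is known. Young's inequality with a scaling
  parameter replaces Hoelder's: a multiple of the left side is absorbed, which is legitimate because
  all sums are finite.\<close>

lemma hker_lp_large:
  fixes q :: real
  assumes "q \<ge> 2"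
  shows "\<exists>C. kernel_lp q C (hker :: real \<Rightarrow> real)"
proof -
  define p where "p = q / (q - 1)"
  have p: "1 < p" "p \<le> 2" "1 / p + 1 / q = 1" "(q - 1) * p = q"
    using assms by (auto simp: p_def field_simps)
  obtain C where "kernel_lp p C (hker :: real \<Rightarrow> real)"
    using hker_lp_small[OF p(1,2)] by blast
  then have C: "C \<ge> 0" and *:
    "\<And>J N (z :: int \<Rightarrow> real). finite J \<Longrightarrow> finite N \<Longrightarrow>
      (\<Sum>n\<in>N. \<bar>\<Sum>j\<in>J. z j * hker (of_int n - of_int j)\<bar> powr p) \<le> C * (\<Sum>j\<in>J. \<bar>z j\<bar> powr p)"
    by (simp_all add: kernel_lp_def)
  \<comment> \<open>Chosen so that C / l^p \<le> 1 / 2, which allows the absorption; the summand 1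
    keeps \<open>l\<close> positive when \<open>C = 0\<close>.\<close>
  define l where "l = (2 * (C + 1)) powr (1 / p)"
  have l: "l > 0" "l powr p = 2 * (C + 1)" using C p by (auto simp: l_def powr_powr)
  have main: "(\<Sum>n\<in>N. \<bar>\<Sum>j\<in>J. z j * hker (of_int n - of_int j)\<bar> powr q) \<le> 2 * l powr q * (\<Sum>j\<in>J. \<bar>z j\<bar> powr q)"
    if J: "finite J" and N: "finite N" for J N and z :: "int \<Rightarrow> real"
  proof -
    define a where "a n = (\<Sum>j\<in>J. z j * hker (of_int n - of_int j))" for n :: int
    \<comment> \<open>The extremal sequence of Hoelder's inequality: its pairing with
      \<open>a\<close> and its \<open>p\<close>-th power sum both equal the \<open>q\<close>-th
      power sum of \<open>a\<close>.\<close>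
    define w where "w n = \<bar>a n\<bar> powr (q - 1) * sgn (a n)" for n
    define b where "b j = (\<Sum>n\<in>N. w n * hker (of_int j - of_int n))" for j :: int
    have aw: "a n * w n = \<bar>a n\<bar> powr q" for n
    proof -
      have "a n * w n = \<bar>a n\<bar> * \<bar>a n\<bar> powr (q - 1)" by (simp add: w_def abs_sgn mult_ac)
      then show ?thesis using powr_mult_base[of "\<bar>a n\<bar>" "q - 1"] by simp
    qed
    have wp: "\<bar>w n\<bar> powr p = \<bar>a n\<bar> powr q" for n
      using p(1) by (cases "a n = 0") (auto simp: w_def abs_mult abs_sgn_eq powr_powr p(4))
    define X Y where "X = (\<Sum>n\<in>N. \<bar>a n\<bar> powr q)" and "Y = (\<Sum>j\<in>J. \<bar>z j\<bar> powr q)"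
    have X0: "X \<ge> 0" and Y0: "Y \<ge> 0" by (simp_all add: X_def Y_def sum_nonneg)
    have bp: "(\<Sum>j\<in>J. \<bar>b j\<bar> powr p) \<le> C * X"
      using *[OF N J, of w] unfolding b_def[symmetric] wp X_def by simp
    have "X = (\<Sum>n\<in>N. a n * w n)" by (simp add: X_def aw)
    also have "\<dots> = (\<Sum>n\<in>N. \<Sum>j\<in>J. z j * (w n * hker (of_int n - of_int j)))"
      by (simp add: a_def sum_distrib_left mult_ac)
    also have "\<dots> = (\<Sum>j\<in>J. \<Sum>n\<in>N. z j * (w n * hker (of_int n - of_int j)))"
      by (rule sum.swap)
    also have "\<dots> = (\<Sum>j\<in>J. - (z j * b j))"
    proof (intro sum.cong refl)
      fix j
      have "hker (of_int n - of_int j) = - hker (of_int j - of_int n)" for n :: int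
        using hker_minus[of "of_int j - of_int n"] by simp
      then show "(\<Sum>n\<in>N. z j * (w n * hker (of_int n - of_int j))) = - (z j * b j)"
        by (simp add: b_def sum_distrib_left sum_negf)
    qed
    also have "\<dots> \<le> (\<Sum>j\<in>J. l powr q * \<bar>z j\<bar> powr q + \<bar>b j\<bar> powr p / l powr p)"
    proof (intro sum_mono)
      fix j
      have "- (z j * b j) \<le> \<bar>z j * b j\<bar>" by simp
      also have "\<bar>z j * b j\<bar> = (\<bar>b j\<bar> / l) * (l * \<bar>z j\<bar>)" using l by (simp add: abs_mult)
      also have "\<dots> \<le> (\<bar>b j\<bar> / l) powr p / p + (l * \<bar>z j\<bar>) powr q / q"
        using p assms l by (intro Youngs_inequality) auto
      also have "\<dots> \<le> (\<bar>b j\<bar> / l) powr p / 1 + (l * \<bar>z j\<bar>) powr q / 1"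
        using p assms by (intro add_mono divide_left_mono) auto
      finally show "- (z j * b j) \<le> l powr q * \<bar>z j\<bar> powr q + \<bar>b j\<bar> powr p / l powr p"
        using l by (simp add: powr_mult powr_divide)
    qed
    also have "\<dots> = l powr q * Y + (\<Sum>j\<in>J. \<bar>b j\<bar> powr p) / l powr p"
      by (simp add: sum.distrib sum_distrib_left sum_divide_distrib Y_def)
    also have "\<dots> \<le> l powr q * Y + C * X / l powr p"
      using bp by (intro add_left_mono divide_right_mono) auto
    also have "C * X / l powr p \<le> X / 2"
      unfolding l(2) using C X0 by (simp add: field_simps)
    finally show ?thesis by (simp add: X_def Y_def a_def)
  qed
  then have "kernel_lp q (2 * l powr q) (hker :: real \<Rightarrow> real)" by (simp add: kernel_lp_def)
  then show ?thesis ..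
qed

lemma kernel_lp_complex:
  fixes K :: "real \<Rightarrow> real"
  assumes "p > 1" "kernel_lp p C K"
  shows "kernel_lp p (2 powr (p - 1) * (2 * C)) (\<lambda>x. complex_of_real (K x))"
proof -
  have C: "C \<ge> 0" and *:
    "\<And>J N (z :: int \<Rightarrow> real). finite J \<Longrightarrow> finite N \<Longrightarrow>
      (\<Sum>n\<in>N. \<bar>\<Sum>j\<in>J. z j * K (of_int n - of_int j)\<bar> powr p) \<le> C * (\<Sum>j\<in>J. \<bar>z j\<bar> powr p)"
    using assms by (simp_all add: kernel_lp_def)
  have "(\<Sum>n\<in>N. norm (\<Sum>j\<in>J. y j * complex_of_real (K (of_int n - of_int j))) powr p)
      \<le> 2 powr (p - 1) * (2 * C) * (\<Sum>j\<in>J. norm (y j) powr p)" if J: "finite J" and N: "finite N" for J N y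
  proof -
    define r i where "r n = (\<Sum>j\<in>J. Re (y j) * K (of_int n - of_int j))"
      and "i n = (\<Sum>j\<in>J. Im (y j) * K (of_int n - of_int j))" for n :: int
    have "norm (\<Sum>j\<in>J. y j * complex_of_real (K (of_int n - of_int j))) powr p
       \<le> 2 powr (p - 1) * (\<bar>r n\<bar> powr p + \<bar>i n\<bar> powr p)" for n
    proof -
      have "(\<Sum>j\<in>J. y j * complex_of_real (K (of_int n - of_int j))) = of_real (r n) + \<i> * of_real (i n)"
        by (auto simp: complex_eq_iff r_def i_def)
      then show ?thesis
        using norm_add_powr_le[OF assms(1), of "complex_of_real (r n)" "\<i> * of_real (i n)"] by (simp add: norm_mult)
    qed
    then have "(\<Sum>n\<in>N. norm (\<Sum>j\<in>J. y j * complex_of_real (K (of_int n - of_int j))) powr p)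
       \<le> (\<Sum>n\<in>N. 2 powr (p - 1) * (\<bar>r n\<bar> powr p + \<bar>i n\<bar> powr p))"
      by (intro sum_mono)
    also have "\<dots> = 2 powr (p - 1) * ((\<Sum>n\<in>N. \<bar>r n\<bar> powr p) + (\<Sum>n\<in>N. \<bar>i n\<bar> powr p))"
      by (simp add: sum_distrib_left sum.distrib distrib_left)
    also have "\<dots> \<le> 2 powr (p - 1) * (C * (\<Sum>j\<in>J. \<bar>Re (y j)\<bar> powr p) + C * (\<Sum>j\<in>J. \<bar>Im (y j)\<bar> powr p))"
      unfolding r_def i_def by (intro mult_left_mono add_mono * J N) auto
    also have "\<dots> \<le> 2 powr (p - 1) * (C * (\<Sum>j\<in>J. norm (y j) powr p) + C * (\<Sum>j\<in>J. norm (y j) powr p))"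
      using C assms by (intro mult_left_mono add_mono sum_mono powr_mono2) (auto simp: abs_Re_le_cmod abs_Im_le_cmod)
    finally show ?thesis by (simp add: algebra_simps)
  qed
  then show ?thesis using C by (simp add: kernel_lp_def)
qed

section \<open>Kernels of operators from sequences to functions\<close>

lemma kernel_LpD:
  assumes "kernel_Lp p C K" "finite J"
  shows "(\<integral>\<^sup>+x. ennreal (norm (\<Sum>j\<in>J. y j * K (x - of_int j)) powr p) \<partial>lborel)
       \<le> ennreal (C * (\<Sum>j\<in>J. norm (y j) powr p))"
  using assms by (simp add: kernel_Lp_def)

lemma kernel_Lp_mono:
  assumes K: "kernel_Lp p C K" and CC': "C \<le> C'"
  shows "kernel_Lp p C' K"
  unfolding kernel_Lp_def
proof (intro conjI allI impI)
  show "0 \<le> C'" using K CC' by (simp add: kernel_Lp_def)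
  fix J :: "int set" and y :: "int \<Rightarrow> 'a" assume "finite J"
  then have "(\<integral>\<^sup>+x. ennreal (norm (\<Sum>j\<in>J. y j * K (x - of_int j)) powr p) \<partial>lborel)
       \<le> ennreal (C * (\<Sum>j\<in>J. norm (y j) powr p))" by (rule kernel_LpD[OF K])
  also have "\<dots> \<le> ennreal (C' * (\<Sum>j\<in>J. norm (y j) powr p))"
    by (intro ennreal_leI mult_right_mono CC' sum_nonneg) auto
  finally show "(\<integral>\<^sup>+x. ennreal (norm (\<Sum>j\<in>J. y j * K (x - of_int j)) powr p) \<partial>lborel)
       \<le> ennreal (C' * (\<Sum>j\<in>J. norm (y j) powr p))" .
qed

lemma kernel_Lp_pker:
  fixes K :: "real \<Rightarrow> complex"
  assumes p: "p > 1" and B: "B \<ge> 0" "\<And>t. norm (K t) \<le> B * pker t"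
  shows "kernel_Lp p (B powr p * (18 powr (p - 1) * pi)) K"
  unfolding kernel_Lp_def
proof (intro conjI allI impI)
  fix J :: "int set" and y :: "int \<Rightarrow> complex" assume J: "finite J"
  have "(\<integral>\<^sup>+x. ennreal (norm (\<Sum>j\<in>J. y j * K (x - of_int j)) powr p) \<partial>lborel)
     \<le> (\<integral>\<^sup>+x. ennreal (B powr p) * ennreal ((\<Sum>j\<in>J. norm (y j) * pker (x - of_int j)) powr p) \<partial>lborel)"
  proof (intro nn_integral_mono)
    fix x
    have "norm (\<Sum>j\<in>J. y j * K (x - of_int j)) \<le> (\<Sum>j\<in>J. norm (y j) * (B * pker (x - of_int j)))"
      by (intro sum_norm_le) (auto simp: norm_mult intro!: mult_left_mono B)
    also have "\<dots> = B * (\<Sum>j\<in>J. norm (y j) * pker (x - of_int j))" by (simp add: sum_distrib_left mult_ac)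
    finally have "norm (\<Sum>j\<in>J. y j * K (x - of_int j)) powr p \<le> (B * (\<Sum>j\<in>J. norm (y j) * pker (x - of_int j))) powr p"
      using p by (intro powr_mono2) auto
    also have "\<dots> = B powr p * (\<Sum>j\<in>J. norm (y j) * pker (x - of_int j)) powr p"
      using B by (intro powr_mult) 
    finally show "ennreal (norm (\<Sum>j\<in>J. y j * K (x - of_int j)) powr p)
        \<le> ennreal (B powr p) * ennreal ((\<Sum>j\<in>J. norm (y j) * pker (x - of_int j)) powr p)"
      by (simp add: ennreal_leI flip: ennreal_mult)
  qed
  also have "\<dots> \<le> ennreal (B powr p) * ennreal (18 powr (p - 1) * pi * (\<Sum>j\<in>J. norm (y j) powr p))"
    by (subst nn_integral_cmult) (auto intro!: mult_left_mono conv_pker_Lp p J)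
  also have "\<dots> = ennreal (B powr p * (18 powr (p - 1) * pi) * (\<Sum>j\<in>J. norm (y j) powr p))"
    by (subst ennreal_mult[symmetric]) (auto intro!: mult_nonneg_nonneg sum_nonneg simp: mult_ac)
  finally show "(\<integral>\<^sup>+x. ennreal (norm (\<Sum>j\<in>J. y j * K (x - of_int j)) powr p) \<partial>lborel)
      \<le> ennreal (B powr p * (18 powr (p - 1) * pi) * (\<Sum>j\<in>J. norm (y j) powr p))" .
qed auto

text \<open>A modulation of the kernel splits into unimodular factors on the coefficients and one
  unimodular factor depending on \<open>x\<close> alone. The constant stays the same whatever the
  frequency, so intervals may lie anywhere.\<close>

lemma kernel_Lp_modulate:
  fixes K :: "real \<Rightarrow> complex"
  assumes K: "kernel_Lp p C K"
  shows "kernel_Lp p C (\<lambda>t. exp (\<i> * of_real (b * t)) * K t)"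
  unfolding kernel_Lp_def
proof (intro conjI allI impI)
  show "0 \<le> C" using K by (simp add: kernel_Lp_def)
  fix J :: "int set" and y :: "int \<Rightarrow> complex" assume J: "finite J"
  define z where "z j = y j * exp (\<i> * of_real (- (b * of_int j)))" for j
  have nz: "norm (z j) = norm (y j)" for j by (simp add: z_def norm_mult)
  have "(\<Sum>j\<in>J. y j * (exp (\<i> * of_real (b * (x - of_int j))) * K (x - of_int j)))
      = exp (\<i> * of_real (b * x)) * (\<Sum>j\<in>J. z j * K (x - of_int j))" for x
  proof -
    have "exp (\<i> * of_real (b * (x - of_int j))) = exp (\<i> * of_real (b * x)) * exp (\<i> * of_real (- (b * of_int j)))" for j
      by (simp add: exp_add[symmetric] algebra_simps)
    then show ?thesis by (simp add: z_def sum_distrib_left mult_ac)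
  qed
  then have "norm (\<Sum>j\<in>J. y j * (exp (\<i> * of_real (b * (x - of_int j))) * K (x - of_int j)))
      = norm (\<Sum>j\<in>J. z j * K (x - of_int j))" for x
    by (simp only: norm_mult norm_exp_i_times mult_1)
  then show "(\<integral>\<^sup>+x. ennreal (norm (\<Sum>j\<in>J. y j * (exp (\<i> * of_real (b * (x - of_int j))) * K (x - of_int j))) powr p) \<partial>lborel)
       \<le> ennreal (C * (\<Sum>j\<in>J. norm (y j) powr p))"
    using kernel_LpD[OF K J, of z] unfolding nz by simp
qed

text \<open>Jensen with weights \<open>norm (a i)\<close> yields the constant of the triangle
  inequality for the operator norm. It depends only on the absolute sum of the coefficients, not on
  the number of terms, as averages and series require.\<close>

lemma kernel_Lp_lincomb:
  fixes K :: "'i \<Rightarrow> real \<Rightarrow> complex"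
  assumes p: "p > 1" and [measurable]: "\<And>i. i \<in> I \<Longrightarrow> K i \<in> borel_measurable borel"
    and K: "\<And>i. i \<in> I \<Longrightarrow> kernel_Lp p C (K i)" and C: "C \<ge> 0"
  shows "kernel_Lp p (C * (\<Sum>i\<in>I. norm (a i)) powr p) (\<lambda>t. \<Sum>i\<in>I. a i * K i t)"
  unfolding kernel_Lp_def
proof (intro conjI allI impI)
  show "0 \<le> C * (\<Sum>i\<in>I. norm (a i)) powr p" using C by simp
  fix J :: "int set" and y :: "int \<Rightarrow> complex" assume J: "finite J"
  define F where "F i x = (\<Sum>j\<in>J. y j * K i (x - of_int j))" for i x
  have [measurable]: "F i \<in> borel_measurable borel" if [simp]: "i \<in> I" for i
    unfolding F_def by measurable
  define A where "A = (\<Sum>i\<in>I. norm (a i))"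
  have A: "A \<ge> 0" by (simp add: A_def sum_nonneg)
  have AA: "A powr (p - 1) * A = A powr p"
    using A powr_mult_base[of A "p - 1"] by (simp add: mult.commute)
  define Y where "Y = (\<Sum>j\<in>J. norm (y j) powr p)"
  have Y: "Y \<ge> 0" by (simp add: Y_def sum_nonneg)
  have swap: "(\<Sum>j\<in>J. y j * (\<Sum>i\<in>I. a i * K i (x - of_int j))) = (\<Sum>i\<in>I. a i * F i x)" for x
    unfolding F_def sum_distrib_left by (subst sum.swap) (simp add: mult_ac)
  have "(\<integral>\<^sup>+x. ennreal (norm (\<Sum>j\<in>J. y j * (\<Sum>i\<in>I. a i * K i (x - of_int j))) powr p) \<partial>lborel)
     \<le> (\<integral>\<^sup>+x. (\<Sum>i\<in>I. ennreal (A powr (p - 1) * norm (a i)) * ennreal (norm (F i x) powr p)) \<partial>lborel)"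
    unfolding swap
  proof (intro nn_integral_mono)
    fix x
    have "norm (\<Sum>i\<in>I. a i * F i x) \<le> (\<Sum>i\<in>I. norm (a i) * norm (F i x))"
      by (intro sum_norm_le) (simp add: norm_mult)
    then have "norm (\<Sum>i\<in>I. a i * F i x) powr p \<le> (\<Sum>i\<in>I. norm (a i) * norm (F i x)) powr p"
      using p by (intro powr_mono2) auto
    also have "\<dots> \<le> A powr (p - 1) * (\<Sum>i\<in>I. norm (a i) * norm (F i x) powr p)"
      unfolding A_def by (intro powr_sum_weighted_le p) auto
    finally have "ennreal (norm (\<Sum>i\<in>I. a i * F i x) powr p)
        \<le> ennreal (\<Sum>i\<in>I. A powr (p - 1) * norm (a i) * norm (F i x) powr p)"
      by (intro ennreal_leI) (simp add: sum_distrib_left mult.assoc)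
    also have "\<dots> = (\<Sum>i\<in>I. ennreal (A powr (p - 1) * norm (a i)) * ennreal (norm (F i x) powr p))"
      by (subst sum_ennreal[symmetric]) (auto simp: ennreal_mult intro!: sum.cong)
    finally show "ennreal (norm (\<Sum>i\<in>I. a i * F i x) powr p)
      \<le> (\<Sum>i\<in>I. ennreal (A powr (p - 1) * norm (a i)) * ennreal (norm (F i x) powr p))" .
  qed
  also have "\<dots> = (\<Sum>i\<in>I. ennreal (A powr (p - 1) * norm (a i)) * (\<integral>\<^sup>+x. ennreal (norm (F i x) powr p) \<partial>lborel))"
    by (subst nn_integral_sum) (auto intro!: sum.cong nn_integral_cmult)
  also have "\<dots> \<le> (\<Sum>i\<in>I. ennreal (A powr (p - 1) * norm (a i)) * ennreal (C * Y))"
    unfolding F_def Y_def by (intro sum_mono mult_left_mono kernel_LpD K J) auto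
  also have "\<dots> = (\<Sum>i\<in>I. ennreal (A powr (p - 1) * norm (a i) * (C * Y)))"
    using C Y by (intro sum.cong) (auto simp: ennreal_mult)
  also have "\<dots> = ennreal (A powr (p - 1) * A * C * Y)"
    using C Y by (subst sum_ennreal) (auto simp: A_def sum_distrib_left sum_distrib_right mult_ac)
  finally show "(\<integral>\<^sup>+x. ennreal (norm (\<Sum>j\<in>J. y j * (\<Sum>i\<in>I. a i * K i (x - of_int j))) powr p) \<partial>lborel)
      \<le> ennreal (C * (\<Sum>i\<in>I. norm (a i)) powr p * (\<Sum>j\<in>J. norm (y j) powr p))"
    unfolding AA by (simp add: A_def Y_def mult_ac)
qed

lemma kernel_Lp_limit:
  fixes K :: "nat \<Rightarrow> real \<Rightarrow> complex"
  assumes [measurable]: "\<And>n. K n \<in> borel_measurable borel"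
    and K: "\<And>n. kernel_Lp p (C n) (K n)" and p: "p > 1"
    and lim: "\<And>t. (\<lambda>n. K n t) \<longlonglongrightarrow> L t" and C: "C \<longlonglongrightarrow> C'"
  shows "kernel_Lp p C' L"
  unfolding kernel_Lp_def
proof (intro conjI allI impI)
  have "C n \<ge> 0" for n using K[of n] by (simp add: kernel_Lp_def)
  then show "C' \<ge> 0" by (intro LIMSEQ_le_const[OF C]) auto
  fix J :: "int set" and y :: "int \<Rightarrow> complex" assume J: "finite J"
  show "(\<integral>\<^sup>+x. ennreal (norm (\<Sum>j\<in>J. y j * L (x - of_int j)) powr p) \<partial>lborel)
       \<le> ennreal (C' * (\<Sum>j\<in>J. norm (y j) powr p))"
  proof (rule nn_integral_pointwise_limit_le)
    show "(\<lambda>x. ennreal (norm (\<Sum>j\<in>J. y j * K n (x - of_int j)) powr p)) \<in> borel_measurable lborel" for n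
      by measurable
    show "\<forall>\<^sub>F n in sequentially. (\<integral>\<^sup>+x. ennreal (norm (\<Sum>j\<in>J. y j * K n (x - of_int j)) powr p) \<partial>lborel)
       \<le> ennreal (C n * (\<Sum>j\<in>J. norm (y j) powr p))"
      by (intro always_eventually allI kernel_LpD K J)
    show "(\<lambda>n. C n * (\<Sum>j\<in>J. norm (y j) powr p)) \<longlonglongrightarrow> C' * (\<Sum>j\<in>J. norm (y j) powr p)"
      by (intro tendsto_intros C)
    show "(\<lambda>n. ennreal (norm (\<Sum>j\<in>J. y j * K n (x - of_int j)) powr p))
        \<longlonglongrightarrow> ennreal (norm (\<Sum>j\<in>J. y j * L (x - of_int j)) powr p)" for x
      using p by (intro tendsto_ennrealI tendsto_powr2 tendsto_intros lim) auto
  qed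
qed

text \<open>The return from the integers to the line, for every exponent: the value at
  \<open>x\<close> is compared with the one at \<open>\<lfloor>x\<rfloor>\<close>, and the resulting
  step function is integrated through the discrete bound.\<close>

lemma hker_Lp:
  assumes p: "p > 1"
  shows "\<exists>C. kernel_Lp p C (\<lambda>t. complex_of_real (hker t))"
proof -
  obtain C0 where "kernel_lp p C0 (hker :: real \<Rightarrow> real)"
    using hker_lp_small[of p] hker_lp_large[of p] p by (cases "p \<le> 2") auto
  then obtain C where "kernel_lp p C (\<lambda>t. complex_of_real (hker t))"
    using kernel_lp_complex[OF p] by blast
  then have C: "C \<ge> 0" and *: "\<And>J N y. finite J \<Longrightarrow> finite N \<Longrightarrow>
     (\<Sum>n\<in>N. norm (\<Sum>j\<in>J. y j * complex_of_real (hker (of_int n - of_int j))) powr p)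
       \<le> C * (\<Sum>j\<in>J. norm (y j) powr p)"
    by (simp_all add: kernel_lp_def)
  define D where "D = 2 powr (p - 1)"
  have D: "D \<ge> 0" by (simp add: D_def)
  define K where "K = 18 powr (p - 1) * pi"
  have K: "K \<ge> 0" by (simp add: K_def)
  define E where "E = D * C + D * (3 powr p * K)"
  have "(\<integral>\<^sup>+x. ennreal (norm (\<Sum>j\<in>J. y j * complex_of_real (hker (x - of_int j))) powr p) \<partial>lborel)
      \<le> ennreal (E * (\<Sum>j\<in>J. norm (y j) powr p))" if J: "finite J" for J y
  proof -
    define U V where "U x = (\<Sum>j\<in>J. y j * complex_of_real (hker (x - of_int j)))"
      and "V x = (\<Sum>j\<in>J. norm (y j) * pker (x - of_int j))" for x
    define S where "S = (\<Sum>j\<in>J. norm (y j) powr p)"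
    have S: "S \<ge> 0" by (simp add: S_def sum_nonneg)
    have [measurable]: "U \<in> borel_measurable borel" "V \<in> borel_measurable borel"
      unfolding U_def V_def by measurable
    have near: "norm (U x) powr p \<le> D * norm (U (of_int \<lfloor>x\<rfloor>)) powr p + D * (3 powr p * V x powr p)" for x
    proof -
      have "\<bar>x - of_int \<lfloor>x\<rfloor>\<bar> \<le> 1" by linarith
      then show ?thesis using hker_conv_near[of p x "of_int \<lfloor>x\<rfloor>" x y J] p by (simp add: U_def V_def D_def)
    qed
    have disc: "(\<integral>\<^sup>+x. ennreal (norm (U (of_int \<lfloor>x\<rfloor>)) powr p) \<partial>(lborel :: real measure)) \<le> ennreal (C * S)"
    proof (rule nn_integral_pointwise_limit_le)
      let ?f = "\<lambda>n x. \<Sum>k\<in>{- int n..<int n}. ennreal (norm (U (of_int k)) powr p) * indicator {of_int k..<of_int k + 1 :: real} x"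
      show "?f n \<in> borel_measurable lborel" for n by measurable
      show "\<forall>\<^sub>F n in sequentially. (\<integral>\<^sup>+x. ?f n x \<partial>lborel) \<le> ennreal (C * S)"
      proof (intro always_eventually allI)
        fix n
        have "(\<integral>\<^sup>+x. ?f n x \<partial>lborel) = (\<Sum>k\<in>{- int n..<int n}. ennreal (norm (U (of_int k)) powr p))"
          by (subst nn_integral_sum) (auto simp: nn_integral_cmult_indicator)
        also have "\<dots> \<le> ennreal (C * S)"
          unfolding U_def S_def using *[OF J, of "{- int n..<int n}" y] by (simp add: ennreal_leI)
        finally show "(\<integral>\<^sup>+x. ?f n x \<partial>lborel) \<le> ennreal (C * S)" .
      qed
      show "(\<lambda>n. ?f n x) \<longlonglongrightarrow> ennreal (norm (U (of_int \<lfloor>x\<rfloor>)) powr p)" for x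
      proof (rule tendsto_eventually)
        have eq: "?f n x = (\<Sum>k\<in>{- int n..<int n}. if k = \<lfloor>x\<rfloor> then ennreal (norm (U (of_int \<lfloor>x\<rfloor>)) powr p) else 0)" for n
        proof (intro sum.cong refl)
          fix k
          have "x \<in> {of_int k..<of_int k + 1} \<longleftrightarrow> k = \<lfloor>x\<rfloor>" by (auto simp: floor_eq_iff eq_commute[of k])
          then show "ennreal (norm (U (of_int k)) powr p) * indicator {of_int k..<of_int k + 1} x
              = (if k = \<lfloor>x\<rfloor> then ennreal (norm (U (of_int \<lfloor>x\<rfloor>)) powr p) else 0)"
            by (simp add: indicator_def)
        qed
        show "\<forall>\<^sub>F n in sequentially. ?f n x = ennreal (norm (U (of_int \<lfloor>x\<rfloor>)) powr p)"
          using eventually_ge_at_top[of "nat (\<bar>\<lfloor>x\<rfloor>\<bar> + 1)"]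
        proof eventually_elim
          case (elim n)
          then have "\<lfloor>x\<rfloor> \<in> {- int n..<int n}" by auto
          then show ?case unfolding eq by simp
        qed
      qed
    qed auto
    have "(\<integral>\<^sup>+x. ennreal (norm (U x) powr p) \<partial>lborel)
      \<le> (\<integral>\<^sup>+x. ennreal D * ennreal (norm (U (of_int \<lfloor>x\<rfloor>)) powr p) + ennreal (D * 3 powr p) * ennreal (V x powr p) \<partial>lborel)"
    proof (intro nn_integral_mono)
      fix x
      show "ennreal (norm (U x) powr p)
         \<le> ennreal D * ennreal (norm (U (of_int \<lfloor>x\<rfloor>)) powr p) + ennreal (D * 3 powr p) * ennreal (V x powr p)"
        using ennreal_leI[OF near[of x]] D by (simp add: ennreal_mult mult.assoc)
    qed
    also have "\<dots> = ennreal D * (\<integral>\<^sup>+x. ennreal (norm (U (of_int \<lfloor>x\<rfloor>)) powr p) \<partial>(lborel :: real measure)) + ennreal (D * 3 powr p) * (\<integral>\<^sup>+x. ennreal (V x powr p) \<partial>lborel)"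
      by (subst nn_integral_add) (auto simp: nn_integral_cmult)
    also have "\<dots> \<le> ennreal D * ennreal (C * S) + ennreal (D * 3 powr p) * ennreal (K * S)"
      unfolding V_def K_def S_def
      by (intro add_mono mult_left_mono disc[unfolded S_def] J conv_pker_Lp p) auto
    also have "\<dots> = ennreal (E * S)"
      using D C S K by (simp add: E_def flip: ennreal_plus ennreal_mult) (simp add: algebra_simps)
    finally show ?thesis by (simp add: U_def S_def)
  qed
  then have "kernel_Lp p E (\<lambda>t. complex_of_real (hker t))"
    using C D K by (simp add: kernel_Lp_def E_def)
  then show ?thesis ..
qed

section \<open>Inverse Fourier transforms of symbols and the kernels of intervals\<close>

text \<open>The inverse Fourier transform without its factor 1 / (2 pi), which is restored only in
  the final theorem.\<close>

definition fourier_kernel :: "(real \<Rightarrow> real) \<Rightarrow> real \<Rightarrow> complex" where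
  "fourier_kernel m x = (LINT \<xi>|lborel. of_real (m \<xi>) * exp (\<i> * of_real x * of_real \<xi>))"

lemma fourier_kernel_integrable:
  assumes "integrable lborel m"
  shows "integrable lborel (\<lambda>\<xi>. complex_of_real (m \<xi>) * exp (\<i> * of_real x * of_real \<xi>))"
proof (rule Bochner_Integration.integrable_bound[OF assms])
  have [measurable]: "m \<in> borel_measurable lborel" using assms by auto
  show "(\<lambda>\<xi>. complex_of_real (m \<xi>) * exp (\<i> * of_real x * of_real \<xi>)) \<in> borel_measurable lborel"
    by measurable
  show "AE \<xi> in lborel. norm (complex_of_real (m \<xi>) * exp (\<i> * of_real x * of_real \<xi>)) \<le> norm (m \<xi>)"
  proof (intro AE_I2)
    fix \<xi>
    have "norm (exp (\<i> * of_real x * of_real \<xi>)) = 1"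
      using norm_exp_i_times[of "x * \<xi>"] by (simp add: mult.assoc)
    then show "norm (complex_of_real (m \<xi>) * exp (\<i> * of_real x * of_real \<xi>)) \<le> norm (m \<xi>)"
      by (simp add: norm_mult)
  qed
qed

lemma fourier_kernel_measurable:
  assumes [measurable]: "m \<in> borel_measurable borel"
  shows "fourier_kernel m \<in> borel_measurable borel"
  unfolding fourier_kernel_def[abs_def] by measurable

text \<open>The factor \<open>\<i> * of_real x\<close> stays on the left so that
  \<open>x = 0\<close> is no exception.\<close>

lemma fourier_kernel_interval:
  assumes ab: "a \<le> b"
  shows "\<i> * of_real x * fourier_kernel (indicator {a..b}) x
           = exp (\<i> * of_real x * of_real b) - exp (\<i> * of_real x * of_real a)"
proof -
  have "has_bochner_integral lborel
     (\<lambda>\<xi>. indicator {a..b} \<xi> *\<^sub>R (\<i> * of_real x * exp (\<i> * of_real x * of_real \<xi>)))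
     (exp (\<i> * of_real x * of_real b) - exp (\<i> * of_real x * of_real a))"
  proof (rule has_bochner_integral_FTC_Icc[OF ab])
    show "((\<lambda>\<xi>. exp (\<i> * of_real x * of_real \<xi>)) has_vector_derivative \<i> * of_real x * exp (\<i> * of_real x * of_real \<xi>)) (at \<xi> within {a..b})" for \<xi>
      by (rule has_vector_derivative_real_field) (auto intro!: derivative_eq_intros)
  qed (auto intro!: continuous_intros)
  then have "(LINT \<xi>|lborel. indicator {a..b} \<xi> *\<^sub>R (\<i> * of_real x * exp (\<i> * of_real x * of_real \<xi>)))
     = exp (\<i> * of_real x * of_real b) - exp (\<i> * of_real x * of_real a)"
    by (simp add: has_bochner_integral_iff)
  moreover have "(LINT \<xi>|lborel. indicator {a..b} \<xi> *\<^sub>R (\<i> * of_real x * exp (\<i> * of_real x * of_real \<xi>)))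
      = (LINT \<xi>|lborel. \<i> * of_real x * (of_real (indicator {a..b} \<xi>) * exp (\<i> * of_real x * of_real \<xi>)))"
    by (intro Bochner_Integration.integral_cong) (auto simp: indicator_def)
  ultimately show ?thesis
    unfolding fourier_kernel_def integral_mult_right_zero[symmetric] by simp
qed

lemma fourier_kernel_interval_bound:
  assumes ab: "a \<le> b"
  shows "norm (fourier_kernel (indicator {a..b}) x) \<le> b - a"
proof -
  have "norm (fourier_kernel (indicator {a..b}) x)
     \<le> (LINT \<xi>|lborel. norm (complex_of_real (indicator {a..b} \<xi>) * exp (\<i> * of_real x * of_real \<xi>)))"
    unfolding fourier_kernel_def by (rule integral_norm_bound)
  also have "\<dots> = (LINT \<xi>|lborel. indicator {a..b} \<xi>)"
    using norm_exp_i_times[of "x * \<xi>" for \<xi>]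
    by (intro Bochner_Integration.integral_cong) (auto simp: norm_mult indicator_def mult.assoc)
  also have "\<dots> = b - a" using ab by simp
  finally show ?thesis .
qed

text \<open>The decay makes the series of the operator converge absolutely for every sequence in \<open>\<ell>\<^sub>p\<close>.\<close>

definition adm_kernel :: "real \<Rightarrow> real \<Rightarrow> (real \<Rightarrow> complex) \<Rightarrow> bool" where
  "adm_kernel p A K \<longleftrightarrow> K \<in> borel_measurable borel \<and> A \<ge> 0 \<and> kernel_Lp p (A powr p) K
     \<and> (\<forall>x. norm (K x) \<le> A / (1 + \<bar>x\<bar>))"

text \<open>Because \<open>t * hker t + pker t = 1\<close>, the kernel \<open>F\<close> equals
  \<open>t F(t) hker t + F(t) pker t\<close>. Here \<open>t F(t)\<close> is, up to a unimodular
  constant, a difference of two exponentials, and \<open>F\<close> is bounded by the length of the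
  interval, hence by 2 pi.\<close>

lemma adm_kernel_interval:
  assumes p: "p > 1"
  shows "\<exists>A\<ge>0. \<forall>a b. a \<le> b \<longrightarrow> b - a \<le> 2 * pi \<longrightarrow> adm_kernel p A (fourier_kernel (indicator {a..b}))"
proof -
  obtain C where C: "kernel_Lp p C (\<lambda>t. complex_of_real (hker t))"
    using hker_Lp[OF p] by blast
  define K where "K = (2 * pi) powr p * (18 powr (p - 1) * pi)"
  define M where "M = max C K"
  \<comment> \<open>Three kernels are combined with coefficients of modulus 1.\<close>
  define B where "B = M * 3 powr p"
  have M0: "M \<ge> 0" using C by (auto simp: M_def kernel_Lp_def)
  have B0: "B \<ge> 0" using M0 by (simp add: B_def)
  \<comment> \<open>The 9 serves the decay: |x| |F x| \<le> 2 from the two exponentials, and |F x|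
    \<le> 2 pi < 7.\<close>
  define A where "A = max (B powr (1 / p)) 9"
  have A9: "A \<ge> 9" by (simp add: A_def)
  have AB: "B \<le> A powr p"
  proof -
    have "B = (B powr (1 / p)) powr p" using p B0 by (simp add: powr_powr)
    also have "\<dots> \<le> A powr p" using p by (intro powr_mono2) (auto simp: A_def)
    finally show ?thesis .
  qed
  have "adm_kernel p A (fourier_kernel (indicator {a..b}))" if ab: "a \<le> b" "b - a \<le> 2 * pi" for a b :: real
  proof -
    define F where "F = fourier_kernel (indicator {a..b})"
    have Fm [measurable]: "F \<in> borel_measurable borel"
      unfolding F_def by (intro fourier_kernel_measurable) auto
    have F1: "\<i> * of_real x * F x = exp (\<i> * of_real (b * x)) - exp (\<i> * of_real (a * x))" for x
      using fourier_kernel_interval[OF ab(1), of x] by (simp add: F_def mult_ac)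
    have F2: "norm (F x) \<le> 2 * pi" for x
      using fourier_kernel_interval_bound[OF ab(1), of x] ab by (simp add: F_def)
    have dec: "norm (F x) \<le> A / (1 + \<bar>x\<bar>)" for x
    proof -
      have "norm (\<i> * of_real x * F x) \<le> 1 + 1"
        unfolding F1 by (rule norm_triangle_le_diff) (simp only: norm_exp_i_times)
      then have "\<bar>x\<bar> * norm (F x) \<le> 2" by (simp add: norm_mult)
      moreover have "norm (F x) \<le> 7" using F2[of x] pi_less_4 pi_approx by simp
      ultimately have "norm (F x) * (1 + \<bar>x\<bar>) \<le> A" using A9 by (simp add: algebra_simps)
      then show ?thesis by (simp add: pos_le_divide_eq add_pos_nonneg)
    qed
    define k where "k i t = (if i = (0::nat) then exp (\<i> * of_real (b * t)) * of_real (hker t)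
       else if i = 1 then exp (\<i> * of_real (a * t)) * of_real (hker t) else F t * of_real (pker t))" for i t
    define c where "c i = (if i = (0::nat) then - \<i> else if i = 1 then \<i> else 1)" for i
    have Fdec: "F t = (\<Sum>i<3. c i * k i t)" for t
    proof -
      have e: "exp (\<i> * of_real (b * t)) - exp (\<i> * of_real (a * t)) = \<i> * of_real t * F t" by (rule F1[symmetric])
      have "(\<Sum>i<3. c i * k i t) = - \<i> * (exp (\<i> * of_real (b * t)) - exp (\<i> * of_real (a * t))) * of_real (hker t) + F t * of_real (pker t)"
        by (simp add: c_def k_def eval_nat_numeral algebra_simps)
      also have "\<dots> = F t * of_real (t * hker t + pker t)"
        unfolding e by (simp add: algebra_simps)
      also have "t * hker t + pker t = 1"
      proof -
        have "1 + t\<^sup>2 > 0" by (simp add: add_pos_nonneg)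
        then show ?thesis by (simp add: hker_def pker_def divide_simps) (simp add: power2_eq_square)
      qed
      finally show ?thesis by simp
    qed
    have "kernel_Lp p (M * (\<Sum>i<3. norm (c i)) powr p) (\<lambda>t. \<Sum>i<3. c i * k i t)"
    proof (rule kernel_Lp_lincomb[OF p])
      show "k i \<in> borel_measurable borel" for i unfolding k_def[abs_def] by measurable
      show "kernel_Lp p M (k i)" for i
      proof -
        have "kernel_Lp p C (\<lambda>t. exp (\<i> * of_real (u * t)) * complex_of_real (hker t))" for u
          by (rule kernel_Lp_modulate[OF C])
        moreover have "kernel_Lp p K (\<lambda>t. F t * complex_of_real (pker t))"
          unfolding K_def using p
          by (intro kernel_Lp_pker) (auto simp: norm_mult less_imp_le pker_pos intro!: mult_right_mono F2)
        ultimately have "kernel_Lp p C (k i) \<or> kernel_Lp p K (k i)" unfolding k_def[abs_def] by (cases "i = 0"; cases "i = 1") auto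
        then show ?thesis by (auto intro: kernel_Lp_mono simp: M_def)
      qed
    qed (rule M0)
    moreover have "(\<Sum>i<3. norm (c i)) = 3" by (simp add: c_def eval_nat_numeral)
    ultimately have "kernel_Lp p B F"
      by (simp add: B_def flip: Fdec)
    then have "kernel_Lp p (A powr p) F" using AB by (rule kernel_Lp_mono)
    then show ?thesis using dec A9 Fm by (auto simp: adm_kernel_def F_def)
  qed
  then show ?thesis using A9 by (intro exI[of _ A]) auto
qed

text \<open>Since \<open>adm_kernel\<close> records the \<open>p\<close>-th root of the constant,
  its parameters combine like norms, and the pointwise decay scales in the same way.\<close>

lemma adm_kernel_lincomb:
  assumes p: "p > 1" and K: "\<And>i. i \<in> I \<Longrightarrow> adm_kernel p A (K i)" and A: "A \<ge> 0"
  shows "adm_kernel p (A * (\<Sum>i\<in>I. norm (a i))) (\<lambda>t. \<Sum>i\<in>I. a i * K i t)"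
  unfolding adm_kernel_def
proof (intro conjI allI)
  have [measurable]: "\<And>i. i \<in> I \<Longrightarrow> K i \<in> borel_measurable borel"
    using K by (simp add: adm_kernel_def)
  show "(\<lambda>t. \<Sum>i\<in>I. a i * K i t) \<in> borel_measurable borel" by measurable
  show "0 \<le> A * (\<Sum>i\<in>I. norm (a i))" using A by (simp add: sum_nonneg)
  have "kernel_Lp p (A powr p * (\<Sum>i\<in>I. norm (a i)) powr p) (\<lambda>t. \<Sum>i\<in>I. a i * K i t)"
    using K by (intro kernel_Lp_lincomb p) (auto simp: adm_kernel_def)
  then show "kernel_Lp p ((A * (\<Sum>i\<in>I. norm (a i))) powr p) (\<lambda>t. \<Sum>i\<in>I. a i * K i t)"
    using A by (simp add: powr_mult sum_nonneg)
  show "norm (\<Sum>i\<in>I. a i * K i x) \<le> A * (\<Sum>i\<in>I. norm (a i)) / (1 + \<bar>x\<bar>)" for x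
  proof -
    have "norm (\<Sum>i\<in>I. a i * K i x) \<le> (\<Sum>i\<in>I. norm (a i) * (A / (1 + \<bar>x\<bar>)))"
      using K by (intro sum_norm_le)
         (auto simp: norm_mult adm_kernel_def simp del: times_divide_eq_right intro!: mult_left_mono)
    then show ?thesis by (simp add: sum_distrib_right sum_distrib_left sum_divide_distrib mult_ac)
  qed
qed

lemma adm_kernel_limit:
  assumes p: "p > 1" and K: "\<And>n. adm_kernel p (A n) (K n)"
    and lim: "\<And>t. (\<lambda>n. K n t) \<longlonglongrightarrow> L t" and A: "A \<longlonglongrightarrow> B"
  shows "adm_kernel p B L"
  unfolding adm_kernel_def
proof (intro conjI allI)
  have [measurable]: "\<And>n. K n \<in> borel_measurable borel" and A0: "\<And>n. A n \<ge> 0"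
    and Kd: "\<And>n x. norm (K n x) \<le> A n / (1 + \<bar>x\<bar>)"
    using K by (simp_all add: adm_kernel_def)
  show "L \<in> borel_measurable borel"
    by (rule borel_measurable_LIMSEQ_metric[of K]) (use lim in auto)
  show B: "B \<ge> 0" by (rule LIMSEQ_le_const[OF A]) (use A0 in auto)
  show "kernel_Lp p (B powr p) L"
  proof (rule kernel_Lp_limit[OF _ _ p lim])
    show "kernel_Lp p (A n powr p) (K n)" for n using K by (simp add: adm_kernel_def)
    show "(\<lambda>n. A n powr p) \<longlonglongrightarrow> B powr p"
      using p A0 by (intro tendsto_powr2 A tendsto_const) auto
  qed auto
  show "norm (L x) \<le> B / (1 + \<bar>x\<bar>)" for x
    by (rule LIMSEQ_le[OF tendsto_norm[OF lim[of x]] tendsto_divide[OF A tendsto_const]]) (use Kd in auto)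
qed

section \<open>Monotone symbols\<close>

lemma adm_kernel_mono:
  assumes K: "adm_kernel p A K" and AB: "A \<le> B" and p: "p > 1"
  shows "adm_kernel p B K"
proof -
  have A: "A \<ge> 0" "kernel_Lp p (A powr p) K" and K': "K \<in> borel_measurable borel"
    "\<And>x. norm (K x) \<le> A / (1 + \<bar>x\<bar>)"
    using K by (auto simp: adm_kernel_def)
  have "A powr p \<le> B powr p" using A AB p by (intro powr_mono2) auto
  then have "kernel_Lp p (B powr p) K" by (rule kernel_Lp_mono[OF A(2)])
  moreover have "norm (K x) \<le> B / (1 + \<bar>x\<bar>)" for x
    using K'(2)[of x] AB divide_right_mono[of A B "1 + \<bar>x\<bar>"] by linarith
  ultimately show ?thesis using A AB K'(1) by (simp add: adm_kernel_def)
qed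

lemma fourier_kernel_sum:
  assumes "\<And>i. i \<in> I \<Longrightarrow> integrable lborel (m i)"
  shows "fourier_kernel (\<lambda>\<xi>. \<Sum>i\<in>I. a i * m i \<xi>) x = (\<Sum>i\<in>I. of_real (a i) * fourier_kernel (m i) x)"
proof -
  have "fourier_kernel (\<lambda>\<xi>. \<Sum>i\<in>I. a i * m i \<xi>) x
      = (LINT \<xi>|lborel. (\<Sum>i\<in>I. of_real (a i) * (of_real (m i \<xi>) * exp (\<i> * of_real x * of_real \<xi>))))"
    unfolding fourier_kernel_def
    by (intro Bochner_Integration.integral_cong) (auto simp: sum_distrib_right sum_distrib_left mult_ac)
  also have "\<dots> = (\<Sum>i\<in>I. LINT \<xi>|lborel. of_real (a i) * (of_real (m i \<xi>) * exp (\<i> * of_real x * of_real \<xi>)))"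
    by (intro Bochner_Integration.integral_sum integrable_mult_right fourier_kernel_integrable assms)
  finally show ?thesis by (simp add: fourier_kernel_def)
qed

text \<open>Disposes of endpoints of intervals and of the lattice of multiples of 2 pi, where the
  symbol is only defined by continuity.\<close>

lemma fourier_kernel_discrete_difference:
  assumes "countable X" "\<And>\<xi>. \<xi> \<notin> X \<Longrightarrow> m \<xi> = m' \<xi>"
  shows "fourier_kernel m = fourier_kernel m'"
  unfolding fourier_kernel_def fun_eq_iff
  by (intro allI integral_discrete_difference[of X]) (use assms in auto)

definition interval_adm :: "real \<Rightarrow> real \<Rightarrow> bool" where
  "interval_adm p A \<longleftrightarrow> A \<ge> 0 \<and>
     (\<forall>a b. a \<le> b \<longrightarrow> b - a \<le> 2 * pi \<longrightarrow> adm_kernel p A (fourier_kernel (indicator {a..b})))"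

text \<open>An upper level set of an increasing function is an interval that reaches up to
  \<open>b\<close>; it differs from \<open>{c..b}\<close>, with \<open>c\<close> its infimum, at
  most in the two endpoints. An empty level set corresponds to the null set
  \<open>{b..b}\<close>.\<close>

lemma fourier_kernel_upper_level_set:
  fixes h :: "real \<Rightarrow> real"
  assumes ab: "a < b" and h: "mono_on {a<..<b} h"
  shows "\<exists>c. a \<le> c \<and> c \<le> b \<and> fourier_kernel (indicator {\<xi>\<in>{a<..<b}. t < h \<xi>}) = fourier_kernel (indicator {c..b})"
proof (cases "{\<xi>\<in>{a<..<b}. t < h \<xi>} = {}")
  case True
  show ?thesis
    using ab unfolding True by (intro exI[of _ b] conjI fourier_kernel_discrete_difference[of "{b}"]) auto
next
  case False
  define S where "S = {\<xi>\<in>{a<..<b}. t < h \<xi>}"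
  define c where "c = Inf S"
  have S: "S \<noteq> {}" "S \<subseteq> {a<..<b}" using False by (auto simp: S_def)
  have bdd: "bdd_below S" using S(2) by (intro bdd_belowI[of _ a]) auto
  have lower: "c \<le> \<xi>" if "\<xi> \<in> S" for \<xi> unfolding c_def by (rule cInf_lower[OF that bdd])
  have ac: "a \<le> c" unfolding c_def using S by (intro cInf_greatest) auto
  have cb: "c \<le> b"
  proof -
    obtain s where s: "s \<in> S" using S(1) by blast
    then have "s < b" using S(2) by auto
    then show ?thesis using lower[OF s] by linarith
  qed
  have up: "\<xi> \<in> S" if "c < \<xi>" "\<xi> < b" for \<xi>
  proof -
    obtain s where s: "s \<in> S" "s < \<xi>" using \<open>c < \<xi>\<close> unfolding c_def cInf_less_iff[OF S(1) bdd] by blast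
    then have "h s \<le> h \<xi>" using that S(2) ac by (intro mono_onD[OF h]) auto
    then show ?thesis using s that ac by (auto simp: S_def)
  qed
  have "fourier_kernel (indicator S) = fourier_kernel (indicator {c..b})"
  proof (rule fourier_kernel_discrete_difference[of "{c, b}"])
    fix \<xi> assume x: "\<xi> \<notin> {c, b}"
    have "\<xi> \<in> S \<longleftrightarrow> \<xi> \<in> {c..b}"
    proof
      assume "\<xi> \<in> S" then show "\<xi> \<in> {c..b}" using lower[of \<xi>] S(2) by auto
    next
      assume "\<xi> \<in> {c..b}" then show "\<xi> \<in> S" using up[of \<xi>] x by auto
    qed
    then show "indicator S \<xi> = (indicator {c..b} \<xi> :: real)" by (simp add: indicator_def)
  qed simp
  then show ?thesis using ac cb by (auto simp: S_def)
qed

text \<open>A discrete layer-cake formula: \<open>s n\<close> averages the indicators of the level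
  sets at the heights i / (n + 1) and is within 1 / (n + 1) of the symbol. An average has total
  weight 1, so the constant \<open>A\<close> of intervals survives unchanged.\<close>

lemma adm_kernel_mono_on:
  assumes p: "p > 1" and A: "interval_adm p A" and ab: "a < b" "b - a \<le> 2 * pi"
    and h: "mono_on {a<..<b} h" and h01: "\<And>\<xi>. a < \<xi> \<Longrightarrow> \<xi> < b \<Longrightarrow> 0 \<le> h \<xi> \<and> h \<xi> \<le> 1"
  defines "m \<equiv> \<lambda>\<xi>. indicator {a<..<b} \<xi> * h \<xi>"
  shows "m \<in> borel_measurable borel" "adm_kernel p A (fourier_kernel m)"
proof -
  define S where "S n i = {\<xi>\<in>{a<..<b}. real i / real (Suc n) < h \<xi>}" for n i :: nat
  define s where "s n \<xi> = (\<Sum>i<Suc n. 1 / real (Suc n) * indicator (S n i) \<xi>)" for n \<xi>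
  have Sm [measurable]: "S n i \<in> sets borel" for n i
  proof -
    have "is_interval (S n i)"
      unfolding is_interval_1
    proof (intro ballI allI impI)
      fix u v w assume "u \<in> S n i" "v \<in> S n i" "u \<le> w \<and> w \<le> v"
      then show "w \<in> S n i"
        using mono_onD[OF h, of u w] by (auto simp: S_def)
    qed
    then show ?thesis by (rule real_interval_borel_measurable)
  qed
  have sm [measurable]: "s n \<in> borel_measurable borel" for n
    unfolding s_def by measurable
  have close: "\<bar>s n \<xi> - m \<xi>\<bar> \<le> 1 / real (Suc n)" for n \<xi>
  proof (cases "\<xi> \<in> {a<..<b}")
    case False
    then have "\<xi> \<notin> S n i" for i by (auto simp: S_def)
    then show ?thesis using False by (simp add: s_def m_def)
  next
    case True
    define t where "t = h \<xi> * real (Suc n)"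
    have t: "0 \<le> t" "t \<le> real (Suc n)"
      using h01[of \<xi>] True mult_right_mono[of "h \<xi>" 1 "real (Suc n)"] by (auto simp: t_def)
    \<comment> \<open>Counting the levels below h(\<xi>) gives a ceiling, which rounds
      \<open>t\<close> by at most 1.\<close>
    have iff: "\<xi> \<in> S n i \<longleftrightarrow> i < nat \<lceil>t\<rceil>" for i
    proof -
      have "\<xi> \<in> S n i \<longleftrightarrow> real i < t" using True by (simp add: S_def t_def field_simps)
      also have "\<dots> \<longleftrightarrow> i < nat \<lceil>t\<rceil>" by (simp add: zless_nat_eq_int_zless less_ceiling_iff)
      finally show ?thesis .
    qed
    have "s n \<xi> = 1 / real (Suc n) * (\<Sum>i<Suc n. of_bool (i < nat \<lceil>t\<rceil>))"
      unfolding s_def sum_distrib_left by (intro sum.cong refl) (simp add: indicator_def iff)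
    also have "(\<Sum>i<Suc n. of_bool (i < nat \<lceil>t\<rceil>)) = real (card ({..<Suc n} \<inter> {i. i < nat \<lceil>t\<rceil>}))"
      by (subst sum_of_bool_eq) auto
    also have "{..<Suc n} \<inter> {i. i < nat \<lceil>t\<rceil>} = {..<nat \<lceil>t\<rceil>}"
      using t by (auto simp: nat_le_iff ceiling_le_iff less_le_trans)
    finally have "s n \<xi> = real (nat \<lceil>t\<rceil>) / real (Suc n)" by simp
    moreover have "m \<xi> = t / real (Suc n)" using True by (simp add: m_def t_def)
    ultimately have "s n \<xi> - m \<xi> = (real (nat \<lceil>t\<rceil>) - t) / real (Suc n)" by (simp add: diff_divide_distrib)
    moreover have "\<bar>real (nat \<lceil>t\<rceil>) - t\<bar> \<le> 1" using t by linarith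
    ultimately show ?thesis by (simp add: abs_divide divide_right_mono)
  qed
  have lim: "(\<lambda>n. s n \<xi>) \<longlonglongrightarrow> m \<xi>" for \<xi>
  proof (rule LIM_zero_cancel, rule Lim_null_comparison)
    show "\<forall>\<^sub>F n in sequentially. norm (s n \<xi> - m \<xi>) \<le> 1 / real (Suc n)"
      using close by simp
    show "(\<lambda>n. 1 / real (Suc n)) \<longlonglongrightarrow> 0" by (rule LIMSEQ_Suc[OF lim_1_over_n])
  qed
  show mm [measurable]: "m \<in> borel_measurable borel"
    by (rule borel_measurable_LIMSEQ_metric[of s]) (use lim in auto)
  have s1: "\<bar>s n \<xi>\<bar> \<le> indicator {a<..<b} \<xi>" for n \<xi>
  proof (cases "\<xi> \<in> {a<..<b}")
    case True
    have "s n \<xi> \<le> (\<Sum>i<Suc n. 1 / real (Suc n) * 1)"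
      unfolding s_def by (intro sum_mono mult_left_mono) (auto simp: indicator_def)
    moreover have "s n \<xi> \<ge> 0" unfolding s_def by (intro sum_nonneg) auto
    ultimately show ?thesis using True by simp
  next
    case False
    then have "\<xi> \<notin> S n i" for i by (auto simp: S_def)
    then show ?thesis using False by (simp add: s_def)
  qed
  have iS: "integrable lborel (indicator (S n i) :: real \<Rightarrow> real)" for n i
  proof (rule integrable_real_indicator)
    show "S n i \<in> sets lborel" by simp
    have "emeasure lborel (S n i) \<le> emeasure lborel {a<..<b}" by (intro emeasure_mono) (auto simp: S_def)
    also have "\<dots> < \<infinity>" using ab by simp
    finally show "emeasure lborel (S n i) < \<infinity>" .
  qed
  have adm: "adm_kernel p A (fourier_kernel (s n))" for n
  proof -
    have 1: "adm_kernel p A (fourier_kernel (indicator (S n i)))" for i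
    proof -
      obtain c where c: "a \<le> c" "c \<le> b" "fourier_kernel (indicator (S n i)) = fourier_kernel (indicator {c..b})"
        using fourier_kernel_upper_level_set[OF ab(1) h, of "real i / real (Suc n)"] unfolding S_def by auto
      then show ?thesis using A ab by (simp add: interval_adm_def)
    qed
    have A0: "A \<ge> 0" using A by (simp add: interval_adm_def)
    have "adm_kernel p (A * (\<Sum>i<Suc n. norm (complex_of_real (1 / real (Suc n)))))
       (\<lambda>t. \<Sum>i<Suc n. complex_of_real (1 / real (Suc n)) * fourier_kernel (indicator (S n i)) t)"
      by (intro adm_kernel_lincomb p 1 A0)
    moreover have "(\<lambda>t. \<Sum>i<Suc n. complex_of_real (1 / real (Suc n)) * fourier_kernel (indicator (S n i)) t)
        = fourier_kernel (s n)"
      unfolding s_def[abs_def] by (intro ext fourier_kernel_sum[symmetric] iS)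
    moreover have "(\<Sum>i<Suc n. norm (complex_of_real (1 / real (Suc n)))) = 1"
      by (simp add: norm_divide del: of_nat_Suc)
    ultimately show ?thesis by simp
  qed
  show "adm_kernel p A (fourier_kernel m)"
  proof (rule adm_kernel_limit[OF p adm])
    show "(\<lambda>n. A) \<longlonglongrightarrow> A" by simp
    show "(\<lambda>n. fourier_kernel (s n) t) \<longlonglongrightarrow> fourier_kernel m t" for t
      unfolding fourier_kernel_def
    proof (rule integral_dominated_convergence[where w="indicator {a<..<b}"])
      show "integrable lborel (indicator {a<..<b} :: real \<Rightarrow> real)" using ab by simp
      show "AE \<xi> in lborel. (\<lambda>n. complex_of_real (s n \<xi>) * exp (\<i> * of_real t * of_real \<xi>))
         \<longlonglongrightarrow> complex_of_real (m \<xi>) * exp (\<i> * of_real t * of_real \<xi>)"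
        by (intro AE_I2 tendsto_intros lim)
      show "AE \<xi> in lborel. norm (complex_of_real (s n \<xi>) * exp (\<i> * of_real t * of_real \<xi>)) \<le> indicator {a<..<b} \<xi>" for n
      proof (intro AE_I2)
        fix \<xi>
        have "norm (exp (\<i> * of_real t * of_real \<xi>)) = 1"
          using norm_exp_i_times[of "t * \<xi>"] by (simp add: mult.assoc)
        then show "norm (complex_of_real (s n \<xi>) * exp (\<i> * of_real t * of_real \<xi>)) \<le> indicator {a<..<b} \<xi>"
          using s1[of n \<xi>] by (simp add: norm_mult)
      qed
    qed measurable
  qed
qed

definition monotone_pm :: "real \<Rightarrow> real \<Rightarrow> (real \<Rightarrow> real) \<Rightarrow> bool" where
  "monotone_pm a b h \<longleftrightarrow> mono_on {a<..<b} h \<or> antimono_on {a<..<b} h"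

lemma monotone_pm_cmult:
  assumes "monotone_pm a b h" "c \<ge> 0"
  shows "monotone_pm a b (\<lambda>\<xi>. c * h \<xi>)"
  using assms by (auto simp: monotone_pm_def monotone_on_def mult_left_mono)

lemma monotone_pm_reflect:
  assumes "monotone_pm a b h"
  shows "monotone_pm (- b) (- a) (\<lambda>\<xi>. h (- \<xi>))"
  using assms by (auto simp: monotone_pm_def monotone_on_def)

lemma integrable_interval_bounded:
  fixes m :: "real \<Rightarrow> real"
  assumes "m \<in> borel_measurable borel" "a < b" "\<And>\<xi>. \<bar>m \<xi>\<bar> \<le> B * indicator {a<..<b} \<xi>"
  shows "integrable lborel m"
  by (rule Bochner_Integration.integrable_bound[where f="\<lambda>\<xi>. B * indicator {a<..<b} \<xi>"])
     (use assms in \<open>auto intro: order_trans[OF _ abs_ge_self]\<close>)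

text \<open>For decreasing \<open>h\<close> the function 1 - h increases, and \<open>h\<close> is
  the indicator of the interval minus that; this doubles the constant.\<close>

lemma adm_kernel_monotone_pm:
  assumes p: "p > 1" and A: "interval_adm p A" and ab: "a < b" "b - a \<le> 2 * pi"
    and h: "monotone_pm a b h" and h01: "\<And>\<xi>. a < \<xi> \<Longrightarrow> \<xi> < b \<Longrightarrow> 0 \<le> h \<xi> \<and> h \<xi> \<le> 1"
  shows "(\<lambda>\<xi>. indicator {a<..<b} \<xi> * h \<xi>) \<in> borel_measurable borel \<and>
         adm_kernel p (2 * A) (fourier_kernel (\<lambda>\<xi>. indicator {a<..<b} \<xi> * h \<xi>))"
proof (cases "mono_on {a<..<b} h")
  case True
  show ?thesis
    using adm_kernel_mono_on[OF p A ab True h01] A p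
    by (auto intro: adm_kernel_mono simp: interval_adm_def)
next
  case False
  then have anti: "antimono_on {a<..<b} h" using h by (simp add: monotone_pm_def)
  have A0: "A \<ge> 0" using A by (simp add: interval_adm_def)
  define g where "g \<xi> = 1 - h \<xi>" for \<xi>
  define m where "m i \<xi> = (if i then indicator {a..b} \<xi> else indicator {a<..<b} \<xi> * g \<xi>)" for i \<xi>
  define c where "c i = (if i then 1 else - 1 :: real)" for i
  have g: "mono_on {a<..<b} g" "\<And>\<xi>. a < \<xi> \<Longrightarrow> \<xi> < b \<Longrightarrow> 0 \<le> g \<xi> \<and> g \<xi> \<le> 1"
    using anti h01 by (auto simp: g_def monotone_on_def)
  note G = adm_kernel_mono_on[OF p A ab g]
  have m1: "m True = indicator {a..b}" "m False = (\<lambda>\<xi>. indicator {a<..<b} \<xi> * g \<xi>)"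
    by (auto simp: m_def)
  have adm: "adm_kernel p A (fourier_kernel (m i))" for i
    using A ab G(2) by (cases i) (auto simp: m1 interval_adm_def)
  have int: "integrable lborel (m i)" for i
  proof (cases i)
    case True then show ?thesis using ab by (simp add: m1)
  next
    case False then show ?thesis
      unfolding m_def[abs_def] using G(1) ab g(2)
      by (auto intro!: integrable_interval_bounded[where a=a and b=b and B=1] simp: indicator_def)
  qed
  have "adm_kernel p (A * (\<Sum>i\<in>UNIV. norm (complex_of_real (c i)))) (\<lambda>t. \<Sum>i\<in>UNIV. complex_of_real (c i) * fourier_kernel (m i) t)"
    by (intro adm_kernel_lincomb p adm A0)
  moreover have "(\<lambda>t. \<Sum>i\<in>UNIV. complex_of_real (c i) * fourier_kernel (m i) t) = fourier_kernel (\<lambda>\<xi>. \<Sum>i\<in>UNIV. c i * m i \<xi>)"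
    by (intro ext fourier_kernel_sum[symmetric] int)
  moreover have "fourier_kernel (\<lambda>\<xi>. \<Sum>i\<in>UNIV. c i * m i \<xi>) = fourier_kernel (\<lambda>\<xi>. indicator {a<..<b} \<xi> * h \<xi>)"
    by (rule fourier_kernel_discrete_difference[of "{a, b}"])
       (auto simp: UNIV_bool c_def m_def g_def indicator_def)
  moreover have "(\<Sum>i\<in>UNIV. norm (complex_of_real (c i))) = 2" by (simp add: UNIV_bool c_def)
  ultimately have "adm_kernel p (2 * A) (fourier_kernel (\<lambda>\<xi>. indicator {a<..<b} \<xi> * h \<xi>))"
    by (simp add: mult.commute)
  moreover have "(\<lambda>\<xi>. indicator {a<..<b} \<xi> - indicator {a<..<b} \<xi> * g \<xi>) \<in> borel_measurable borel"
    using G(1) by measurable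
  then have "(\<lambda>\<xi>. indicator {a<..<b} \<xi> * h \<xi>) \<in> borel_measurable borel"
    by (simp add: g_def algebra_simps)
  ultimately show ?thesis by simp
qed

lemma nat_index_of_abs:
  fixes \<xi> :: real
  assumes "\<forall>k::int. \<xi> \<noteq> 2 * pi * of_int k"
  shows "\<exists>!k::nat. \<bar>\<xi>\<bar> \<in> {2 * pi * real k<..<2 * pi * real k + 2 * pi}"
proof -
  define k where "k = nat \<lfloor>\<bar>\<xi>\<bar> / (2 * pi)\<rfloor>"
  have iff: "\<bar>\<xi>\<bar> \<in> {2 * pi * real j<..<2 * pi * real j + 2 * pi} \<longleftrightarrow>
     real j < \<bar>\<xi>\<bar> / (2 * pi) \<and> \<bar>\<xi>\<bar> / (2 * pi) < real j + 1" for j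
    by (simp add: field_simps)
  have ne: "\<bar>\<xi>\<bar> / (2 * pi) \<noteq> real k"
  proof
    assume "\<bar>\<xi>\<bar> / (2 * pi) = real k"
    then have "\<bar>\<xi>\<bar> = 2 * pi * of_int (int k)" by (simp add: field_simps)
    then have "\<xi> = 2 * pi * of_int (int k) \<or> \<xi> = 2 * pi * of_int (- int k)" by (auto simp: abs_if split: if_splits)
    then show False using assms by blast
  qed
  have "\<bar>\<xi>\<bar> / (2 * pi) \<ge> 0" by simp
  then have "real k \<le> \<bar>\<xi>\<bar> / (2 * pi)" "\<bar>\<xi>\<bar> / (2 * pi) < real k + 1"
    unfolding k_def by linarith+
  then show ?thesis
    unfolding iff using ne by (intro ex1I[of _ k]) auto
qed

text \<open>Each piece is divided by \<open>b k\<close>, so that its monotone parts have values in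
  [0, 1] and a constant independent of \<open>k\<close>; the weights \<open>b k\<close> return as
  the coefficients of a convergent series. Two monotone parts and their mirror images, each with
  constant \<open>2 * A\<close>, add up to \<open>8 * A\<close>.\<close>

lemma adm_kernel_pieces:
  fixes m :: "real \<Rightarrow> real" and b :: "nat \<Rightarrow> real"
  assumes p: "p > 1" and A: "interval_adm p A"
    and b: "\<And>k. b k > 0" "summable b"
    and even: "\<And>\<xi>. m (- \<xi>) = m \<xi>" and zero: "\<And>k::int. m (2 * pi * of_int k) = 0"
    and pieces: "\<And>k. \<exists>v w. monotone_pm (2 * pi * real k) (2 * pi * real k + 2 * pi) v
        \<and> monotone_pm (2 * pi * real k) (2 * pi * real k + 2 * pi) w
        \<and> (\<forall>\<xi>. 2 * pi * real k < \<xi> \<longrightarrow> \<xi> < 2 * pi * real k + 2 * pi \<longrightarrow>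
              0 \<le> v \<xi> \<and> v \<xi> \<le> b k \<and> 0 \<le> w \<xi> \<and> w \<xi> \<le> b k \<and> m \<xi> = v \<xi> - w \<xi>)"
  shows "adm_kernel p (8 * A * suminf b) (fourier_kernel m)"
proof -
  have A0: "A \<ge> 0" using A by (simp add: interval_adm_def)
  define l r where "l k = 2 * pi * real k" and "r k = 2 * pi * real k + 2 * pi" for k
  have lr: "l k < r k" "r k - l k \<le> 2 * pi" for k by (auto simp: l_def r_def)
  define q where "q k \<xi> = indicator {l k<..<r k} \<bar>\<xi>\<bar> * m \<xi> / b k" for k \<xi>
  have q: "q k \<in> borel_measurable borel \<and> integrable lborel (q k) \<and> (\<forall>\<xi>. \<bar>q k \<xi>\<bar> \<le> indicator {- r k<..<- l k} \<xi> + indicator {l k<..<r k} \<xi>)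
      \<and> adm_kernel p (8 * A) (fourier_kernel (q k))" for k
  proof -
    obtain v w where v: "monotone_pm (l k) (r k) v" and w: "monotone_pm (l k) (r k) w"
      and vw: "\<And>\<xi>. l k < \<xi> \<Longrightarrow> \<xi> < r k \<Longrightarrow>
              0 \<le> v \<xi> \<and> v \<xi> \<le> b k \<and> 0 \<le> w \<xi> \<and> w \<xi> \<le> b k \<and> m \<xi> = v \<xi> - w \<xi>"
      using pieces[of k] unfolding l_def r_def by metis
    define V W where "V \<xi> = 1 / b k * v \<xi>" and "W \<xi> = 1 / b k * w \<xi>" for \<xi>
    have VW: "0 \<le> V \<xi> \<and> V \<xi> \<le> 1 \<and> 0 \<le> W \<xi> \<and> W \<xi> \<le> 1 \<and> m \<xi> / b k = V \<xi> - W \<xi>"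
      if "l k < \<xi>" "\<xi> < r k" for \<xi>
      using vw[OF that] b(1)[of k] by (auto simp: V_def W_def field_simps)
    have V: "monotone_pm (l k) (r k) V" "monotone_pm (l k) (r k) W"
      using monotone_pm_cmult[OF v, of "1 / b k"] monotone_pm_cmult[OF w, of "1 / b k"] b(1)[of k]
      unfolding V_def[abs_def] W_def[abs_def] by (simp_all add: less_imp_le)
    define n where "n i = (if i = (0::nat) then \<lambda>\<xi>. indicator {l k<..<r k} \<xi> * V \<xi>
       else if i = 1 then \<lambda>\<xi>. indicator {l k<..<r k} \<xi> * W \<xi>
       else if i = 2 then \<lambda>\<xi>. indicator {- r k<..<- l k} \<xi> * V (- \<xi>)
       else (\<lambda>\<xi>. indicator {- r k<..<- l k} \<xi> * W (- \<xi>)))" for i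
    define c where "c i = (if i = (0::nat) \<or> i = 2 then 1 else - 1 :: real)" for i
    have n: "n i \<in> borel_measurable borel \<and> adm_kernel p (2 * A) (fourier_kernel (n i))" for i
      unfolding n_def using VW V lr[of k]
      by (auto intro!: adm_kernel_monotone_pm[OF p A, THEN conjunct1] adm_kernel_monotone_pm[OF p A, THEN conjunct2]
          monotone_pm_reflect)
    have ni: "integrable lborel (n i)" for i
    proof (cases "i = 0 \<or> i = 1")
      case True
      have "\<bar>n i \<xi>\<bar> \<le> 1 * indicator {l k<..<r k} \<xi>" for \<xi>
        using True VW[of \<xi>] by (auto simp: n_def indicator_def)
      then show ?thesis using n[of i] lr(1)[of k] by (intro integrable_interval_bounded[where a="l k" and b="r k" and B=1]) auto
    next
      case False
      have "\<bar>n i \<xi>\<bar> \<le> 1 * indicator {- r k<..<- l k} \<xi>" for \<xi>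
        using False VW[of "- \<xi>"] by (auto simp: n_def indicator_def)
      then show ?thesis using n[of i] lr(1)[of k]
        by (intro integrable_interval_bounded[where a="- r k" and b="- l k" and B=1]) auto
    qed
    have l0: "0 \<le> l k" by (simp add: l_def)
    have qn: "q k = (\<lambda>\<xi>. \<Sum>i<4. c i * n i \<xi>)"
    proof
      fix \<xi>
      have e: "(\<Sum>i<4. c i * n i \<xi>) = indicator {l k<..<r k} \<xi> * (V \<xi> - W \<xi>) + indicator {- r k<..<- l k} \<xi> * (V (- \<xi>) - W (- \<xi>))"
        by (simp add: c_def n_def eval_nat_numeral algebra_simps)
      consider "l k < \<xi>" "\<xi> < r k" | "- r k < \<xi>" "\<xi> < - l k" | "\<not> (l k < \<bar>\<xi>\<bar> \<and> \<bar>\<xi>\<bar> < r k)"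
        by linarith
      then show "q k \<xi> = (\<Sum>i<4. c i * n i \<xi>)"
      proof cases
        case 1
        then show ?thesis using VW[of \<xi>] l0 by (simp add: e q_def)
      next
        case 2
        then show ?thesis using VW[of "- \<xi>"] l0 even[of \<xi>] by (simp add: e q_def)
      next
        case 3
        then show ?thesis using l0 by (auto simp: e q_def indicator_def)
      qed
    qed
    have meas: "q k \<in> borel_measurable borel" unfolding qn
      by (intro borel_measurable_sum borel_measurable_times borel_measurable_const) (simp add: n)
    have "integrable lborel (\<lambda>\<xi>. \<Sum>i<4. c i * n i \<xi>)"
      by (intro Bochner_Integration.integrable_sum integrable_mult_right ni)
    moreover have "\<bar>q k \<xi>\<bar> \<le> indicator {- r k<..<- l k} \<xi> + indicator {l k<..<r k} \<xi>" for \<xi>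
    proof -
      consider "l k < \<xi>" "\<xi> < r k" | "- r k < \<xi>" "\<xi> < - l k" | "\<not> (l k < \<bar>\<xi>\<bar> \<and> \<bar>\<xi>\<bar> < r k)"
        by linarith
      then show ?thesis
      proof cases
        case 1
        then have "\<bar>V \<xi> - W \<xi>\<bar> \<le> 1" "m \<xi> / b k = V \<xi> - W \<xi>" using VW[of \<xi>] by (auto simp: abs_le_iff)
        then show ?thesis using 1 l0 by (simp add: q_def indicator_def)
      next
        case 2
        then have "\<bar>V (- \<xi>) - W (- \<xi>)\<bar> \<le> 1" "m \<xi> / b k = V (- \<xi>) - W (- \<xi>)"
          using VW[of "- \<xi>"] even[of \<xi>] by (auto simp: abs_le_iff)
        then show ?thesis using 2 l0 by (simp add: q_def indicator_def)
      next
        case 3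
        then show ?thesis using l0 by (auto simp: q_def indicator_def)
      qed
    qed
    moreover have "adm_kernel p (2 * A * (\<Sum>i<4. norm (complex_of_real (c i)))) (\<lambda>t. \<Sum>i<4. complex_of_real (c i) * fourier_kernel (n i) t)"
      using n A0 by (intro adm_kernel_lincomb p) auto
    moreover have "(\<lambda>t. \<Sum>i<4. complex_of_real (c i) * fourier_kernel (n i) t) = fourier_kernel (q k)"
      unfolding qn by (intro ext fourier_kernel_sum[symmetric] ni)
    moreover have "(\<Sum>i<4. norm (complex_of_real (c i))) = 4" by (simp add: c_def eval_nat_numeral)
    ultimately show ?thesis using meas unfolding qn by (simp add: mult_ac)
  qed
  have sums: "(\<lambda>k. b k * q k \<xi>) sums m \<xi> \<and> summable (\<lambda>k. norm (b k * q k \<xi>))" for \<xi>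
  proof (cases "\<exists>k::int. \<xi> = 2 * pi * of_int k")
    case True
    then have "m \<xi> = 0" using zero by blast
    then show ?thesis by (simp add: q_def)
  next
    case False
    then obtain k0 where k0: "\<And>k. \<bar>\<xi>\<bar> \<in> {l k<..<r k} \<longleftrightarrow> k = k0"
      using nat_index_of_abs[of \<xi>] unfolding l_def r_def by metis
    have e: "(\<lambda>k. b k * q k \<xi>) = (\<lambda>k. if k = k0 then m \<xi> else 0)"
      using k0 b(1) by (auto simp: q_def indicator_def less_imp_neq[THEN not_sym])
    have "(\<lambda>k. norm (b k * q k \<xi>)) = (\<lambda>k. if k = k0 then \<bar>m \<xi>\<bar> else 0)"
      by (rule ext) (simp only: fun_cong[OF e], simp)
    then show ?thesis
      unfolding e using sums_single[of k0 "\<lambda>_. m \<xi>"] summable_single[of k0 "\<lambda>_. \<bar>m \<xi>\<bar>"] by simp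
  qed
  have norm1: "(LINT \<xi>|lborel. norm (b k * q k \<xi>)) \<le> b k * (4 * pi)" for k
  proof -
    have "(LINT \<xi>|lborel. norm (b k * q k \<xi>)) \<le> (LINT \<xi>|lborel. b k * (indicator {- r k<..<- l k} \<xi> + indicator {l k<..<r k} \<xi>))"
      using q[of k] b(1)[of k] lr[of k]
      by (intro integral_mono) (auto simp: abs_mult intro!: mult_left_mono)
    also have "\<dots> = b k * (4 * pi)"
      using lr[of k] by (simp add: l_def r_def)
    finally show ?thesis .
  qed
  \<comment> \<open>Summability of the L1 norms is what permits termwise integration, and with it
    pointwise convergence of the kernels.\<close>
  have sn: "summable (\<lambda>k. LINT \<xi>|lborel. norm (b k * q k \<xi>))"
    by (rule summable_comparison_test'[where g="\<lambda>k. b k * (4 * pi)"])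
       (use norm1 b in \<open>auto intro!: summable_mult2\<close>)
  show "adm_kernel p (8 * A * suminf b) (fourier_kernel m)"
  proof (rule adm_kernel_limit[OF p])
    show "adm_kernel p (8 * A * (\<Sum>k<n. norm (complex_of_real (b k)))) (\<lambda>t. \<Sum>k<n. complex_of_real (b k) * fourier_kernel (q k) t)" for n
      using q A0 by (intro adm_kernel_lincomb p) auto
    show "(\<lambda>n. 8 * A * (\<Sum>k<n. norm (complex_of_real (b k)))) \<longlonglongrightarrow> 8 * A * suminf b"
      using b by (intro tendsto_mult_left) (simp add: less_imp_le summable_LIMSEQ)
    fix t
    define e where "e \<xi> = exp (\<i> * complex_of_real t * of_real \<xi>)" for \<xi>
    have ne: "norm (e \<xi>) = 1" for \<xi>
      using norm_exp_i_times[of "t * \<xi>"] by (simp add: e_def mult.assoc)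
    have "(\<lambda>k. LINT \<xi>|lborel. complex_of_real (b k * q k \<xi>) * e \<xi>) sums (LINT \<xi>|lborel. (\<Sum>k. complex_of_real (b k * q k \<xi>) * e \<xi>))"
    proof (rule sums_integral)
      show "integrable lborel (\<lambda>\<xi>. complex_of_real (b k * q k \<xi>) * e \<xi>)" for k
        unfolding e_def using q[of k] by (intro fourier_kernel_integrable) auto
      show "AE \<xi> in lborel. summable (\<lambda>k. norm (complex_of_real (b k * q k \<xi>) * e \<xi>))"
        using sums by (auto simp: norm_mult ne abs_mult)
      show "summable (\<lambda>k. LINT \<xi>|lborel. norm (complex_of_real (b k * q k \<xi>) * e \<xi>))"
        using sn by (simp add: norm_mult ne abs_mult)
    qed
    moreover have "(\<Sum>k. complex_of_real (b k * q k \<xi>) * e \<xi>) = complex_of_real (m \<xi>) * e \<xi>" for \<xi>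
      using sums[of \<xi>] sums_of_real[of "\<lambda>k. b k * q k \<xi>" "m \<xi>", where 'a=complex]
      by (intro sums_unique[symmetric] sums_mult2) auto
    moreover have "(LINT \<xi>|lborel. complex_of_real (b k * q k \<xi>) * e \<xi>) = complex_of_real (b k) * fourier_kernel (q k) t" for k
      unfolding fourier_kernel_def e_def by (simp add: mult.assoc)
    ultimately have "(\<lambda>k. complex_of_real (b k) * fourier_kernel (q k) t) sums fourier_kernel m t"
      by (simp add: fourier_kernel_def e_def)
    then show "(\<lambda>n. \<Sum>k<n. complex_of_real (b k) * fourier_kernel (q k) t) \<longlonglongrightarrow> fourier_kernel m t"
      by (simp add: sums_def)
  qed
qed

section \<open>Periodized radial profiles\<close>

lemma opposite_monotone_quotient_le:
  fixes P Q :: real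
  assumes "0 \<le> P" "P \<le> P'" "0 \<le> Q'" "Q' \<le> Q"
  shows "P / ((1 + Q) * (1 + P + Q)) \<le> P' / ((1 + Q') * (1 + P' + Q'))"
proof -
  have "P * Q' \<le> P' * Q" using assms by (intro mult_mono) auto
  then have "P / (1 + P + Q) \<le> P' / (1 + P' + Q')"
    using assms by (simp add: divide_simps) (simp add: algebra_simps)
  then have "1 / (1 + Q) * (P / (1 + P + Q)) \<le> 1 / (1 + Q') * (P' / (1 + P' + Q'))"
    using assms by (intro mult_mono divide_left_mono) (auto intro!: mult_pos_pos)
  then show ?thesis by simp
qed

text \<open>The split is 1 / (1 + P + Q) = 1 / (1 + Q) - P / ((1 + Q) (1 + P + Q)), in which both
  terms move in the direction of \<open>P\<close>. Only the first needs a bound: the second is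
  smaller because the difference is nonnegative.\<close>

lemma quotient_monotone_split:
  fixes P Q m :: "real \<Rightarrow> real"
  assumes P0: "\<And>\<xi>. a < \<xi> \<Longrightarrow> \<xi> < b \<Longrightarrow> 0 \<le> P \<xi>" and Q0: "\<And>\<xi>. a < \<xi> \<Longrightarrow> \<xi> < b \<Longrightarrow> 0 \<le> Q \<xi>"
    and mono: "mono_on {a<..<b} P \<and> antimono_on {a<..<b} Q \<or> antimono_on {a<..<b} P \<and> mono_on {a<..<b} Q"
    and m: "\<And>\<xi>. a < \<xi> \<Longrightarrow> \<xi> < b \<Longrightarrow> m \<xi> = 1 / (1 + P \<xi> + Q \<xi>)"
    and B: "\<And>\<xi>. a < \<xi> \<Longrightarrow> \<xi> < b \<Longrightarrow> 1 / (1 + Q \<xi>) \<le> B"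
  shows "\<exists>v w. monotone_pm a b v \<and> monotone_pm a b w \<and>
     (\<forall>\<xi>. a < \<xi> \<longrightarrow> \<xi> < b \<longrightarrow> 0 \<le> v \<xi> \<and> v \<xi> \<le> B \<and> 0 \<le> w \<xi> \<and> w \<xi> \<le> B \<and> m \<xi> = v \<xi> - w \<xi>)"
proof -
  define v w where "v \<xi> = 1 / (1 + Q \<xi>)" and "w \<xi> = P \<xi> / ((1 + Q \<xi>) * (1 + P \<xi> + Q \<xi>))" for \<xi>
  have v1: "1 / (1 + q) \<le> 1 / (1 + q')" if "0 \<le> q'" "q' \<le> q" for q q' :: real
    using that by (intro divide_left_mono) (auto intro!: mult_pos_pos)
  have "monotone_pm a b v" "monotone_pm a b w"
    using mono
  proof (atomize(full), elim disjE)
    assume *: "mono_on {a<..<b} P \<and> antimono_on {a<..<b} Q"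
    then show "monotone_pm a b v \<and> monotone_pm a b w"
      unfolding monotone_pm_def monotone_on_def v_def w_def
      by (intro conjI disjI1 ballI impI v1 opposite_monotone_quotient_le) (auto intro: P0 Q0)
  next
    assume *: "antimono_on {a<..<b} P \<and> mono_on {a<..<b} Q"
    then show "monotone_pm a b v \<and> monotone_pm a b w"
      unfolding monotone_pm_def monotone_on_def v_def w_def
      by (intro conjI disjI2 ballI impI v1 opposite_monotone_quotient_le) (auto intro: P0 Q0)
  qed
  moreover have "0 \<le> v \<xi> \<and> v \<xi> \<le> B \<and> 0 \<le> w \<xi> \<and> w \<xi> \<le> B \<and> m \<xi> = v \<xi> - w \<xi>" if "a < \<xi>" "\<xi> < b" for \<xi>
  proof -
    have P: "P \<xi> \<ge> 0" and Q: "Q \<xi> \<ge> 0" using P0 Q0 that by auto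
    have eq: "m \<xi> = v \<xi> - w \<xi>"
      unfolding m[OF that] v_def w_def using P Q by (simp add: divide_simps)
    have "0 \<le> m \<xi>" unfolding m[OF that] using P Q by simp
    then have "w \<xi> \<le> v \<xi>" using eq by simp
    moreover have "0 \<le> w \<xi>" "0 \<le> v \<xi>" "v \<xi> \<le> B" using P Q B[OF that] by (auto simp: w_def v_def)
    ultimately show ?thesis using eq by linarith
  qed
  ultimately show ?thesis by blast
qed

definition periodized :: "(real \<Rightarrow> real) \<Rightarrow> real \<Rightarrow> real" where
  "periodized g \<xi> = (\<Sum>\<^sub>\<infinity>j\<in>(UNIV :: int set). g \<bar>\<xi> + 2 * pi * of_int j\<bar>)"

text \<open>The value 0 on the lattice replaces the continuous extension: it lets the open pieces
  add up to the symbol everywhere and does not change its Fourier kernel.\<close>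

definition cardinal_symbol :: "(real \<Rightarrow> real) \<Rightarrow> real \<Rightarrow> real" where
  "cardinal_symbol g \<xi> = (if \<exists>k::int. \<xi> = 2 * pi * of_int k then 0 else g \<bar>\<xi>\<bar> / periodized g \<xi>)"

lemma periodized_minus: "periodized g (- \<xi>) = periodized g \<xi>"
proof -
  have "infsum (\<lambda>j. g \<bar>\<xi> + 2 * pi * of_int (- j)\<bar>) (UNIV :: int set) = periodized g \<xi>"
    unfolding periodized_def by (rule infsum_reindex_bij_betw) (rule bij_uminus)
  moreover have "\<bar>\<xi> + 2 * pi * of_int (- j)\<bar> = \<bar>- \<xi> + 2 * pi * of_int j\<bar>" for j :: int by simp
  ultimately show ?thesis by (simp add: periodized_def)
qed

lemma cardinal_symbol_minus: "cardinal_symbol g (- \<xi>) = cardinal_symbol g \<xi>"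
proof -
  have "(\<exists>k::int. - \<xi> = 2 * pi * of_int k) \<longleftrightarrow> (\<exists>k::int. \<xi> = 2 * pi * of_int k)"
    by (metis minus_equation_iff mult_minus_right of_int_minus)
  then show ?thesis by (simp add: cardinal_symbol_def periodized_minus)
qed

text \<open>Isolates the facts about the Bessel profile that matter. The direction of
  \<open>g_ratio\<close> must be the same for all shifts \<open>d\<close>. The sequence
  \<open>b\<close> does not refer to \<open>g\<close>, so one choice can serve all \<open>c\<close>,
  and \<open>b_0\<close> is there because the central piece has only the trivial bound 1.\<close>

locale radial_profile =
  fixes g :: "real \<Rightarrow> real" and b :: "nat \<Rightarrow> real"
  assumes g_pos: "\<And>x. 0 < x \<Longrightarrow> 0 < g x"
    and g_anti: "\<And>x y. 0 < x \<Longrightarrow> x \<le> y \<Longrightarrow> g y \<le> g x"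
    and g_summable: "\<And>x. 0 < x \<Longrightarrow> summable (\<lambda>i. g (x + 2 * pi * real i))"
    and g_ratio: "(\<forall>d x y. 0 < d \<longrightarrow> 0 < x \<longrightarrow> x \<le> y \<longrightarrow> g (x + d) / g x \<le> g (y + d) / g y) \<or>
                  (\<forall>d x y. 0 < d \<longrightarrow> 0 < x \<longrightarrow> x \<le> y \<longrightarrow> g (y + d) / g y \<le> g (x + d) / g x)"
    and b_pos: "\<And>k. 0 < b k" and b_summable: "summable b" and b_0: "1 \<le> b 0"
    and g_decay: "\<And>k. 0 < k \<Longrightarrow> g (2 * pi * real k) \<le> b k * g (2 * pi)"
begin

definition tail :: "real \<Rightarrow> real" where "tail x = (\<Sum>i. g (x + 2 * pi * real i))"

lemma g_shift_pos: "0 < x \<Longrightarrow> 0 < g (x + 2 * pi * real i)"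
  by (intro g_pos add_pos_nonneg) auto

lemma tail_anti: "0 < x \<Longrightarrow> x \<le> y \<Longrightarrow> tail y \<le> tail x"
  unfolding tail_def by (intro suminf_le g_summable g_anti add_pos_nonneg) auto

lemma tail_nonneg: "0 < x \<Longrightarrow> 0 \<le> tail x"
  unfolding tail_def by (intro suminf_nonneg g_summable less_imp_le[OF g_shift_pos])

lemma tail_has_sum: "0 < x \<Longrightarrow> ((\<lambda>i. g (x + 2 * pi * real i)) has_sum tail x) UNIV"
  unfolding tail_def
  by (intro sums_nonneg_imp_has_sum summable_sums g_summable less_imp_le[OF g_shift_pos])

text \<open>For \<xi> in the \<open>k\<close>-th cell the translates fall into two progressions of
  positive numbers: those right of the origin start at \<xi> - 2 pi k, and those left of it, after
  reflection, start at 2 pi k + 2 pi - \<xi>.\<close>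

lemma periodized_eq:
  assumes "2 * pi * real k < \<xi>" "\<xi> < 2 * pi * real k + 2 * pi"
  shows "periodized g \<xi> = tail (\<xi> - 2 * pi * real k) + tail (2 * pi * real k + 2 * pi - \<xi>)"
proof -
  let ?f = "\<lambda>j::int. g \<bar>\<xi> + 2 * pi * of_int j\<bar>"
  have "((\<lambda>i. ?f (int i - int k)) has_sum tail (\<xi> - 2 * pi * real k)) UNIV"
  proof -
    have "\<bar>\<xi> + 2 * pi * of_int (int i - int k)\<bar> = (\<xi> - 2 * pi * real k) + 2 * pi * real i" for i
    proof -
      have "(\<xi> - 2 * pi * real k) + 2 * pi * real i \<ge> 0" using assms by (intro add_nonneg_nonneg) auto
      then show ?thesis by (simp add: algebra_simps)
    qed
    then show ?thesis using tail_has_sum[of "\<xi> - 2 * pi * real k"] assms by simp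
  qed
  then have 1: "(?f has_sum tail (\<xi> - 2 * pi * real k)) (range (\<lambda>i. int i - int k))"
    by (subst has_sum_reindex) (auto simp: inj_on_def o_def)
  have "((\<lambda>i. ?f (- int k - 1 - int i)) has_sum tail (2 * pi * real k + 2 * pi - \<xi>)) UNIV"
  proof -
    have "\<bar>\<xi> + 2 * pi * of_int (- int k - 1 - int i)\<bar> = (2 * pi * real k + 2 * pi - \<xi>) + 2 * pi * real i" for i
    proof -
      have "(2 * pi * real k + 2 * pi - \<xi>) + 2 * pi * real i \<ge> 0" using assms by (intro add_nonneg_nonneg) auto
      then show ?thesis by (simp add: algebra_simps abs_minus_commute)
    qed
    then show ?thesis using tail_has_sum[of "2 * pi * real k + 2 * pi - \<xi>"] assms by simp
  qed
  then have 2: "(?f has_sum tail (2 * pi * real k + 2 * pi - \<xi>)) (range (\<lambda>i. - int k - 1 - int i))"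
    by (subst has_sum_reindex) (auto simp: inj_on_def o_def)
  have "range (\<lambda>i. int i - int k) \<inter> range (\<lambda>i. - int k - 1 - int i) = {}" by auto
  then have "(?f has_sum (tail (\<xi> - 2 * pi * real k) + tail (2 * pi * real k + 2 * pi - \<xi>)))
      (range (\<lambda>i. int i - int k) \<union> range (\<lambda>i. - int k - 1 - int i))"
    by (rule has_sum_Un_disjoint[OF 1 2])
  moreover have "range (\<lambda>i. int i - int k) \<union> range (\<lambda>i. - int k - 1 - int i) = UNIV"
  proof -
    have "j \<in> range (\<lambda>i. int i - int k) \<union> range (\<lambda>i. - int k - 1 - int i)" for j
    proof (cases "j \<ge> - int k")
      case True
      then have "j = int (nat (j + int k)) - int k" by simp
      then show ?thesis by blast
    next
      case False
      then have "j = - int k - 1 - int (nat (- int k - 1 - j))" by simp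
      then show ?thesis by blast
    qed
    then show ?thesis by blast
  qed
  ultimately show ?thesis unfolding periodized_def by (intro infsumI) simp
qed

text \<open>With x = \<xi> - 2 pi k the middle term is g(\<xi>) itself, so the translates nearer to
  the origin are separated from those farther out.\<close>

lemma tail_split:
  assumes "0 < x"
  shows "tail x = (\<Sum>i<k. g (x + 2 * pi * real i)) + g (x + 2 * pi * real k)
     + (\<Sum>i. g (x + 2 * pi * real k + 2 * pi * real (Suc i)))"
proof -
  have "tail x = (\<Sum>i. g (x + 2 * pi * real (i + Suc k))) + (\<Sum>i<Suc k. g (x + 2 * pi * real i))"
    unfolding tail_def by (rule suminf_split_initial_segment) (rule g_summable[OF assms])
  moreover have "x + 2 * pi * real (i + Suc k) = x + 2 * pi * real k + 2 * pi * real (Suc i)" for i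
    by (simp add: algebra_simps)
  ultimately show ?thesis by (simp add: add_ac)
qed

lemma ratio_inverse:
  assumes "0 < x" "0 < y" "0 < d" "g (x + d) / g x \<le> g (y + d) / g y"
  shows "g y / g (y + d) \<le> g x / g (x + d)"
  using assms g_pos[of x] g_pos[of y] g_pos[of "x + d"] g_pos[of "y + d"] by (simp add: field_simps)

lemma cardinal_symbol_pieces:
  "\<exists>v w. monotone_pm (2 * pi * real k) (2 * pi * real k + 2 * pi) v
        \<and> monotone_pm (2 * pi * real k) (2 * pi * real k + 2 * pi) w
        \<and> (\<forall>\<xi>. 2 * pi * real k < \<xi> \<longrightarrow> \<xi> < 2 * pi * real k + 2 * pi \<longrightarrow>
              0 \<le> v \<xi> \<and> v \<xi> \<le> b k \<and> 0 \<le> w \<xi> \<and> w \<xi> \<le> b k \<and> cardinal_symbol g \<xi> = v \<xi> - w \<xi>)"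
proof -
  define a where "a = 2 * pi * real k"
  have a0: "a \<ge> 0" by (simp add: a_def)
  \<comment> \<open>\<open>L\<close> collects the translates on the same side of the origin that lie
    closer to it, \<open>R\<close> those farther out, and \<open>T\<close> all those on the other
    side.\<close>
  define L where "L \<xi> = (\<Sum>i<k. g (\<xi> - a + 2 * pi * real i) / g \<xi>)" for \<xi>
  define R where "R \<xi> = (\<Sum>i. g (\<xi> + 2 * pi * real (Suc i)) / g \<xi>)" for \<xi>
  define T where "T \<xi> = tail (a + 2 * pi - \<xi>) / g \<xi>" for \<xi>
  have Rsum: "summable (\<lambda>i. g (\<xi> + 2 * pi * real (Suc i)) / g \<xi>)" if "0 < \<xi>" for \<xi>
    using g_summable[OF that] by (intro summable_divide) (subst summable_Suc_iff)
  have L0: "0 \<le> L \<xi>" if "a < \<xi>" for \<xi>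
    unfolding L_def using that a0 by (intro sum_nonneg divide_nonneg_nonneg less_imp_le[OF g_shift_pos] less_imp_le[OF g_pos]) auto
  have R0: "0 \<le> R \<xi>" if "a < \<xi>" for \<xi>
    unfolding R_def using that a0 by (intro suminf_nonneg Rsum divide_nonneg_nonneg less_imp_le[OF g_shift_pos] less_imp_le[OF g_pos]) auto
  have T0: "0 \<le> T \<xi>" if "a < \<xi>" "\<xi> < a + 2 * pi" for \<xi>
    unfolding T_def using that a0 by (intro divide_nonneg_nonneg tail_nonneg less_imp_le[OF g_pos]) auto
  have Tmono: "T \<xi> \<le> T \<eta>" if "a < \<xi>" "\<xi> \<le> \<eta>" "\<eta> < a + 2 * pi" for \<xi> \<eta>
    unfolding T_def using that a0 by (intro frac_le tail_anti tail_nonneg g_pos g_anti) auto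
  have not_lattice: "\<not> (\<exists>j::int. \<xi> = 2 * pi * of_int j)" if "a < \<xi>" "\<xi> < a + 2 * pi" for \<xi>
  proof
    assume "\<exists>j::int. \<xi> = 2 * pi * of_int j"
    then obtain j :: int where j: "\<xi> = 2 * pi * of_int j" by blast
    have "2 * pi * real k < 2 * pi * of_int j" "2 * pi * of_int j < 2 * pi * (real k + 1)"
      using that by (auto simp: j a_def algebra_simps)
    then have "of_int (int k) < (of_int j :: real)" "(of_int j :: real) < of_int (int k + 1)" by simp_all
    then show False unfolding of_int_less_iff by linarith
  qed
  have m: "cardinal_symbol g \<xi> = 1 / (1 + L \<xi> + R \<xi> + T \<xi>)" if x: "a < \<xi>" "\<xi> < a + 2 * pi" for \<xi>
  proof -
    have gx: "g \<xi> > 0" and x0: "0 < \<xi>" using x a0 g_pos[of \<xi>] by auto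
    have "periodized g \<xi> = tail (\<xi> - a) + tail (a + 2 * pi - \<xi>)"
      using periodized_eq[of k \<xi>] x by (simp add: a_def)
    also have "tail (\<xi> - a) = (\<Sum>i<k. g (\<xi> - a + 2 * pi * real i)) + g \<xi> + (\<Sum>i. g (\<xi> + 2 * pi * real (Suc i)))"
      using tail_split[of "\<xi> - a" k] x by (simp add: a_def)
    finally have "periodized g \<xi> / g \<xi> = 1 + L \<xi> + R \<xi> + T \<xi>"
      using gx suminf_divide[of "\<lambda>i. g (\<xi> + 2 * pi * real (Suc i))" "g \<xi>"] g_summable[OF x0]
      by (simp add: L_def R_def T_def add_divide_distrib sum_divide_distrib summable_Suc_iff[of "\<lambda>i. g (\<xi> + 2 * pi * real i)"] del: of_nat_Suc)
    moreover have "cardinal_symbol g \<xi> = 1 / (periodized g \<xi> / g \<xi>)"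
      using not_lattice[OF x] x0 gx by (simp add: cardinal_symbol_def)
    ultimately show ?thesis by simp
  qed
  \<comment> \<open>For k > 0 the innermost term of \<open>L\<close> already exceeds g(2 pi) / g(a),
    because \<xi> lies in the cell starting at \<open>a\<close> and \<open>g\<close> decreases;
    \<open>g_decay\<close> finishes. For \<open>k = 0\<close> the sum \<open>L\<close> is
    empty.\<close>
  have bound: "1 / (1 + Q) \<le> b k" if x: "a < \<xi>" "\<xi> < a + 2 * pi" and Q: "L \<xi> \<le> Q" for \<xi> Q
  proof (cases "k = 0")
    case True
    have "1 / (1 + Q) \<le> 1" using L0[OF x(1)] Q by simp
    then show ?thesis using b_0 True by simp
  next
    case False
    have gx: "g \<xi> > 0" "g \<xi> \<le> g a" "a > 0" "g a > 0"
    proof -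
      show "a > 0" using False by (simp add: a_def)
      then show "g \<xi> > 0" "g \<xi> \<le> g a" "g a > 0" using x by (auto intro: g_pos g_anti)
    qed
    have g2: "g (2 * pi) > 0" by (intro g_pos) simp
    have "g (2 * pi) / g a \<le> g (\<xi> - a + 2 * pi * real 0) / g \<xi>"
      using x gx g_anti[of "\<xi> - a" "2 * pi"] g2 by (intro frac_le) auto
    also have "\<dots> \<le> L \<xi>"
      unfolding L_def using x a0 False
      by (intro member_le_sum divide_nonneg_nonneg less_imp_le[OF g_shift_pos] less_imp_le[OF g_pos]) auto
    finally have "g (2 * pi) / g a \<le> 1 + Q" using Q by linarith
    moreover have "g (2 * pi) / g a > 0" using g2 gx by simp
    ultimately have "1 / (1 + Q) \<le> 1 / (g (2 * pi) / g a)"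
      by (intro divide_left_mono mult_pos_pos) linarith+
    also have "\<dots> \<le> b k" using g_decay[of k] False g2 gx by (simp add: a_def[symmetric] pos_divide_le_eq)
    finally show ?thesis .
  qed
  \<comment> \<open>\<open>T\<close> increases in any case, as its numerator moves towards the
    origin and its denominator away. The quotients in \<open>L\<close> are inverse to those of
    \<open>g_ratio\<close>, so \<open>L\<close> runs against \<open>R\<close>, and \<open>T\<close>
    joins whichever of the two increases. The part containing \<open>L\<close> plays the role of
    \<open>Q\<close>, so that \<open>bound\<close> applies.\<close>
  show ?thesis
    using g_ratio
  proof
    assume ratio: "\<forall>d x y. 0 < d \<longrightarrow> 0 < x \<longrightarrow> x \<le> y \<longrightarrow> g (x + d) / g x \<le> g (y + d) / g y"
    have Rm: "R \<xi> \<le> R \<eta>" if "a < \<xi>" "\<xi> \<le> \<eta>" for \<xi> \<eta>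
      unfolding R_def using that a0 by (intro suminf_le Rsum ratio[rule_format]) auto
    have Lm: "L \<eta> \<le> L \<xi>" if "a < \<xi>" "\<xi> \<le> \<eta>" for \<xi> \<eta>
      unfolding L_def
    proof (intro sum_mono)
      fix i assume "i \<in> {..<k}"
      then have d: "0 < a - 2 * pi * real i" by (simp add: a_def)
      have pos: "0 < \<xi> - a + 2 * pi * real i" "0 < \<eta> - a + 2 * pi * real i"
        using that by (auto intro!: add_pos_nonneg)
      show "g (\<eta> - a + 2 * pi * real i) / g \<eta> \<le> g (\<xi> - a + 2 * pi * real i) / g \<xi>"
        using ratio_inverse[OF pos(1,2) d ratio[rule_format, OF d pos(1)]] that by simp
    qed
    show ?thesis
      unfolding a_def[symmetric]
    proof (rule quotient_monotone_split[where P="\<lambda>\<xi>. R \<xi> + T \<xi>" and Q=L])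
      show "mono_on {a<..<a + 2 * pi} (\<lambda>\<xi>. R \<xi> + T \<xi>) \<and> antimono_on {a<..<a + 2 * pi} L
         \<or> antimono_on {a<..<a + 2 * pi} (\<lambda>\<xi>. R \<xi> + T \<xi>) \<and> mono_on {a<..<a + 2 * pi} L"
        by (intro disjI1 conjI monotone_onI) (auto intro!: add_mono Rm Tmono Lm)
      show "cardinal_symbol g \<xi> = 1 / (1 + (R \<xi> + T \<xi>) + L \<xi>)" if "a < \<xi>" "\<xi> < a + 2 * pi" for \<xi>
        using m[OF that] by (simp add: add_ac)
    qed (use bound L0 R0 T0 in auto)
  next
    assume ratio: "\<forall>d x y. 0 < d \<longrightarrow> 0 < x \<longrightarrow> x \<le> y \<longrightarrow> g (y + d) / g y \<le> g (x + d) / g x"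
    have Rm: "R \<eta> \<le> R \<xi>" if "a < \<xi>" "\<xi> \<le> \<eta>" for \<xi> \<eta>
      unfolding R_def using that a0 by (intro suminf_le Rsum ratio[rule_format]) auto
    have Lm: "L \<xi> \<le> L \<eta>" if "a < \<xi>" "\<xi> \<le> \<eta>" for \<xi> \<eta>
      unfolding L_def
    proof (intro sum_mono)
      fix i assume "i \<in> {..<k}"
      then have d: "0 < a - 2 * pi * real i" by (simp add: a_def)
      have pos: "0 < \<xi> - a + 2 * pi * real i" "0 < \<eta> - a + 2 * pi * real i"
        using that by (auto intro!: add_pos_nonneg)
      show "g (\<xi> - a + 2 * pi * real i) / g \<xi> \<le> g (\<eta> - a + 2 * pi * real i) / g \<eta>"
        using ratio_inverse[OF pos(2,1) d ratio[rule_format, OF d pos(1)]] that by simp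
    qed
    show ?thesis
      unfolding a_def[symmetric]
    proof (rule quotient_monotone_split[where P=R and Q="\<lambda>\<xi>. L \<xi> + T \<xi>"])
      show "mono_on {a<..<a + 2 * pi} R \<and> antimono_on {a<..<a + 2 * pi} (\<lambda>\<xi>. L \<xi> + T \<xi>)
         \<or> antimono_on {a<..<a + 2 * pi} R \<and> mono_on {a<..<a + 2 * pi} (\<lambda>\<xi>. L \<xi> + T \<xi>)"
        by (intro disjI2 conjI monotone_onI) (auto intro!: add_mono Rm Tmono Lm)
      show "cardinal_symbol g \<xi> = 1 / (1 + R \<xi> + (L \<xi> + T \<xi>))" if "a < \<xi>" "\<xi> < a + 2 * pi" for \<xi>
        using m[OF that] by (simp add: add_ac)
    qed (use bound L0 R0 T0 in auto)
  qed
qed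

lemma cardinal_symbol_adm:
  assumes "p > 1" "interval_adm p A"
  shows "adm_kernel p (8 * A * suminf b) (fourier_kernel (cardinal_symbol g))"
proof (rule adm_kernel_pieces[OF assms b_pos b_summable cardinal_symbol_minus _ cardinal_symbol_pieces])
  show "cardinal_symbol g (2 * pi * of_int k) = 0" for k :: int
    by (auto simp: cardinal_symbol_def)
qed

end

section \<open>Bessel functions\<close>

definition bexp :: "real \<Rightarrow> (real \<Rightarrow> real) \<Rightarrow> real \<Rightarrow> real" where
  "bexp x f t = indicator {0..} t * (exp (- x * cosh t) * f t)"

lemma bessel_K_bexp: "bessel_K \<nu> x = (LINT t|lborel. bexp x (\<lambda>t. cosh (\<nu> * t)) t)"
  by (simp add: bessel_K_def set_lebesgue_integral_def bexp_def)

lemma cosh_real_measurable [measurable]: "cosh \<in> borel_measurable (borel :: real measure)"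
  by (intro borel_measurable_continuous_onI continuous_intros)

lemma cosh_lower:
  fixes t :: real
  assumes "0 \<le> t"
  shows "t\<^sup>2 / 4 \<le> cosh t"
  using exp_lower_Taylor_quadratic[OF assms] exp_gt_zero[of "- t"] assms
  unfolding cosh_field_def by argo

text \<open>Completing the square in cosh t \<ge> t^2 / 4; the exponent M + 1 in place of M leaves
  the integrable factor exp (- t).\<close>

lemma exp_cosh_decay:
  fixes x t M :: real
  assumes "0 < x" "0 \<le> t"
  shows "exp (- x * cosh t) * exp (M * t) \<le> exp ((M + 1)\<^sup>2 / x) * exp (- t)"
proof -
  have "0 \<le> x * (t / 2 - (M + 1) / x)\<^sup>2" using assms by simp
  also have "\<dots> = x * (t\<^sup>2 / 4) - (M + 1) * t + (M + 1)\<^sup>2 / x"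
    using assms by (simp add: power2_eq_square field_simps)
  also have "\<dots> \<le> x * cosh t - (M + 1) * t + (M + 1)\<^sup>2 / x"
    using assms cosh_lower[of t] by (intro add_right_mono diff_right_mono mult_left_mono) auto
  finally show ?thesis by (simp add: exp_add[symmetric] algebra_simps)
qed

lemma integrable_exp_minus_atLeast_0: "integrable lborel (\<lambda>t::real. indicator {0..} t * exp (- t))"
proof (rule integrableI_nonneg)
  have lim: "((\<lambda>t::real. - exp (- t)) \<longlongrightarrow> - 0) at_top"
    by (intro tendsto_minus filterlim_compose[OF exp_at_bot] filterlim_uminus_at_bot_at_top)
  have "(\<integral>\<^sup>+t. ennreal (exp (- t)) * indicator {0..} t \<partial>lborel) = ennreal (- 0 - (- exp (- 0 :: real)))"
    by (rule nn_integral_FTC_atLeast[OF _ _ _ lim]) (auto intro!: derivative_eq_intros)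
  moreover have "(\<integral>\<^sup>+t. ennreal (exp (- t)) * indicator {0..} t \<partial>lborel)
      = (\<integral>\<^sup>+t. ennreal (indicator {0..} t * exp (- t :: real)) \<partial>lborel)"
    by (intro nn_integral_cong) (auto simp: indicator_def)
  ultimately show "(\<integral>\<^sup>+t. ennreal (indicator {0..} t * exp (- t :: real)) \<partial>lborel) < \<infinity>"
    by (metis ennreal_less_top infinity_ennreal_def)
qed auto

lemma bexp_integrable:
  assumes [measurable]: "f \<in> borel_measurable borel" and x: "0 < x"
    and f: "\<And>t. 0 \<le> t \<Longrightarrow> \<bar>f t\<bar> \<le> exp (M * t)"
  shows "integrable lborel (bexp x f)"
proof (rule Bochner_Integration.integrable_bound)
  show "integrable lborel (\<lambda>t. exp ((M + 1)\<^sup>2 / x) * (indicator {0..} t * exp (- t)))"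
    by (intro integrable_mult_right integrable_exp_minus_atLeast_0)
  show "bexp x f \<in> borel_measurable lborel" unfolding bexp_def[abs_def] by measurable
  show "AE t in lborel. norm (bexp x f t) \<le> norm (exp ((M + 1)\<^sup>2 / x) * (indicator {0..} t * exp (- t)))"
  proof (intro AE_I2)
    fix t :: real
    show "norm (bexp x f t) \<le> norm (exp ((M + 1)\<^sup>2 / x) * (indicator {0..} t * exp (- t)))"
    proof (cases "0 \<le> t")
      case True
      then have "exp (- x * cosh t) * \<bar>f t\<bar> \<le> exp (- x * cosh t) * exp (M * t)"
        by (intro mult_left_mono f) auto
      also have "\<dots> \<le> exp ((M + 1)\<^sup>2 / x) * exp (- t)" by (rule exp_cosh_decay[OF x True])
      finally show ?thesis using True by (simp add: bexp_def abs_mult)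
    qed (simp add: bexp_def)
  qed
qed

lemma cosh_le_exp_abs: "cosh (x::real) \<le> exp \<bar>x\<bar>"
  unfolding cosh_field_def using exp_le_cancel_iff[of x "\<bar>x\<bar>"] exp_le_cancel_iff[of "- x" "\<bar>x\<bar>"] by argo

lemma cosh_mult_le: "0 \<le> t \<Longrightarrow> cosh (\<nu> * t :: real) \<le> exp (\<bar>\<nu>\<bar> * t)"
  using cosh_le_exp_abs[of "\<nu> * t"] by (simp add: abs_mult)

lemma bessel_K_integrable: "0 < x \<Longrightarrow> integrable lborel (bexp x (\<lambda>t. cosh (\<nu> * t)))"
  by (rule bexp_integrable[where M="\<bar>\<nu>\<bar>"]) (auto intro: cosh_mult_le)

lemma bexp_cmult_exp: "bexp (x + d) f t = bexp x f t * exp (- d * cosh t)"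
  by (simp add: bexp_def exp_add[symmetric] algebra_simps)

lemma bexp_nonneg: "(\<And>t. 0 \<le> t \<Longrightarrow> 0 \<le> f t) \<Longrightarrow> 0 \<le> bexp x f t"
  by (auto simp: bexp_def indicator_def)

lemma bessel_K_pos:
  assumes x: "0 < x"
  shows "0 < bessel_K \<nu> x"
proof -
  have "exp (- x * cosh 1) = (LINT t|lborel. indicator {0..1::real} t * exp (- x * cosh 1))"
    by simp
  also have "\<dots> \<le> (LINT t|lborel. bexp x (\<lambda>t. cosh (\<nu> * t)) t)"
  proof (intro integral_mono bessel_K_integrable x)
    fix t :: real
    have "exp (- x * cosh 1) * 1 \<le> exp (- x * cosh t) * cosh (\<nu> * t)" if "0 \<le> t" "t \<le> 1"
      using that x cosh_real_nonneg_le_iff[of t 1] by (intro mult_mono) (auto simp: cosh_real_ge_1)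
    then show "indicator {0..1} t * exp (- x * cosh 1) \<le> bexp x (\<lambda>t. cosh (\<nu> * t)) t"
      by (auto simp: bexp_def indicator_def)
  qed simp
  finally show ?thesis unfolding bessel_K_bexp by (rule less_le_trans[OF exp_gt_zero])
qed

text \<open>Since cosh t \<ge> 1, the shift costs a factor exp (- d) under the integral. All
  exponential decay, and hence the uniformity in \<open>c\<close>, stems from this.\<close>

lemma bessel_K_shift_le:
  assumes x: "0 < x" "0 \<le> d"
  shows "bessel_K \<nu> (x + d) \<le> exp (- d) * bessel_K \<nu> x"
proof -
  have "(LINT t|lborel. bexp (x + d) (\<lambda>t. cosh (\<nu> * t)) t) \<le> (LINT t|lborel. exp (- d) * bexp x (\<lambda>t. cosh (\<nu> * t)) t)"
  proof (intro integral_mono bessel_K_integrable integrable_mult_right)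
    fix t :: real
    have "d * 1 \<le> d * cosh t" using x by (intro mult_left_mono cosh_real_ge_1) auto
    then have "bexp x (\<lambda>t. cosh (\<nu> * t)) t * exp (- d * cosh t) \<le> bexp x (\<lambda>t. cosh (\<nu> * t)) t * exp (- d)"
      by (intro mult_left_mono bexp_nonneg) auto
    then show "bexp (x + d) (\<lambda>t. cosh (\<nu> * t)) t \<le> exp (- d) * bexp x (\<lambda>t. cosh (\<nu> * t)) t"
      by (simp add: bexp_cmult_exp mult.commute)
  qed (use x in auto)
  then show ?thesis by (simp add: bessel_K_bexp)
qed

lemma bessel_K_minus: "bessel_K (- \<nu>) x = bessel_K \<nu> x"
  by (simp add: bessel_K_def)

section \<open>Ratios of Bessel functions by correlation inequalities\<close>

text \<open>Chebyshev's correlation inequality: similarly ordered functions are positively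
  correlated under a nonnegative weight. The symmetrised product is integrated in \<open>t\<close>
  for fixed \<open>s\<close> and then in \<open>s\<close>, which avoids a product measure.\<close>

lemma chebyshev_integral_le:
  fixes w f h :: "'a \<Rightarrow> real"
  assumes w: "integrable M w" "integrable M (\<lambda>t. w t * f t)" "integrable M (\<lambda>t. w t * h t)"
      "integrable M (\<lambda>t. w t * f t * h t)"
    and mono: "\<And>s t. 0 \<le> w s * w t * ((f s - f t) * (h s - h t))"
  shows "(LINT t|M. w t * f t) * (LINT t|M. w t * h t) \<le> (LINT t|M. w t) * (LINT t|M. w t * f t * h t)"
proof -
  define I0 If Ih Ifh where "I0 = (LINT t|M. w t)" and "If = (LINT t|M. w t * f t)"
    and "Ih = (LINT t|M. w t * h t)" and "Ifh = (LINT t|M. w t * f t * h t)"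
  have 1: "0 \<le> w s * f s * h s * I0 - w s * f s * Ih - w s * h s * If + w s * Ifh" for s
  proof -
    have "0 \<le> (LINT t|M. w s * w t * ((f s - f t) * (h s - h t)))"
      by (intro Bochner_Integration.integral_nonneg mono)
    also have "\<dots> = (LINT t|M. w s * f s * h s * w t - w s * f s * (w t * h t) - w s * h s * (w t * f t) + w s * (w t * f t * h t))"
      by (intro Bochner_Integration.integral_cong) (auto simp: algebra_simps)
    also have "\<dots> = w s * f s * h s * I0 - w s * f s * Ih - w s * h s * If + w s * Ifh"
      using w by (simp add: I0_def If_def Ih_def Ifh_def)
    finally show ?thesis .
  qed
  have "0 \<le> (LINT s|M. I0 * (w s * f s * h s) - Ih * (w s * f s) - If * (w s * h s) + Ifh * w s)"
    using 1 by (intro Bochner_Integration.integral_nonneg) (simp add: mult_ac)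
  also have "\<dots> = I0 * Ifh - Ih * If - If * Ih + Ifh * I0"
    using w by (simp add: I0_def If_def Ih_def Ifh_def)
  finally show ?thesis by (simp add: I0_def If_def Ih_def Ifh_def mult.commute)
qed

text \<open>Log-convexity of K in its argument. Passing from x to x + d, or from x to y, multiplies
  the integrand by a decreasing function of cosh t, so the two factors are similarly
  ordered.\<close>

lemma bessel_K_shift_ratio:
  assumes x: "0 < x" "x \<le> y" "0 \<le> d"
  shows "bessel_K \<nu> (x + d) * bessel_K \<nu> y \<le> bessel_K \<nu> (y + d) * bessel_K \<nu> x"
proof -
  let ?w = "bexp x (\<lambda>t. cosh (\<nu> * t))"
  let ?f = "\<lambda>t. exp (- d * cosh t)" and ?h = "\<lambda>t. exp (- (y - x) * cosh t)"
  have f: "?w t * ?f t = bexp (x + d) (\<lambda>t. cosh (\<nu> * t)) t" for t by (simp add: bexp_cmult_exp)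
  have h: "?w t * ?h t = bexp y (\<lambda>t. cosh (\<nu> * t)) t" for t
    using bexp_cmult_exp[of x "y - x" "\<lambda>t. cosh (\<nu> * t)" t] by simp
  have fh: "bexp (x + d) (\<lambda>t. cosh (\<nu> * t)) t * ?h t = bexp (y + d) (\<lambda>t. cosh (\<nu> * t)) t" for t
    using bexp_cmult_exp[of "x + d" "y - x" "\<lambda>t. cosh (\<nu> * t)" t] by (simp add: add.commute[of y d])
  have "(LINT t|lborel. ?w t * ?f t) * (LINT t|lborel. ?w t * ?h t) \<le> (LINT t|lborel. ?w t) * (LINT t|lborel. ?w t * ?f t * ?h t)"
  proof (rule chebyshev_integral_le)
    show "0 \<le> ?w s * ?w t * ((?f s - ?f t) * (?h s - ?h t))" for s t
    proof -
      have A: "0 \<le> (?f s - ?f t) * (?h s - ?h t)"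
      proof (cases "cosh s \<le> cosh t")
        case True
        then have "d * cosh s \<le> d * cosh t" using x by (intro mult_left_mono)
        moreover have "(x - y) * cosh t \<le> (x - y) * cosh s" using True x by (intro mult_left_mono_neg) auto
        ultimately show ?thesis by (intro mult_nonneg_nonneg) auto
      next
        case False
        then have "d * cosh t \<le> d * cosh s" using x by (intro mult_left_mono) auto
        moreover have "(x - y) * cosh s \<le> (x - y) * cosh t" using False x by (intro mult_left_mono_neg) auto
        ultimately show ?thesis by (intro mult_nonpos_nonpos) auto
      qed
      show ?thesis by (intro mult_nonneg_nonneg[OF _ A] mult_nonneg_nonneg bexp_nonneg) auto
    qed
    show "integrable lborel ?w" "integrable lborel (\<lambda>t. ?w t * ?f t)" "integrable lborel (\<lambda>t. ?w t * ?h t)"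
      "integrable lborel (\<lambda>t. ?w t * ?f t * ?h t)"
      unfolding f fh h using x by (auto intro!: bessel_K_integrable)
  qed
  then show ?thesis unfolding f fh h bessel_K_bexp by (simp only: mult.commute)
qed

text \<open>The quotient cosh (\<mu> t) / cosh ((\<mu> - 1) t) increases on the half line: after
  turning products into sums, the arguments on the right dominate those on the left one by
  one.\<close>

lemma cosh_quotient_cross:
  fixes \<mu> s t :: real
  assumes "1 \<le> \<mu>" "0 \<le> s" "s \<le> t"
  shows "cosh (\<mu> * s) * cosh ((\<mu> - 1) * t) \<le> cosh (\<mu> * t) * cosh ((\<mu> - 1) * s)"
proof -
  have prod: "cosh a * cosh b = (cosh (a + b) + cosh (a - b)) / 2" for a b :: real
    by (simp add: cosh_add cosh_diff)
  have mono: "cosh a \<le> cosh b" if "\<bar>a\<bar> \<le> b" for a b :: real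
    using that cosh_real_nonneg_le_iff[of "\<bar>a\<bar>" b] by simp
  have "0 \<le> (\<mu> - 1) * (t - s)" "0 \<le> \<mu> * (t - s)" using assms by simp_all
  then have 1: "\<bar>\<mu> * s - (\<mu> - 1) * t\<bar> \<le> \<mu> * t - (\<mu> - 1) * s"
    using assms by (auto simp: abs_le_iff algebra_simps)
  have 0: "0 \<le> \<mu> * s + (\<mu> - 1) * t" using assms by (intro add_nonneg_nonneg mult_nonneg_nonneg) auto
  then have 2: "\<bar>\<mu> * s + (\<mu> - 1) * t\<bar> \<le> \<mu> * t + (\<mu> - 1) * s"
    using assms by (subst abs_of_nonneg) (auto simp: algebra_simps)
  show ?thesis unfolding prod using mono[OF 1] mono[OF 2] by simp
qed

text \<open>Correlation against the integrand of K_(\<mu>-1): raising the order multiplies it by an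
  increasing function, raising the argument by a decreasing one. The minus sign in \<open>?h\<close>
  aligns the two.\<close>

lemma bessel_K_order_ratio:
  assumes x: "0 < x" "x \<le> y" and mu: "1 \<le> \<mu>"
  shows "bessel_K (\<mu> - 1) x * bessel_K \<mu> y \<le> bessel_K (\<mu> - 1) y * bessel_K \<mu> x"
proof -
  let ?w = "bexp x (\<lambda>t. cosh ((\<mu> - 1) * t))"
  let ?f = "\<lambda>t. cosh (\<mu> * t) / cosh ((\<mu> - 1) * t)" and ?h = "\<lambda>t. - exp (- (y - x) * cosh t)"
  have f: "?w t * ?f t = bexp x (\<lambda>t. cosh (\<mu> * t)) t" for t by (simp add: bexp_def)
  have h: "?w t * ?h t = - bexp y (\<lambda>t. cosh ((\<mu> - 1) * t)) t" for t
    using bexp_cmult_exp[of x "y - x" "\<lambda>t. cosh ((\<mu> - 1) * t)" t] by simp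
  have fh: "bexp x (\<lambda>t. cosh (\<mu> * t)) t * ?h t = - bexp y (\<lambda>t. cosh (\<mu> * t)) t" for t
    using bexp_cmult_exp[of x "y - x" "\<lambda>t. cosh (\<mu> * t)" t] by simp
  have inc: "0 \<le> (?f s - ?f t) * (?h s - ?h t)" if "0 \<le> s" "s \<le> t" for s t
  proof -
    have "?f s \<le> ?f t"
      using cosh_quotient_cross[OF mu that] by (simp add: divide_simps)
    moreover have "cosh s \<le> cosh t" using that cosh_real_nonneg_le_iff[of s t] by simp
    then have "(x - y) * cosh t \<le> (x - y) * cosh s" using x by (intro mult_left_mono_neg) auto
    then have "?h s \<le> ?h t" by simp
    ultimately show ?thesis by (intro mult_nonpos_nonpos) auto
  qed
  have "(LINT t|lborel. ?w t * ?f t) * (LINT t|lborel. ?w t * ?h t) \<le> (LINT t|lborel. ?w t) * (LINT t|lborel. ?w t * ?f t * ?h t)"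
  proof (rule chebyshev_integral_le)
    show "0 \<le> ?w s * ?w t * ((?f s - ?f t) * (?h s - ?h t))" for s t
    \<comment> \<open>Both factors are even in \<open>t\<close>, hence monotone only on the half
      line; elsewhere the weight vanishes.\<close>
    proof (cases "0 \<le> s \<and> 0 \<le> t")
      case True
      have A: "0 \<le> (?f s - ?f t) * (?h s - ?h t)"
      proof (cases "s \<le> t")
        case True
        then show ?thesis using inc[of s t] \<open>0 \<le> s \<and> 0 \<le> t\<close> by blast
      next
        case False
        then have "0 \<le> t" "t \<le> s" using \<open>0 \<le> s \<and> 0 \<le> t\<close> by auto
        then have "0 \<le> (?f t - ?f s) * (?h t - ?h s)" by (rule inc)
        moreover have "(a - b) * (c - d) = (b - a) * (d - c)" for a b c d :: real by (simp add: algebra_simps)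
        ultimately show ?thesis by metis
      qed
      show ?thesis by (intro mult_nonneg_nonneg[OF _ A] mult_nonneg_nonneg bexp_nonneg) auto
    next
      case False
      then have "?w s = 0 \<or> ?w t = 0" by (auto simp: bexp_def)
      then show ?thesis by auto
    qed
    show "integrable lborel ?w" "integrable lborel (\<lambda>t. ?w t * ?f t)" "integrable lborel (\<lambda>t. ?w t * ?h t)"
      "integrable lborel (\<lambda>t. ?w t * ?f t * ?h t)"
      unfolding f fh h using x by (auto intro!: bessel_K_integrable)
  qed
  then show ?thesis unfolding f fh h bessel_K_bexp by (simp add: mult.commute)
qed

section \<open>The derivative of K and its recurrence\<close>

lemma exp_quadratic_remainder:
  fixes v :: real
  shows "\<bar>exp v - 1 - v\<bar> \<le> v\<^sup>2 * exp \<bar>v\<bar>"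
proof -
  have 0: "0 \<le> exp v - 1 - v" using exp_ge_add_one_self[of v] by linarith
  have "1 - v \<le> exp (- v)" using exp_ge_add_one_self[of "- v"] by simp
  then have "exp v * (1 - v) \<le> exp v * exp (- v)" by (intro mult_left_mono) auto
  then have 1: "exp v - 1 \<le> v * exp v" by (simp add: exp_minus algebra_simps)
  have "exp v - 1 - v \<le> v\<^sup>2 * exp \<bar>v\<bar>"
  proof (cases "0 \<le> v")
    case True
    have "exp v - 1 - v \<le> v * (exp v - 1)" using 1 by (simp add: algebra_simps)
    also have "\<dots> \<le> v * (v * exp v)" using 1 True by (intro mult_left_mono) auto
    finally show ?thesis using True by (simp add: power2_eq_square mult_ac)
  next
    case False
    have "exp v - 1 - v \<le> v * (exp v - 1)" using 1 by (simp add: algebra_simps)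
    also have "\<dots> \<le> v * v" using 0 False by (intro mult_left_mono_neg) auto
    also have "\<dots> \<le> v\<^sup>2 * exp \<bar>v\<bar>" by (simp add: power2_eq_square mult_le_cancel_left1)
    finally show ?thesis .
  qed
  then show ?thesis using 0 by simp
qed

lemma abs_sinh_le_exp: "\<bar>sinh (x::real)\<bar> \<le> exp \<bar>x\<bar>"
proof -
  have "\<bar>sinh x\<bar> \<le> cosh x"
    using sinh_less_cosh_real[of x] sinh_less_cosh_real[of "- x"] by (simp add: abs_le_iff)
  then show ?thesis using cosh_le_exp_abs[of x] by linarith
qed

lemma bexp_cosh_cosh_integrable:
  assumes "0 < x"
  shows "integrable lborel (bexp x (\<lambda>t. cosh t ^ n * cosh (\<mu> * t)))"
proof (rule bexp_integrable[where M="real n + \<bar>\<mu>\<bar>"])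
  fix t :: real assume t: "0 \<le> t"
  have "cosh t ^ n * cosh (\<mu> * t) \<le> exp t ^ n * exp (\<bar>\<mu>\<bar> * t)"
    using t cosh_le_exp_abs[of t] by (intro mult_mono power_mono cosh_mult_le) auto
  also have "\<dots> = exp ((real n + \<bar>\<mu>\<bar>) * t)"
    by (simp add: exp_of_nat_mult[symmetric] exp_add[symmetric] algebra_simps)
  finally show "\<bar>cosh t ^ n * cosh (\<mu> * t)\<bar> \<le> exp ((real n + \<bar>\<mu>\<bar>) * t)" by simp
qed (use assms in measurable)

text \<open>Differentiation under the integral sign, done directly: the first-order Taylor remainder
  of the integrand is at most (y - x)^2 times one integrable function.\<close>

lemma bessel_K_deriv_integral:
  assumes x: "0 < x"
  shows "(bessel_K \<mu> has_real_derivative - (LINT t|lborel. bexp x (\<lambda>t. cosh t * cosh (\<mu> * t)) t)) (at x)"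
proof -
  define D where "D = (LINT t|lborel. bexp x (\<lambda>t. cosh t * cosh (\<mu> * t)) t)"
  define C where "C = (LINT t|lborel. bexp (x / 2) (\<lambda>t. cosh t ^ 2 * cosh (\<mu> * t)) t)"
  \<comment> \<open>The radius x / 2 lets exp (- x cosh t) absorb the exponential in the remainder
    and still leave exp (- (x / 2) cosh t).\<close>
  have quad: "\<bar>bessel_K \<mu> y - bessel_K \<mu> x + (y - x) * D\<bar> \<le> (y - x)\<^sup>2 * C" if y: "\<bar>y - x\<bar> \<le> x / 2" for y
  proof -
    have y0: "0 < y" using x y by linarith
    note ints = bessel_K_integrable[OF x, of \<mu>] bessel_K_integrable[OF y0, of \<mu>]
      bexp_cosh_cosh_integrable[OF x, of 1 \<mu>, simplified]
    let ?r = "\<lambda>t. bexp y (\<lambda>t. cosh (\<mu> * t)) t - bexp x (\<lambda>t. cosh (\<mu> * t)) t + (y - x) * bexp x (\<lambda>t. cosh t * cosh (\<mu> * t)) t"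
    have e: "bessel_K \<mu> y - bessel_K \<mu> x + (y - x) * D = (LINT t|lborel. ?r t)"
      unfolding bessel_K_bexp D_def
      by (subst Bochner_Integration.integral_add[OF Bochner_Integration.integrable_diff[OF ints(2,1)] integrable_mult_right[OF ints(3)]],
          subst Bochner_Integration.integral_diff[OF ints(2,1)], subst integral_mult_right_zero, rule refl)
    have "\<bar>bessel_K \<mu> y - bessel_K \<mu> x + (y - x) * D\<bar> \<le> (LINT t|lborel. \<bar>?r t\<bar>)"
      unfolding e by (rule integral_abs_bound)
    also have "\<dots> \<le> (LINT t|lborel. (y - x)\<^sup>2 * bexp (x / 2) (\<lambda>t. cosh t ^ 2 * cosh (\<mu> * t)) t)"
    proof (intro integral_mono)
      show "integrable lborel (\<lambda>t. \<bar>?r t\<bar>)" using ints by auto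
      show "integrable lborel (\<lambda>t. (y - x)\<^sup>2 * bexp (x / 2) (\<lambda>t. cosh t ^ 2 * cosh (\<mu> * t)) t)"
        using x by (intro integrable_mult_right bexp_cosh_cosh_integrable) auto
      fix t :: real
      show "\<bar>?r t\<bar> \<le> (y - x)\<^sup>2 * bexp (x / 2) (\<lambda>t. cosh t ^ 2 * cosh (\<mu> * t)) t"
      proof (cases "0 \<le> t")
        case True
        define c where "c = cosh t"
        have c: "c > 0" by (simp add: c_def)
        define v where "v = - (y - x) * c"
        have "exp (- y * c) = exp (- x * c) * exp v" by (simp add: v_def exp_add[symmetric] algebra_simps)
        then have "?r t = exp (- x * c) * (exp v - 1 - v) * cosh (\<mu> * t)"
          using True by (simp add: bexp_def c_def[symmetric]) (simp add: v_def algebra_simps)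
        then have "\<bar>?r t\<bar> = exp (- x * c) * \<bar>exp v - 1 - v\<bar> * cosh (\<mu> * t)"
          by (simp add: abs_mult)
        also have "\<dots> \<le> exp (- x * c) * (v\<^sup>2 * exp \<bar>v\<bar>) * cosh (\<mu> * t)"
          by (intro mult_right_mono mult_left_mono exp_quadratic_remainder) auto
        also have "\<dots> \<le> exp (- x * c) * (v\<^sup>2 * exp (x / 2 * c)) * cosh (\<mu> * t)"
        proof -
          have "\<bar>v\<bar> = \<bar>y - x\<bar> * c" using c by (simp add: v_def abs_mult abs_minus_commute)
          also have "\<dots> \<le> x / 2 * c" using y c by (intro mult_right_mono) auto
          finally show ?thesis by (intro mult_right_mono mult_left_mono) auto
        qed
        also have "\<dots> = (y - x)\<^sup>2 * (exp (- x * c) * exp (x / 2 * c) * (c\<^sup>2 * cosh (\<mu> * t)))"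
          by (simp add: v_def power_mult_distrib power2_commute[of x y] mult_ac)
        also have "exp (- x * c) * exp (x / 2 * c) = exp (- (x / 2) * c)"
          by (simp add: exp_add[symmetric])
        finally show ?thesis using True by (simp add: bexp_def c_def)
      qed (simp add: bexp_def)
    qed
    finally show ?thesis by (simp add: C_def)
  qed
  have "((\<lambda>y. (bessel_K \<mu> y - bessel_K \<mu> x) / (y - x)) \<longlongrightarrow> - D) (at x)"
  proof (rule LIM_zero_cancel, rule Lim_null_comparison)
    show "\<forall>\<^sub>F y in at x. norm ((bessel_K \<mu> y - bessel_K \<mu> x) / (y - x) - - D) \<le> \<bar>y - x\<bar> * C"
      unfolding eventually_at
    proof (intro exI[of _ "x / 2"] conjI ballI impI)
      fix y assume "y \<noteq> x \<and> dist y x < x / 2"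
      then have y: "y - x \<noteq> 0" "\<bar>y - x\<bar> \<le> x / 2" by (auto simp: dist_real_def)
      have "(bessel_K \<mu> y - bessel_K \<mu> x) / (y - x) - - D = (bessel_K \<mu> y - bessel_K \<mu> x + (y - x) * D) / (y - x)"
        using y by (simp add: add_divide_distrib)
      then have "norm ((bessel_K \<mu> y - bessel_K \<mu> x) / (y - x) - - D) = \<bar>bessel_K \<mu> y - bessel_K \<mu> x + (y - x) * D\<bar> / \<bar>y - x\<bar>"
        by simp
      also have "\<dots> \<le> (y - x)\<^sup>2 * C / \<bar>y - x\<bar>" using quad[OF y(2)] by (intro divide_right_mono) auto
      also have "\<dots> = \<bar>y - x\<bar> * C"
      proof -
        have "(y - x)\<^sup>2 = \<bar>y - x\<bar> * \<bar>y - x\<bar>" by (simp add: power2_eq_square)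
        then show ?thesis using y by (simp only: mult.assoc) simp
      qed
      finally show "norm ((bessel_K \<mu> y - bessel_K \<mu> x) / (y - x) - - D) \<le> \<bar>y - x\<bar> * C" .
    qed (use x in auto)
    have "((\<lambda>y. \<bar>y - x\<bar> * C) \<longlongrightarrow> \<bar>x - x\<bar> * C) (at x)" by (intro tendsto_intros)
    then show "((\<lambda>y. \<bar>y - x\<bar> * C) \<longlongrightarrow> 0) (at x)" by simp
  qed
  then show ?thesis by (simp add: has_field_derivative_iff D_def)
qed

lemma bexp_sinh_sinh_integrable:
  assumes "0 < x"
  shows "integrable lborel (bexp x (\<lambda>t. sinh t * sinh (\<mu> * t)))"
proof (rule bexp_integrable[where M="1 + \<bar>\<mu>\<bar>"])
  fix t :: real assume t: "0 \<le> t"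
  have "\<bar>sinh t\<bar> * \<bar>sinh (\<mu> * t)\<bar> \<le> exp \<bar>t\<bar> * exp \<bar>\<mu> * t\<bar>"
    by (intro mult_mono abs_sinh_le_exp) auto
  also have "\<dots> = exp ((1 + \<bar>\<mu>\<bar>) * t)"
    using t by (simp add: exp_add[symmetric] abs_mult algebra_simps)
  finally show "\<bar>sinh t * sinh (\<mu> * t)\<bar> \<le> exp ((1 + \<bar>\<mu>\<bar>) * t)" by (simp add: abs_mult)
next
  show "(\<lambda>t. sinh t * sinh (\<mu> * t)) \<in> borel_measurable borel"
    by (intro borel_measurable_continuous_onI continuous_intros)
qed (rule assms)

text \<open>Integration by parts: \<open>F\<close> is an antiderivative of \<open>\<phi>\<close> on
  the half line and vanishes both at 0 and at infinity.\<close>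

lemma bexp_sinh_sinh_integral:
  assumes x: "0 < x"
  shows "x * (LINT t|lborel. bexp x (\<lambda>t. sinh t * sinh (\<mu> * t)) t) = \<mu> * bessel_K \<mu> x"
proof -
  define \<phi> where "\<phi> t = x * bexp x (\<lambda>t. sinh t * sinh (\<mu> * t)) t - \<mu> * bexp x (\<lambda>t. cosh (\<mu> * t)) t" for t
  define F where "F t = - exp (- x * cosh t) * sinh (\<mu> * t)" for t
  have int: "integrable lborel \<phi>"
    unfolding \<phi>_def[abs_def]
    by (intro Bochner_Integration.integrable_diff integrable_mult_right bexp_sinh_sinh_integrable bessel_K_integrable x)
  have ftc: "(LINT t|lborel. indicator {0..real n} t *\<^sub>R \<phi> t) = F (real n) - F 0" for n
  proof -
    define \<psi> where "\<psi> t = exp (- x * cosh t) * (x * sinh t * sinh (\<mu> * t) - \<mu> * cosh (\<mu> * t))" for t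
    have "has_bochner_integral lborel (\<lambda>t. indicator {0..real n} t *\<^sub>R \<psi> t) (F (real n) - F 0)"
    proof (rule has_bochner_integral_FTC_Icc)
      show "(F has_vector_derivative \<psi> t) (at t within {0..real n})" for t
        unfolding F_def \<psi>_def has_real_derivative_iff_has_vector_derivative[symmetric]
        by (auto intro!: derivative_eq_intros simp: algebra_simps)
      show "continuous_on {0..real n} \<psi>" unfolding \<psi>_def by (intro continuous_intros)
    qed auto
    moreover have "(LINT t|lborel. indicator {0..real n} t *\<^sub>R \<phi> t) = (LINT t|lborel. indicator {0..real n} t *\<^sub>R \<psi> t)"
      by (intro Bochner_Integration.integral_cong refl)
         (auto simp: \<phi>_def \<psi>_def bexp_def indicator_def algebra_simps)
    ultimately show ?thesis by (simp add: has_bochner_integral_iff)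
  qed
  have "(\<lambda>n. F (real n)) \<longlonglongrightarrow> 0"
  proof (rule Lim_null_comparison)
    define C where "C = exp ((\<bar>\<mu>\<bar> + 1)\<^sup>2 / x)"
    show "\<forall>\<^sub>F n in sequentially. norm (F (real n)) \<le> C * exp (- real n)"
    proof (intro always_eventually allI)
      fix n
      have "norm (F (real n)) = exp (- x * cosh (real n)) * \<bar>sinh (\<mu> * real n)\<bar>" by (simp add: F_def abs_mult)
      also have "\<dots> \<le> exp (- x * cosh (real n)) * exp (\<bar>\<mu>\<bar> * real n)"
        using abs_sinh_le_exp[of "\<mu> * real n"] by (intro mult_left_mono) (auto simp: abs_mult)
      also have "\<dots> \<le> C * exp (- real n)" unfolding C_def by (rule exp_cosh_decay[OF x]) simp
      finally show "norm (F (real n)) \<le> C * exp (- real n)" .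
    qed
    have "(\<lambda>n. exp (- real n)) \<longlonglongrightarrow> 0"
      by (intro filterlim_compose[OF exp_at_bot] filterlim_compose[OF filterlim_uminus_at_bot_at_top] filterlim_real_sequentially)
    then show "(\<lambda>n. C * exp (- real n)) \<longlonglongrightarrow> 0" by (rule tendsto_mult_right_zero)
  qed
  then have 1: "(\<lambda>n. LINT t|lborel. indicator {0..real n} t *\<^sub>R \<phi> t) \<longlonglongrightarrow> 0"
    unfolding ftc by (simp add: F_def)
  have 2: "(\<lambda>n. LINT t|lborel. indicator {0..real n} t *\<^sub>R \<phi> t) \<longlonglongrightarrow> (LINT t|lborel. \<phi> t)"
  proof (rule integral_dominated_convergence[where w="\<lambda>t. \<bar>\<phi> t\<bar>"])
    have [measurable]: "\<phi> \<in> borel_measurable lborel" using int by auto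
    show "\<phi> \<in> borel_measurable lborel" by measurable
    show "(\<lambda>t. indicator {0..real n} t *\<^sub>R \<phi> t) \<in> borel_measurable lborel" for n by measurable
    show "integrable lborel (\<lambda>t. \<bar>\<phi> t\<bar>)" using int by (rule integrable_abs)
    show "AE t in lborel. (\<lambda>n. indicator {0..real n} t *\<^sub>R \<phi> t) \<longlonglongrightarrow> \<phi> t"
    proof (intro AE_I2 tendsto_eventually)
      fix t
      show "\<forall>\<^sub>F n in sequentially. indicator {0..real n} t *\<^sub>R \<phi> t = \<phi> t"
        using eventually_ge_at_top[of "nat \<lceil>t\<rceil>"]
      proof eventually_elim
        case (elim n)
        then have "t \<le> real n" by linarith
        then show ?case by (cases "0 \<le> t") (auto simp: \<phi>_def bexp_def)
      qed
    qed
    show "AE t in lborel. norm (indicator {0..real n} t *\<^sub>R \<phi> t) \<le> \<bar>\<phi> t\<bar>" for n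
      by (intro AE_I2) (auto simp: indicator_def)
  qed
  have "(LINT t|lborel. \<phi> t) = 0" by (rule LIMSEQ_unique[OF 2 1])
  then show ?thesis
    unfolding \<phi>_def bessel_K_bexp using bexp_sinh_sinh_integrable[OF x, of \<mu>] bessel_K_integrable[OF x, of \<mu>]
    by simp
qed

text \<open>The addition formula splits cosh t cosh (\<mu> t) into cosh ((\<mu> - 1) t) and a
  product of sinh terms, whose integral was found by parts.\<close>

lemma bessel_K_deriv:
  assumes x: "0 < x"
  shows "(bessel_K \<mu> has_real_derivative - (bessel_K (\<mu> - 1) x + \<mu> / x * bessel_K \<mu> x)) (at x)"
proof -
  have "(LINT t|lborel. bexp x (\<lambda>t. cosh t * cosh (\<mu> * t)) t)
      = (LINT t|lborel. bexp x (\<lambda>t. cosh ((\<mu> - 1) * t)) t + bexp x (\<lambda>t. sinh t * sinh (\<mu> * t)) t)"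
  proof (intro Bochner_Integration.integral_cong refl)
    fix t
    have e: "cosh t * cosh (\<mu> * t) = cosh ((\<mu> - 1) * t) + sinh t * sinh (\<mu> * t)"
      using cosh_diff[of "\<mu> * t" t] by (simp add: left_diff_distrib)
    show "bexp x (\<lambda>t. cosh t * cosh (\<mu> * t)) t = bexp x (\<lambda>t. cosh ((\<mu> - 1) * t)) t + bexp x (\<lambda>t. sinh t * sinh (\<mu> * t)) t"
      unfolding bexp_def e by (simp add: distrib_left)
  qed
  also have "\<dots> = bessel_K (\<mu> - 1) x + (LINT t|lborel. bexp x (\<lambda>t. sinh t * sinh (\<mu> * t)) t)"
    unfolding bessel_K_bexp by (intro Bochner_Integration.integral_add bexp_sinh_sinh_integrable bessel_K_integrable x)
  also have "(LINT t|lborel. bexp x (\<lambda>t. sinh t * sinh (\<mu> * t)) t) = \<mu> / x * bessel_K \<mu> x"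
    using bexp_sinh_sinh_integral[OF x, of \<mu>] x by (simp add: field_simps)
  finally show ?thesis using bessel_K_deriv_integral[OF x, of \<mu>] by simp
qed

section \<open>Monotonicity and decay of the Bessel profile\<close>

text \<open>The transform of the multiquadric as a function of c |\<xi>|, up to a constant factor
  that cancels in the quotient.\<close>

definition bessel_profile :: "real \<Rightarrow> real \<Rightarrow> real" where
  "bessel_profile \<nu> x = x powr (- \<nu>) * bessel_K \<nu> x"

lemma bessel_profile_pos: "0 < x \<Longrightarrow> 0 < bessel_profile \<nu> x"
  by (simp add: bessel_profile_def bessel_K_pos)

lemma bessel_profile_shift_le:
  assumes x: "0 < x" "0 \<le> d"
  shows "bessel_profile \<nu> (x + d) \<le> ((x + d) / x) powr \<bar>\<nu>\<bar> * exp (- d) * bessel_profile \<nu> x"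
proof -
  have "(x + d) powr (- \<nu>) = ((x + d) / x) powr (- \<nu>) * x powr (- \<nu>)"
    using x by (simp add: powr_divide)
  also have "\<dots> \<le> ((x + d) / x) powr \<bar>\<nu>\<bar> * x powr (- \<nu>)"
    using x by (intro mult_right_mono powr_mono) auto
  finally have "(x + d) powr (- \<nu>) * bessel_K \<nu> (x + d) \<le> (((x + d) / x) powr \<bar>\<nu>\<bar> * x powr (- \<nu>)) * (exp (- d) * bessel_K \<nu> x)"
    using x by (intro mult_mono bessel_K_shift_le) (auto intro!: less_imp_le[OF bessel_K_pos])
  then show ?thesis by (simp add: bessel_profile_def mult_ac)
qed

text \<open>For \<nu> \<ge> 0 the quotient is a product of two increasing factors, a power and a
  quotient of Bessel functions. For negative order the power factor turns around, so another
  argument is needed there.\<close>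

lemma bessel_profile_ratio_mono:
  assumes nu: "0 \<le> \<nu>" and x: "0 < x" "x \<le> y" "0 < d"
  shows "bessel_profile \<nu> (x + d) / bessel_profile \<nu> x \<le> bessel_profile \<nu> (y + d) / bessel_profile \<nu> y"
proof -
  have K: "bessel_K \<nu> (x + d) / bessel_K \<nu> x \<le> bessel_K \<nu> (y + d) / bessel_K \<nu> y"
    using bessel_K_shift_ratio[of x y d \<nu>] bessel_K_pos[of x \<nu>] bessel_K_pos[of y \<nu>] x
    by (simp add: divide_simps)
  have "(y + d) / y \<le> (x + d) / x" using x by (simp add: field_simps)
  then have "((x + d) / x) powr (- \<nu>) \<le> ((y + d) / y) powr (- \<nu>)"
    using x nu by (intro powr_mono2') auto
  then have "((x + d) / x) powr (- \<nu>) * (bessel_K \<nu> (x + d) / bessel_K \<nu> x)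
      \<le> ((y + d) / y) powr (- \<nu>) * (bessel_K \<nu> (y + d) / bessel_K \<nu> y)"
    using x by (intro mult_mono K) (auto intro!: divide_nonneg_nonneg less_imp_le[OF bessel_K_pos])
  then show ?thesis using x by (simp add: bessel_profile_def powr_divide)
qed

lemma bessel_profile_anti_nonneg:
  assumes nu: "0 \<le> \<nu>" and x: "0 < x" "x \<le> y"
  shows "bessel_profile \<nu> y \<le> bessel_profile \<nu> x"
  unfolding bessel_profile_def
proof (rule mult_mono)
  have "bessel_K \<nu> y \<le> exp (- (y - x)) * bessel_K \<nu> x"
    using bessel_K_shift_le[of x "y - x" \<nu>] x by simp
  also have "\<dots> \<le> 1 * bessel_K \<nu> x"
    using x by (intro mult_right_mono less_imp_le[OF bessel_K_pos]) auto
  finally show "bessel_K \<nu> y \<le> bessel_K \<nu> x" by simp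
  show "y powr (- \<nu>) \<le> x powr (- \<nu>)" using nu x by (intro powr_mono2') auto
qed (use x in \<open>auto intro!: less_imp_le[OF bessel_K_pos]\<close>)

text \<open>For x^\<mu> K_\<mu> the term \<mu> / x of the recurrence cancels, which leaves a pure
  quotient of Bessel functions.\<close>

lemma ln_bessel_profile_deriv:
  assumes x: "0 < x"
  shows "((\<lambda>x. ln (bessel_profile (- \<mu>) x)) has_real_derivative - (bessel_K (\<mu> - 1) x / bessel_K \<mu> x)) (at x)"
proof -
  have K: "bessel_K \<mu> x > 0" by (rule bessel_K_pos[OF x])
  have "((\<lambda>x. \<mu> * ln x + ln (bessel_K \<mu> x)) has_real_derivative
      \<mu> * (1 / x) + - (bessel_K (\<mu> - 1) x + \<mu> / x * bessel_K \<mu> x) / bessel_K \<mu> x) (at x)"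
    using x K bessel_K_deriv[OF x, of \<mu>] by (auto intro!: derivative_eq_intros)
  moreover have "\<mu> * (1 / x) + - (bessel_K (\<mu> - 1) x + \<mu> / x * bessel_K \<mu> x) / bessel_K \<mu> x
      = - (bessel_K (\<mu> - 1) x / bessel_K \<mu> x)"
    using x K by (simp add: field_simps)
  ultimately have "((\<lambda>x. \<mu> * ln x + ln (bessel_K \<mu> x)) has_real_derivative - (bessel_K (\<mu> - 1) x / bessel_K \<mu> x)) (at x)"
    by simp
  then show ?thesis
  proof (rule DERIV_cong_ev[THEN iffD1, OF refl _ refl, rotated])
    show "\<forall>\<^sub>F y in nhds x. \<mu> * ln y + ln (bessel_K \<mu> y) = ln (bessel_profile (- \<mu>) y)"
      using eventually_nhds_in_open[of "{0<..}" x] x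
      by (auto elim!: eventually_mono simp: bessel_profile_def bessel_K_minus ln_mult ln_powr bessel_K_pos
          less_imp_neq[OF bessel_K_pos, THEN not_sym])
  qed
qed

lemma bessel_profile_anti_neg:
  assumes mu: "1 \<le> \<mu>" and x: "0 < x" "x \<le> y"
  shows "bessel_profile (- \<mu>) y \<le> bessel_profile (- \<mu>) x"
proof -
  have "ln (bessel_profile (- \<mu>) y) \<le> ln (bessel_profile (- \<mu>) x)"
  proof (rule DERIV_nonpos_imp_nonincreasing[OF x(2)])
    fix t assume t: "x \<le> t" "t \<le> y"
    then have "0 < t" using x by simp
    then have "- (bessel_K (\<mu> - 1) t / bessel_K \<mu> t) \<le> 0"
      by (auto intro!: divide_nonneg_nonneg less_imp_le[OF bessel_K_pos])
    then show "\<exists>D. ((\<lambda>x. ln (bessel_profile (- \<mu>) x)) has_real_derivative D) (at t) \<and> D \<le> 0"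
      using ln_bessel_profile_deriv[OF \<open>0 < t\<close>, of \<mu>] by blast
  qed
  then show ?thesis using x bessel_profile_pos by simp
qed

text \<open>The logarithmic derivative - K_(\<mu>-1) / K_\<mu> decreases by
  \<open>bessel_K_order_ratio\<close>; thus the profile is log-concave and its shifted quotients
  decrease.\<close>

lemma bessel_profile_ratio_anti:
  assumes mu: "1 \<le> \<mu>" and x: "0 < x" "x \<le> y" "0 < d"
  shows "bessel_profile (- \<mu>) (y + d) / bessel_profile (- \<mu>) y \<le> bessel_profile (- \<mu>) (x + d) / bessel_profile (- \<mu>) x"
proof -
  let ?l = "\<lambda>x. ln (bessel_profile (- \<mu>) x)"
  have "?l (y + d) - ?l y \<le> ?l (x + d) - ?l x"
  proof (rule DERIV_nonpos_imp_nonincreasing[OF x(2), where f="\<lambda>t. ?l (t + d) - ?l t"])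
    fix t assume t: "x \<le> t" "t \<le> y"
    then have t0: "0 < t" "0 < t + d" using x by auto
    have "((\<lambda>t. ?l (t + d)) has_real_derivative - (bessel_K (\<mu> - 1) (t + d) / bessel_K \<mu> (t + d))) (at t)"
      using ln_bessel_profile_deriv[OF t0(2), of \<mu>] by (simp add: DERIV_shift)
    then have "((\<lambda>t. ?l (t + d) - ?l t) has_real_derivative
       - (bessel_K (\<mu> - 1) (t + d) / bessel_K \<mu> (t + d)) - - (bessel_K (\<mu> - 1) t / bessel_K \<mu> t)) (at t)"
      by (intro DERIV_diff ln_bessel_profile_deriv t0)
    moreover have "- (bessel_K (\<mu> - 1) (t + d) / bessel_K \<mu> (t + d)) - - (bessel_K (\<mu> - 1) t / bessel_K \<mu> t) \<le> 0"
      using bessel_K_order_ratio[OF t0(1) _ mu, of "t + d"] bessel_K_pos[OF t0(1), of \<mu>] bessel_K_pos[OF t0(2), of \<mu>] x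
      by (simp add: divide_simps)
    ultimately show "\<exists>D. ((\<lambda>t. ?l (t + d) - ?l t) has_real_derivative D) (at t) \<and> D \<le> 0" by blast
  qed
  then have "ln (bessel_profile (- \<mu>) (y + d) / bessel_profile (- \<mu>) y) \<le> ln (bessel_profile (- \<mu>) (x + d) / bessel_profile (- \<mu>) x)"
    using x by (simp add: ln_div bessel_profile_pos less_imp_neq[OF bessel_profile_pos, THEN not_sym])
  then show ?thesis using x by (simp add: bessel_profile_pos)
qed

text \<open>From ln v \<le> v - 1 at v = u e / M; it trades a power for an exponential of rate as
  small as desired.\<close>

lemma powr_le_exp:
  fixes u M e :: real
  assumes "0 < M" "0 < e" "0 < u"
  shows "u powr M \<le> (M / e) powr M * exp (e * u)"
proof -
  have "ln (u * e / M) \<le> u * e / M - 1" using assms by (intro ln_le_minus_one) auto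
  then have "ln u \<le> u * e / M + ln (M / e)" using assms by (simp add: ln_mult ln_div)
  then have "M * ln u \<le> M * (u * e / M + ln (M / e))" using assms by (intro mult_left_mono) auto
  also have "\<dots> = M * ln (M / e) + e * u" using assms by (simp add: algebra_simps)
  finally have "exp (M * ln u) \<le> exp (M * ln (M / e) + e * u)" by simp
  then show ?thesis using assms by (simp add: powr_def exp_add)
qed

lemma summable_exp_minus_mult:
  assumes "0 < (a::real)"
  shows "summable (\<lambda>k. exp (- (a * real k)))"
proof -
  have "exp (- (a * real k)) = exp (- a) ^ k" for k by (simp add: exp_of_nat_mult[symmetric] mult.commute)
  then show ?thesis using assms by (simp add: summable_geometric)
qed

text \<open>A bound for the profile at 2 pi k relative to 2 pi. The base k + 1 keeps the value at 0
  positive, and the exponent 1 - k reflects that the shift is counted from 2 pi.\<close>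

definition decay_weight :: "real \<Rightarrow> nat \<Rightarrow> real" where
  "decay_weight M k = (real k + 1) powr M * exp (1 - real k)"

lemma decay_weight_summable:
  assumes M: "0 < M"
  shows "summable (decay_weight M)"
proof (rule summable_comparison_test')
  show "summable (\<lambda>k. (M / (1/2)) powr M * exp (3/2) * exp (- (1/2 * real k)))"
    by (intro summable_mult summable_exp_minus_mult) auto
  show "norm (decay_weight M k) \<le> (M / (1/2)) powr M * exp (3/2) * exp (- (1/2 * real k))" if "0 \<le> k" for k
  proof -
    have "(real k + 1) powr M * exp (1 - real k) \<le> ((M / (1/2)) powr M * exp (1/2 * (real k + 1))) * exp (1 - real k)"
      using M by (intro mult_right_mono powr_le_exp) auto
    also have "\<dots> = (M / (1/2)) powr M * exp (3/2) * exp (- (1/2 * real k))"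
      by (simp add: mult.assoc exp_add[symmetric] field_simps)
    finally show ?thesis by (simp add: decay_weight_def)
  qed
qed

lemma bessel_radial_profile:
  assumes nu: "1 \<le> \<nu> \<or> \<nu> \<le> - 1" and c: "1 \<le> c"
  shows "radial_profile (\<lambda>\<xi>. bessel_profile \<nu> (c * \<xi>)) (decay_weight \<bar>\<nu>\<bar>)"
proof
  have c0: "0 < c" and M: "0 < \<bar>\<nu>\<bar>" using c nu by auto
  let ?g = "\<lambda>\<xi>. bessel_profile \<nu> (c * \<xi>)"
  show "0 < ?g x" if "0 < x" for x using that c0 by (intro bessel_profile_pos) simp
  show "?g y \<le> ?g x" if "0 < x" "x \<le> y" for x y
    using nu bessel_profile_anti_nonneg[of \<nu> "c * x" "c * y"] bessel_profile_anti_neg[of "- \<nu>" "c * x" "c * y"] that c0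
    by auto
  show "summable (\<lambda>i. ?g (x + 2 * pi * real i))" if x: "0 < x" for x
  proof (rule summable_comparison_test')
    \<comment> \<open>The rate x / 2 in \<open>powr_le_exp\<close> spends pi i of the available
      decay 2 pi i on the power and keeps the other half.\<close>
    define B where "B = (\<bar>\<nu>\<bar> / (x / 2)) powr \<bar>\<nu>\<bar> * exp (x / 2) * ?g x"
    show "summable (\<lambda>i. B * exp (- (pi * real i)))"
      by (intro summable_mult summable_exp_minus_mult) auto
    show "norm (?g (x + 2 * pi * real i)) \<le> B * exp (- (pi * real i))" if "0 \<le> i" for i
    proof -
      define u where "u = (x + 2 * pi * real i) / x"
      have u: "0 < u" using x by (auto simp: u_def intro!: divide_pos_pos add_pos_nonneg)
      have eu: "x / 2 * u = x / 2 + pi * real i" using x by (simp add: u_def field_simps)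
      have gx: "0 \<le> ?g x" using x c0 by (intro less_imp_le[OF bessel_profile_pos]) simp
      have "?g (x + 2 * pi * real i) = bessel_profile \<nu> (c * x + c * (2 * pi * real i))" by (simp add: algebra_simps)
      also have "\<dots> \<le> ((c * x + c * (2 * pi * real i)) / (c * x)) powr \<bar>\<nu>\<bar> * exp (- (c * (2 * pi * real i))) * ?g x"
        using x c0 by (intro bessel_profile_shift_le) auto
      also have "(c * x + c * (2 * pi * real i)) / (c * x) = u" using x c0 by (simp add: u_def field_simps)
      also have "u powr \<bar>\<nu>\<bar> * exp (- (c * (2 * pi * real i))) * ?g x
          \<le> ((\<bar>\<nu>\<bar> / (x / 2)) powr \<bar>\<nu>\<bar> * exp (x / 2 * u)) * exp (- (1 * (2 * pi * real i))) * ?g x"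
        using c M x u gx mult_right_mono[of 1 c "real i"]
        by (intro mult_right_mono mult_mono powr_le_exp) (auto intro!: mult_right_mono)
      also have "\<dots> = B * exp (- (pi * real i))"
        unfolding eu B_def by (simp add: exp_add exp_minus field_simps) (simp add: exp_add[symmetric])
      finally show ?thesis using bessel_profile_pos[of "c * (x + 2 * pi * real i)" \<nu>] c0 x
        by (simp add: add_pos_nonneg)
    qed
  qed
  show "(\<forall>d x y. 0 < d \<longrightarrow> 0 < x \<longrightarrow> x \<le> y \<longrightarrow> ?g (x + d) / ?g x \<le> ?g (y + d) / ?g y) \<or>
        (\<forall>d x y. 0 < d \<longrightarrow> 0 < x \<longrightarrow> x \<le> y \<longrightarrow> ?g (y + d) / ?g y \<le> ?g (x + d) / ?g x)"
    using nu
  proof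
    assume "1 \<le> \<nu>"
    then show ?thesis using c0
      by (intro disjI1 allI impI) (auto simp: distrib_left intro!: bessel_profile_ratio_mono)
  next
    assume "\<nu> \<le> - 1"
    then have "1 \<le> - \<nu>" by simp
    note * = bessel_profile_ratio_anti[OF this, unfolded minus_minus]
    show ?thesis using c0 by (intro disjI2 allI impI) (auto simp: distrib_left intro!: *)
  qed
  show "0 < decay_weight \<bar>\<nu>\<bar> k" for k by (simp add: decay_weight_def add_nonneg_pos)
  show "summable (decay_weight \<bar>\<nu>\<bar>)" by (rule decay_weight_summable[OF M])
  show "1 \<le> decay_weight \<bar>\<nu>\<bar> 0" by (simp add: decay_weight_def)
  show "?g (2 * pi * real k) \<le> decay_weight \<bar>\<nu>\<bar> k * ?g (2 * pi)" if k: "0 < k" for k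
  proof -
    define x d where "x = c * (2 * pi)" and "d = c * (2 * pi) * (real k - 1)"
    have x: "0 < x" using c0 by (simp add: x_def)
    have d: "0 \<le> d" using c0 k by (simp add: d_def)
    have xd: "c * (2 * pi * real k) = x + d" "(x + d) / x = real k"
      using x by (auto simp: x_def d_def field_simps)
    have "(real k - 1) * 1 \<le> (real k - 1) * (c * (2 * pi))"
    proof (intro mult_left_mono)
      have "1 * 1 \<le> c * (2 * pi)" using c pi_gt3 by (intro mult_mono) auto
      then show "1 \<le> c * (2 * pi)" by simp
    qed (use k in auto)
    then have ed: "exp (- d) \<le> exp (1 - real k)" by (simp add: d_def mult.commute)
    have "?g (2 * pi * real k) \<le> real k powr \<bar>\<nu>\<bar> * exp (- d) * bessel_profile \<nu> x"
      using bessel_profile_shift_le[OF x d, of \<nu>] unfolding xd by simp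
    also have "\<dots> \<le> (real k + 1) powr \<bar>\<nu>\<bar> * exp (1 - real k) * bessel_profile \<nu> x"
      using ed x by (intro mult_right_mono mult_mono powr_mono2) (auto intro!: less_imp_le[OF bessel_profile_pos])
    finally show ?thesis by (simp add: decay_weight_def x_def)
  qed
qed

section \<open>The operator norm\<close>

lemma summable_on_int_powr:
  assumes q: "(q::real) > 1"
  shows "(\<lambda>j::int. (1 + \<bar>x - of_int j\<bar>) powr - q) summable_on UNIV"
proof -
  let ?f = "\<lambda>j::int. (1 + \<bar>real_of_int j\<bar>) powr - q"
  have "summable (\<lambda>n. real n powr - q)" using q by (subst summable_real_powr_iff) simp
  then have "summable (\<lambda>n. real (Suc n) powr - q)" by (subst summable_Suc_iff)
  then have nat: "(\<lambda>n. (1 + real n) powr - q) summable_on UNIV"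
    by (intro summable_nonneg_imp_summable_on) auto
  have "?f summable_on range int"
    by (subst summable_on_reindex) (use nat in \<open>auto simp: o_def\<close>)
  moreover have "?f summable_on range (\<lambda>n. - int n)"
    by (subst summable_on_reindex) (use nat in \<open>auto simp: o_def inj_on_def\<close>)
  ultimately have "?f summable_on (range int \<union> range (\<lambda>n. - int n))" by (rule summable_on_union)
  moreover have "range int \<union> range (\<lambda>n. - int n) = UNIV"
  proof -
    have "j \<in> range int \<union> range (\<lambda>n. - int n)" for j by (cases j rule: int_cases2) auto
    then show ?thesis by blast
  qed
  ultimately have f: "?f summable_on UNIV" by simp
  have "bij_betw (\<lambda>j. j - \<lfloor>x\<rfloor>) UNIV (UNIV :: int set)"
    by (rule bij_betw_byWitness[where f'="\<lambda>j. j + \<lfloor>x\<rfloor>"]) auto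
  then have "(\<lambda>j. ?f (j - \<lfloor>x\<rfloor>)) summable_on UNIV"
    using f summable_on_reindex_bij_betw[of "\<lambda>j. j - \<lfloor>x\<rfloor>" UNIV UNIV ?f] by simp
  then have g: "(\<lambda>j. 2 powr q * ?f (j - \<lfloor>x\<rfloor>)) summable_on UNIV" by (rule summable_on_cmult_right)
  show ?thesis
  proof (rule summable_on_comparison_test[OF g])
    fix j :: int
    have "(1 + \<bar>real_of_int (j - \<lfloor>x\<rfloor>)\<bar>) / 2 \<le> 1 + \<bar>x - of_int j\<bar>"
    proof -
      have "\<bar>real_of_int (j - \<lfloor>x\<rfloor>)\<bar> \<le> \<bar>x - of_int j\<bar> + 1"
        using floor_correct[of x] unfolding of_int_diff by arith
      then show ?thesis using abs_ge_zero[of "x - of_int j"] by argo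
    qed
    then have "(1 + \<bar>x - of_int j\<bar>) powr - q \<le> ((1 + \<bar>real_of_int (j - \<lfloor>x\<rfloor>)\<bar>) / 2) powr - q"
      using q by (intro powr_mono2') auto
    also have "\<dots> = 2 powr q * ?f (j - \<lfloor>x\<rfloor>)"
      by (simp add: powr_divide powr_minus field_simps)
    finally show "(1 + \<bar>x - of_int j\<bar>) powr - q \<le> 2 powr q * ?f (j - \<lfloor>x\<rfloor>)" .
  qed auto
qed

text \<open>The decay 1 / (1 + |t|) alone just fails to be summable, but its \<open>q\<close>-th
  power is summable for q > 1, and Young's inequality pairs it with the \<open>p\<close>-th powers
  of the sequence.\<close>

lemma adm_kernel_abs_summable:
  assumes p: "p > 1" and K: "adm_kernel p B K" and y: "y \<in> ell p"
  shows "(\<lambda>j. y j * K (x - of_int j)) summable_on UNIV"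
proof -
  define q where "q = p / (p - 1)"
  have q: "q > 1" "1 / p + 1 / q = 1" using p by (auto simp: q_def field_simps)
  have B: "B \<ge> 0" "\<And>t. norm (K t) \<le> B / (1 + \<bar>t\<bar>)" using K by (auto simp: adm_kernel_def)
  have "(\<lambda>j. B * (norm (y j) powr p + (1 + \<bar>x - of_int j\<bar>) powr - q)) summable_on UNIV"
    using y by (intro summable_on_cmult_right summable_on_add summable_on_int_powr q) (simp add: ell_def)
  then show ?thesis
  proof (rule abs_summable_summable[OF summable_on_comparison_test])
    fix j :: int
    let ?a = "1 + \<bar>x - of_int j\<bar>"
    have a: "?a > 0" by simp
    have "norm (y j) * (1 / ?a) \<le> norm (y j) powr p / p + (1 / ?a) powr q / q"
      using a by (intro Youngs_inequality p q) auto
    also have "\<dots> \<le> norm (y j) powr p / 1 + (1 / ?a) powr q / 1"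
      using p q by (intro add_mono divide_left_mono) auto
    finally have young: "norm (y j) * (1 / ?a) \<le> norm (y j) powr p + (1 / ?a) powr q" by simp
    have aq: "(1 / ?a) powr q = ?a powr - q" using a by (simp add: powr_divide powr_minus_divide)
    have "norm (y j * K (x - of_int j)) \<le> norm (y j) * (B / ?a)"
      unfolding norm_mult by (intro mult_left_mono B) auto
    also have "norm (y j) * (B / ?a) = B * (norm (y j) * (1 / ?a))" by simp
    also have "B * (norm (y j) * (1 / ?a)) \<le> B * (norm (y j) powr p + ?a powr - q)"
      using mult_left_mono[OF young B(1)] unfolding aq .
    finally show "norm (y j * K (x - of_int j)) \<le> B * (norm (y j) powr p + ?a powr - q)" .
  qed auto
qed

lemma has_sum_imp_symmetric_partial_sums:
  fixes f :: "int \<Rightarrow> 'a::{comm_monoid_add, topological_space}"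
  assumes "(f has_sum S) UNIV"
  shows "(\<lambda>n. \<Sum>j\<in>{- int n..int n}. f j) \<longlonglongrightarrow> S"
proof (rule filterlim_compose[OF assms[unfolded has_sum_def]])
  show "filterlim (\<lambda>n. {- int n..int n}) (finite_subsets_at_top UNIV) sequentially"
    unfolding filterlim_finite_subsets_at_top
  proof (intro allI impI)
    fix X :: "int set" assume "finite X \<and> X \<subseteq> UNIV"
    then have X: "finite X" by simp
    define N where "N = Max (abs ` X)"
    have N: "\<bar>j\<bar> \<le> N" if "j \<in> X" for j
      unfolding N_def by (intro Max_ge finite_imageI imageI X that)
    show "\<forall>\<^sub>F n in sequentially. finite {- int n..int n} \<and> X \<subseteq> {- int n..int n} \<and> {- int n..int n} \<subseteq> UNIV"
      using eventually_ge_at_top[of "nat N"]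
    proof eventually_elim
      case (elim n)
      have "j \<in> {- int n..int n}" if "j \<in> X" for j using N[OF that] elim by auto
      then show ?case by auto
    qed
  qed
qed

text \<open>Finite sections obey the bound with the finite power sum, which is at most the full one;
  Fatou's lemma carries the estimate to the unordered sum.\<close>

lemma adm_kernel_opnorm_le:
  assumes p: "p > 1" and K: "adm_kernel p B K"
  shows "ell_Lp_opnorm p (\<lambda>y x. \<Sum>\<^sub>\<infinity>j\<in>UNIV. y j * K (x - of_int j)) \<le> ennreal B"
proof -
  let ?T = "\<lambda>y x. \<Sum>\<^sub>\<infinity>j\<in>(UNIV :: int set). y j * K (x - of_int j)"
  have B: "B \<ge> 0" and [measurable]: "K \<in> borel_measurable borel" and KL: "kernel_Lp p (B powr p) K"
    using K by (auto simp: adm_kernel_def)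
  have "?T y \<in> Lp p \<and> Lp_norm p (?T y) \<le> B * ell_norm p y" if y: "y \<in> ell p" for y
  proof -
    define S where "S n x = (\<Sum>j\<in>{- int n..int n}. y j * K (x - of_int j))" for n x
    define Y where "Y = (\<Sum>\<^sub>\<infinity>j\<in>(UNIV :: int set). norm (y j) powr p)"
    have Y: "Y \<ge> 0" unfolding Y_def by (intro infsum_nonneg) auto
    have [measurable]: "S n \<in> borel_measurable borel" for n unfolding S_def by measurable
    have lim: "(\<lambda>n. S n x) \<longlonglongrightarrow> ?T y x" for x
      unfolding S_def
      by (intro has_sum_imp_symmetric_partial_sums has_sum_infsum adm_kernel_abs_summable[OF p K y])
    have Tm [measurable]: "?T y \<in> borel_measurable borel"
      by (rule borel_measurable_LIMSEQ_metric[of S]) (use lim in auto)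
    have nn: "(\<integral>\<^sup>+x. ennreal (norm (?T y x) powr p) \<partial>lborel) \<le> ennreal (B powr p * Y)"
    proof (rule nn_integral_pointwise_limit_le)
      show "(\<lambda>x. ennreal (norm (S n x) powr p)) \<in> borel_measurable lborel" for n by measurable
      show "(\<lambda>n. ennreal (norm (S n x) powr p)) \<longlonglongrightarrow> ennreal (norm (?T y x) powr p)" for x
        using p by (intro tendsto_ennrealI tendsto_powr2 tendsto_norm lim tendsto_const) auto
      show "\<forall>\<^sub>F n in sequentially. (\<integral>\<^sup>+x. ennreal (norm (S n x) powr p) \<partial>lborel) \<le> ennreal (B powr p * Y)"
      proof (intro always_eventually allI)
        fix n
        have "(\<integral>\<^sup>+x. ennreal (norm (S n x) powr p) \<partial>lborel) \<le> ennreal (B powr p * (\<Sum>j\<in>{- int n..int n}. norm (y j) powr p))"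
          unfolding S_def by (rule kernel_LpD[OF KL]) simp
        also have "\<dots> \<le> ennreal (B powr p * Y)"
          unfolding Y_def using y
          by (intro ennreal_leI mult_left_mono finite_sum_le_infsum) (auto simp: ell_def)
        finally show "(\<integral>\<^sup>+x. ennreal (norm (S n x) powr p) \<partial>lborel) \<le> ennreal (B powr p * Y)" .
      qed
    qed auto
    have int: "integrable lborel (\<lambda>x. norm (?T y x) powr p)"
      by (rule integrableI_nonneg) (use nn in \<open>auto intro: le_less_trans\<close>)
    have "ennreal (LINT x|lborel. norm (?T y x) powr p) \<le> ennreal (B powr p * Y)"
      using nn int by (subst nn_integral_eq_integral[symmetric]) auto
    then have "(LINT x|lborel. norm (?T y x) powr p) \<le> B powr p * Y"
      using Y by (subst (asm) ennreal_le_iff) auto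
    then have "Lp_norm p (?T y) \<le> (B powr p * Y) powr (1 / p)"
      unfolding Lp_norm_def using p by (intro powr_mono2) auto
    also have "\<dots> = B * ell_norm p y"
      using B Y p by (simp add: powr_mult powr_powr ell_norm_def Y_def)
    finally show ?thesis using int Tm by (simp add: Lp_def)
  qed
  then show ?thesis
    unfolding ell_Lp_opnorm_def using B by (intro Inf_lower) blast
qed

section \<open>Identification of the fundamental function\<close>

lemma fundamental_fun_eq:
  assumes \<alpha>: "\<alpha> \<notin> \<nat>" and c: "0 < c"
  shows "fundamental_fun \<alpha> c x
    = 1 / (2 * of_real pi) * fourier_kernel (cardinal_symbol (\<lambda>\<xi>. bessel_profile (\<alpha> + 1/2) (c * \<xi>))) x"
proof -
  define \<nu> where "\<nu> = \<alpha> + 1/2"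
  \<comment> \<open>The factor \<open>c powr (2 * \<nu>)\<close> turns (c / |\<xi>|)^\<nu> into a
    power of c |\<xi>|.\<close>
  define \<kappa> where "\<kappa> = 2 powr (1 + \<alpha>) / Gamma (- \<alpha>) * c powr (2 * \<nu>)"
  have "- \<alpha> \<notin> \<int>\<^sub>\<le>\<^sub>0"
  proof
    assume "- \<alpha> \<in> \<int>\<^sub>\<le>\<^sub>0"
    then obtain n where "- \<alpha> = - of_nat n" by (elim nonpos_Ints_cases')
    then show False using \<alpha> by simp
  qed
  \<comment> \<open>At a pole \<open>Gamma\<close> takes the default value 0 and \<kappa> would
    vanish; excluding natural \<alpha> prevents this.\<close>
  then have \<kappa>: "\<kappa> \<noteq> 0" using c by (simp add: \<kappa>_def Gamma_eq_zero_iff)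
  let ?g = "\<lambda>\<xi>. bessel_profile \<nu> (c * \<xi>)"
  have hat: "multiquadric_hat \<alpha> c \<xi> = \<kappa> * ?g \<bar>\<xi>\<bar>" if "\<xi> \<noteq> 0" for \<xi>
  proof -
    have "(c / \<bar>\<xi>\<bar>) powr \<nu> = c powr (2 * \<nu>) * (c * \<bar>\<xi>\<bar>) powr (- \<nu>)"
    proof -
      have "c powr (2 * \<nu>) = c powr \<nu> * c powr \<nu>" by (simp add: powr_add[symmetric])
      then show ?thesis using c that by (simp add: powr_divide powr_mult powr_minus field_simps)
    qed
    then show ?thesis
      by (simp add: multiquadric_hat_def bessel_profile_def \<kappa>_def \<nu>_def mult_ac)
  qed
  have quot: "fundamental_quotient \<alpha> c \<xi> = cardinal_symbol ?g \<xi>" if "\<nexists>k::int. \<xi> = 2 * pi * of_int k" for \<xi>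
  proof -
    have nz: "\<xi> + 2 * pi * of_int j \<noteq> 0" for j :: int
    proof
      assume "\<xi> + 2 * pi * of_int j = 0"
      then have "\<xi> = 2 * pi * of_int (- j)" by simp
      then show False using that by blast
    qed
    have "(\<Sum>\<^sub>\<infinity>j\<in>(UNIV :: int set). multiquadric_hat \<alpha> c (\<xi> + 2 * pi * of_int j)) = \<kappa> * periodized ?g \<xi>"
      unfolding periodized_def infsum_cmult_right'[symmetric] hat[OF nz] ..
    moreover have "multiquadric_hat \<alpha> c \<xi> = \<kappa> * ?g \<bar>\<xi>\<bar>" using nz[of 0] by (intro hat) simp
    ultimately show ?thesis using that \<kappa> by (simp add: fundamental_quotient_def cardinal_symbol_def)
  qed
  have "fourier_kernel (fundamental_hat \<alpha> c) = fourier_kernel (cardinal_symbol ?g)"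
  proof (rule fourier_kernel_discrete_difference)
    show "countable (range (\<lambda>k::int. 2 * pi * of_int k))" by simp
    show "fundamental_hat \<alpha> c \<xi> = cardinal_symbol ?g \<xi>" if "\<xi> \<notin> range (\<lambda>k::int. 2 * pi * of_int k)" for \<xi>
      using that quot[of \<xi>] by (auto simp: fundamental_hat_def)
  qed
  moreover have "fundamental_fun \<alpha> c x = 1 / (2 * of_real pi) * fourier_kernel (fundamental_hat \<alpha> c) x"
    by (simp add: fundamental_fun_def fourier_kernel_def)
  ultimately show ?thesis by (simp only: \<nu>_def)
qed

theorem theorem22:
  fixes \<alpha> p :: real
  assumes "\<alpha> \<in> {..< -3/2} \<union> ({1/2..} - \<nat>)"
    and "1 < p"
  shows "(SUP c\<in>{1..}. ell_Lp_opnorm p (cardinal_interp \<alpha> c)) < \<infinity>"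
proof -
  define \<nu> where "\<nu> = \<alpha> + 1/2"
  have nu: "1 \<le> \<nu> \<or> \<nu> \<le> - 1" using assms(1) by (auto simp: \<nu>_def)
  have \<alpha>: "\<alpha> \<notin> \<nat>"
  proof
    assume "\<alpha> \<in> \<nat>"
    then have "0 \<le> \<alpha>" by (auto elim: Nats_cases)
    then show False using assms(1) \<open>\<alpha> \<in> \<nat>\<close> by auto
  qed
  obtain A where A: "interval_adm p A"
    using adm_kernel_interval[OF assms(2)] unfolding interval_adm_def by blast
  define C where "C = 8 * A * suminf (decay_weight \<bar>\<nu>\<bar>)"
  define B where "B = C * norm (1 / (2 * complex_of_real pi))"
  have "ell_Lp_opnorm p (cardinal_interp \<alpha> c) \<le> ennreal B" if c: "c \<in> {1..}" for c
  proof -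
    define K where "K = fourier_kernel (cardinal_symbol (\<lambda>\<xi>. bessel_profile \<nu> (c * \<xi>)))"
    have K: "adm_kernel p C K"
      unfolding K_def C_def
      by (rule radial_profile.cardinal_symbol_adm[OF bessel_radial_profile[OF nu] assms(2) A]) (use c in simp)
    then have "C \<ge> 0" by (simp add: adm_kernel_def)
    \<comment> \<open>A linear combination with a single term supplies the factor 1 / (2
      pi).\<close>
    then have "adm_kernel p (C * (\<Sum>i\<in>{()}. norm (1 / (2 * complex_of_real pi)))) (\<lambda>t. \<Sum>i\<in>{()}. 1 / (2 * complex_of_real pi) * K t)"
      by (intro adm_kernel_lincomb assms(2) K)
    then have "adm_kernel p B (\<lambda>t. 1 / (2 * complex_of_real pi) * K t)" by (simp add: B_def)
    moreover have "fundamental_fun \<alpha> c = (\<lambda>t. 1 / (2 * complex_of_real pi) * K t)"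
      using fundamental_fun_eq[OF \<alpha>, of c] c unfolding K_def \<nu>_def by auto
    ultimately have "adm_kernel p B (fundamental_fun \<alpha> c)" by simp
    from adm_kernel_opnorm_le[OF assms(2) this] show ?thesis
      by (simp add: cardinal_interp_def[abs_def])
  qed
  then have "(SUP c\<in>{1..}. ell_Lp_opnorm p (cardinal_interp \<alpha> c)) \<le> ennreal B"
    by (rule SUP_least)
  then show ?thesis by (rule le_less_trans) simp
qed

end
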